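(* Let $D=(V,E)$ be a finite strongly connected digraph without loops, $s,t\in V$ with $s\ne t$, and $f:V\to\{\text{robot},\text{obstacle},\text{hole}\}$ a configuration with the robot exactly at $s$. Then the algorithm FSCD described below, run on $(D,s,t,f)$, terminates and returns true if and only if the robot can be moved from $s$ to $t$ by a finite sequence of moves. FSCD: (1) Construct $\mathcal{G}(D)$ and $\mathcal{G}_{sbc}(D)=(V_{sbc},W_{sbc},E_{sbc})$. (2) While there is an obstacle on the $t$-side of the robot and a hole on the non-$t$-side of the robot, let $v$ be the robot's position and do: if $v\in W_{sbc}$: select a strongly biconnected component $B$ with $v\in V(B)$, no vertex of $B$ on the $t$-side of $v$, and at least one hole on the $w$-side of $v$ for some $w\in V(B)$, $w\neq v$; if $B$ contains no hole, pick $w\in V(B)\cap W_{sbc}$ such that some hole is on the non-$t$-side of $w$ and move one such hole to $w$ without moving the robot; then move a hole of $B$ to $v$, the robot thereby moving to some $w'\in V(B)$ with $(v,w')\in E$. Otherwise ($v\notin W_{sbc}$), let $B$ be the unique strongly biconnected component containing $v$; if $B$ contains no obstacle, move an obstacle on the $t$-side of the robot into $B$ without moving the robot; then move a hole on the non-$t$-side of the robot into $B$, moving the robot if necessary but keeping it inside $B$; then move the robot back to $v$. (3) Let $s'$ be the robot's position. If $s'$ and $t$ lie in a common strongly biconnected component, return true iff at least one hole is on the $t$-side of the robot. Otherwise let $B_0v_1B_1\dots B_{r-1}v_rB_r$ be the path in the tree $\mathcal{G}_{sbc}(D)$ with $s'\in V(B_0)$, $t\in V(B_r)$, $s'\ne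 v_1$, $t\ne v_r$; let $l$ be the maximum of $j-i+1$ over $1\le i\le j\le r$ such that: (a) $i=1$, or $B_{i-1}$ has at least three vertices, or some $B\in V_{sbc}$ not on the path satisfies $\{B,v_i\}\in E_{sbc}$; (b) $j=r$, or $B_j$ has at least three vertices, or some $B\in V_{sbc}$ not on the path satisfies $\{B,v_j\}\in E_{sbc}$; (c) for all $i\le k<j$, $B_k$ has exactly two vertices, and for all $i<k<j$ there is no $B\in V_{sbc}$ not on the path with $\{B,v_k\}\in E_{sbc}$. Return true iff the number of holes on the $t$-side of the robot is at least $l+1$.
   Context: A move consists of choosing an arc $(v,w)\in E$ such that $v$ holds an object (robot or obstacle) and $w$ holds a hole, and moving the object from $v$ to $w$. $\mathcal{G}(D)$ is the underlying undirected graph of $D$ (edges $\{v,w\}$ for arcs $(v,w)$). A digraph is strongly biconnected if it is strongly connected and its underlying graph is biconnected (connected with no cut vertex; the one-vertex graph counts); strongly biconnected components are the maximal strongly biconnected sub-digraphs; for strongly connected $D$ these are the sub-digraphs induced by the vertex sets of the biconnected components of $\mathcal{G}(D)$. $\mathcal{G}_{sbc}(D)=(V_{sbc},W_{sbc},E_{sbc})$ is the bipartite graph with $V_{sbc}$ the biconnected components of $\mathcal{G}(D)$, $W_{sbc}$ the vertices lying in at least two of them, and $\{B,w\}\in E_{sbc}$ iff $w\in V(B)$; it is a tree. For $u,v,w\in V$ with $v\neq w$, $u$ is on the $w$-side of $v$ if $u\neq v$ and either (1) $v\in W_{sbc}$ and $u,w$ lie in the same connected component of $\mathcal{G}(D)-v$,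 or (2) $v\notin W_{sbc}$ and, with $B$ the unique strongly biconnected component containing $v$, either $u\in V(B)$ or $u,w$ lie in the same connected component of $\mathcal{G}(D-V(B))$. $u$ is on the non-$w$-side of $v$ if $u\ne v$ and $u$ is not on the $w$-side of $v$. A hole (obstacle) is on the $t$-side (non-$t$-side) of the robot if its vertex is on the $t$-side (non-$t$-side) of the robot's vertex. *)

theory Defs
  imports "Graph_Theory.Digraph_Component"
begin

text \<open>
  A digraph without parallel arcs is a \<^typ>\<open>'a pair_pre_digraph\<close>; an undirected graph is a
  symmetric digraph, so the underlying undirected graph of \<open>D\<close> is \<open>mk_symmetric D\<close>, and two
  vertices lie in the same connected component of an undirected graph iff they are related by
  the library's \<^const>\<open>reachable\<close> (which holds for vertices of the graph only).
\<close>

type_synonym 'a graph = "('a, 'a \<times> 'a) pre_digraph"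

abbreviation underlying :: "'a graph \<Rightarrow> 'a graph" where
  "underlying D \<equiv> with_proj (mk_symmetric D)"

definition cut_vertex :: "'a graph \<Rightarrow> 'a \<Rightarrow> bool" where
  "cut_vertex G x \<longleftrightarrow> x \<in> verts G \<and> verts G \<noteq> {x} \<and> \<not> connected (pre_digraph.del_vert G x)"

definition biconnected :: "'a graph \<Rightarrow> bool" where
  "biconnected G \<longleftrightarrow> symmetric G \<and> connected G \<and> (\<nexists>x. cut_vertex G x)"

definition strongly_biconnected :: "'a graph \<Rightarrow> bool" where
  "strongly_biconnected D \<longleftrightarrow> strongly_connected D \<and> biconnected (underlying D)"

definition sb_components :: "'a graph \<Rightarrow> 'a graph set" where
  "sb_components D = {B. pre_digraph.max_subgraph D strongly_biconnected B}"

definition V_sbc :: "'a graph \<Rightarrow> 'a graph set" where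
  "V_sbc D = {B. pre_digraph.max_subgraph (underlying D) biconnected B}"

definition W_sbc :: "'a graph \<Rightarrow> 'a set" where
  "W_sbc D = {w. \<exists>B\<in>V_sbc D. \<exists>B'\<in>V_sbc D. B \<noteq> B' \<and> w \<in> verts B \<and> w \<in> verts B'}"

definition E_sbc :: "'a graph \<Rightarrow> ('a graph \<times> 'a) set" where
  "E_sbc D = {(B, w). B \<in> V_sbc D \<and> w \<in> W_sbc D \<and> w \<in> verts B}"

text \<open>
  \<open>side D w v\<close> is the \<open>w\<close>-side of \<open>v\<close>. For \<open>v\<close> outside \<open>W_sbc D\<close> the component \<open>B\<close> is unique
  whenever \<open>D\<close> is strongly connected.
\<close>

definition side :: "'a graph \<Rightarrow> 'a \<Rightarrow> 'a \<Rightarrow> 'a set" where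
  "side D w v = {u \<in> verts D. u \<noteq> v \<and>
     (if v \<in> W_sbc D
      then u \<rightarrow>\<^sup>*\<^bsub>pre_digraph.del_vert (underlying D) v\<^esub> w
      else \<exists>B\<in>sb_components D. v \<in> verts B \<and>
             (u \<in> verts B \<or> u \<rightarrow>\<^sup>*\<^bsub>underlying (D \<restriction> (verts D - verts B))\<^esub> w))}"

definition non_side :: "'a graph \<Rightarrow> 'a \<Rightarrow> 'a \<Rightarrow> 'a set" where
  "non_side D w v = {u \<in> verts D. u \<noteq> v \<and> u \<notin> side D w v}"

datatype cell = Robot | Obstacle | Hole

text \<open>Only the values of a configuration on the vertices of the digraph are relevant.\<close>

type_synonym 'a config = "'a \<Rightarrow> cell"

definition move :: "'a graph \<Rightarrow> 'a \<Rightarrow> 'a \<Rightarrow> 'a config \<Rightarrow> 'a config \<Rightarrow> bool" where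
  "move D v w c c' \<longleftrightarrow>
     (v, w) \<in> arcs_ends D \<and> c v \<noteq> Hole \<and> c w = Hole \<and> c' = c(v := Hole, w := c v)"

definition moves :: "'a graph \<Rightarrow> 'a config \<Rightarrow> 'a config \<Rightarrow> bool" where
  "moves D = (\<lambda>c c'. \<exists>v w. move D v w c c')\<^sup>*\<^sup>*"

definition robot_can_reach :: "'a graph \<Rightarrow> 'a config \<Rightarrow> 'a \<Rightarrow> bool" where
  "robot_can_reach D c t \<longleftrightarrow> (\<exists>c'. moves D c c' \<and> c' t = Robot)"

text \<open>Move sequences that stay inside \<open>X\<close> and move the robot, if at all, only to vertices of \<open>Y\<close>.\<close>

definition moves_within :: "'a graph \<Rightarrow> 'a set \<Rightarrow> 'a set \<Rightarrow> 'a config \<Rightarrow> 'a config \<Rightarrow> bool" where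
  "moves_within D X Y =
     (\<lambda>c c'. \<exists>v\<in>X. \<exists>w\<in>X. move D v w c c' \<and> (c v = Robot \<longrightarrow> w \<in> Y))\<^sup>*\<^sup>*"

text \<open>
  Moving a hole (obstacle) from one vertex to another without moving the robot. Holes, and
  likewise obstacles, are indistinguishable, so only the net effect of the sequence of moves is
  prescribed: everything outside the two end points looks the same afterwards.
\<close>

definition transfer_hole :: "'a graph \<Rightarrow> 'a \<Rightarrow> 'a \<Rightarrow> 'a config \<Rightarrow> 'a config \<Rightarrow> bool" where
  "transfer_hole D h w c c' \<longleftrightarrow>
     c h = Hole \<and> c w \<noteq> Robot \<and> c' = c(h := c w, w := Hole) \<and> moves_within D (verts D) {} c c'"

definition transfer_obstacle :: "'a graph \<Rightarrow> 'a \<Rightarrow> 'a \<Rightarrow> 'a config \<Rightarrow> 'a config \<Rightarrow> bool" where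
  "transfer_obstacle D x w c c' \<longleftrightarrow>
     c x = Obstacle \<and> c w = Hole \<and> c' = c(x := Hole, w := Obstacle) \<and>
     moves_within D (verts D) {} c c'"

definition holes_in :: "'a config \<Rightarrow> 'a set \<Rightarrow> 'a set" where
  "holes_in c X = {x \<in> X. c x = Hole}"

definition obstacles_in :: "'a config \<Rightarrow> 'a set \<Rightarrow> 'a set" where
  "obstacles_in c X = {x \<in> X. c x = Obstacle}"

text \<open>
  The path \<open>B\<^sub>0 v\<^sub>1 B\<^sub>1 \<dots> v\<^sub>r B\<^sub>r\<close> is given by the lists \<open>Bs = [B\<^sub>0, \<dots>, B\<^sub>r]\<close> and
  \<open>vs = [v\<^sub>1, \<dots>, v\<^sub>r]\<close>; thus \<open>v\<^sub>i = vs ! (i - 1)\<close>.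
\<close>

definition sbc_path :: "'a graph \<Rightarrow> 'a \<Rightarrow> 'a \<Rightarrow> 'a graph list \<Rightarrow> 'a list \<Rightarrow> bool" where
  "sbc_path D s t Bs vs \<longleftrightarrow>
     vs \<noteq> [] \<and> length Bs = length vs + 1 \<and> distinct Bs \<and> distinct vs \<and>
     (\<forall>i<length vs. (Bs ! i, vs ! i) \<in> E_sbc D \<and> (Bs ! (i + 1), vs ! i) \<in> E_sbc D) \<and>
     s \<in> verts (hd Bs) \<and> t \<in> verts (last Bs) \<and> s \<noteq> hd vs \<and> t \<noteq> last vs"

definition branching :: "'a graph \<Rightarrow> 'a graph list \<Rightarrow> 'a \<Rightarrow> bool" where
  "branching D Bs w \<longleftrightarrow> (\<exists>B\<in>V_sbc D. B \<notin> set Bs \<and> (B, w) \<in> E_sbc D)"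

definition corridor :: "'a graph \<Rightarrow> 'a graph list \<Rightarrow> 'a list \<Rightarrow> nat \<Rightarrow> nat \<Rightarrow> bool" where
  "corridor D Bs vs i j \<longleftrightarrow>
     1 \<le> i \<and> i \<le> j \<and> j \<le> length vs \<and>
     (i = 1 \<or> card (verts (Bs ! (i - 1))) \<ge> 3 \<or> branching D Bs (vs ! (i - 1))) \<and>
     (j = length vs \<or> card (verts (Bs ! j)) \<ge> 3 \<or> branching D Bs (vs ! (j - 1))) \<and>
     (\<forall>k. i \<le> k \<and> k < j \<longrightarrow> card (verts (Bs ! k)) = 2) \<and>
     (\<forall>k. i < k \<and> k < j \<longrightarrow> \<not> branching D Bs (vs ! (k - 1)))"

definition max_corridor :: "'a graph \<Rightarrow> 'a graph list \<Rightarrow> 'a list \<Rightarrow> nat" where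
  "max_corridor D Bs vs = Max {j - i + 1 | i j. corridor D Bs vs i j}"

text \<open>
  The algorithm as a transition system. A state consists of a program location, the current
  configuration and, inside the loop body, the current values of the variables \<open>v\<close> and \<open>B\<close>.
  Everything that the algorithm leaves open is nondeterministic, and a state without a
  successor other than \<open>Return b\<close> is a run that is stuck at an instruction that cannot be
  executed.
\<close>

datatype 'a state =
    Loop "'a config"
  | Cut_Fetch "'a config" 'a "'a graph"
  | Cut_Move "'a config" 'a "'a graph"
  | In_Fetch "'a config" 'a "'a graph"
  | In_Swap "'a config" 'a "'a graph"
  | In_Return "'a config" 'a "'a graph"
  | Decide "'a config"
  | Return bool

definition robot_at :: "'a graph \<Rightarrow> 'a config \<Rightarrow> 'a \<Rightarrow> bool" where
  "robot_at D c v \<longleftrightarrow> v \<in> verts D \<and> c v = Robot"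

definition loop_cond :: "'a graph \<Rightarrow> 'a \<Rightarrow> 'a config \<Rightarrow> bool" where
  "loop_cond D t c \<longleftrightarrow> (\<exists>v. robot_at D c v \<and>
     obstacles_in c (side D t v) \<noteq> {} \<and> holes_in c (non_side D t v) \<noteq> {})"

text \<open>
  In \<open>in_swap\<close>, moving a hole from the non-\<open>t\<close>-side of \<open>v\<close> into \<open>B\<close> is a sequence of moves inside
  these two regions whose net effect is that the former loses one hole and \<open>B\<close> gains one; more
  than one hole and the robot may take part in it. It is not enough that a hole enters \<open>B\<close>, as
  another hole of \<open>B\<close> could leave it at the same time.
\<close>

inductive fscd_step :: "'a graph \<Rightarrow> 'a \<Rightarrow> 'a state \<Rightarrow> 'a state \<Rightarrow> bool"
  for D :: "'a graph" and t :: 'a where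
  cut_select:
    "fscd_step D t (Loop c) (Cut_Fetch c v B)"
    if "loop_cond D t c" and "robot_at D c v" and "v \<in> W_sbc D"
      and "B \<in> sb_components D" and "v \<in> verts B" and "verts B \<inter> side D t v = {}"
      and "\<exists>w\<in>verts B. w \<noteq> v \<and> holes_in c (side D w v) \<noteq> {}"
| cut_no_fetch:
    "fscd_step D t (Cut_Fetch c v B) (Cut_Move c v B)"
    if "holes_in c (verts B) \<noteq> {}"
| cut_fetch:
    "fscd_step D t (Cut_Fetch c v B) (Cut_Move c' v B)"
    if "holes_in c (verts B) = {}"
      and "w \<in> verts B \<inter> W_sbc D" and "h \<in> holes_in c (non_side D t w)"
      and "transfer_hole D h w c c'"
| cut_move:
    "fscd_step D t (Cut_Move c v B) (Loop c'')"
    if "h \<in> holes_in c (verts B)" and "w' \<in> verts B"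
      and "transfer_hole D h w' c c'" and "move D v w' c' c''"
| in_select:
    "fscd_step D t (Loop c) (In_Fetch c v B)"
    if "loop_cond D t c" and "robot_at D c v" and "v \<notin> W_sbc D"
      and "B \<in> sb_components D" and "v \<in> verts B"
| in_no_fetch:
    "fscd_step D t (In_Fetch c v B) (In_Swap c v B)"
    if "obstacles_in c (verts B) \<noteq> {}"
| in_fetch:
    "fscd_step D t (In_Fetch c v B) (In_Swap c' v B)"
    if "obstacles_in c (verts B) = {}"
      and "x \<in> obstacles_in c (side D t v)" and "w \<in> verts B"
      and "transfer_obstacle D x w c c'"
| in_swap:
    "fscd_step D t (In_Swap c v B) (In_Return c' v B)"
    if "moves_within D (verts B \<union> non_side D t v) (verts B) c c'"
      and "card (holes_in c' (verts B)) = card (holes_in c (verts B)) + 1"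
      and "card (holes_in c' (non_side D t v)) + 1 = card (holes_in c (non_side D t v))"
| in_return:
    "fscd_step D t (In_Return c v B) (Loop c')"
    if "moves_within D (verts B) (verts B) c c'" and "c' v = Robot"
| exit:
    "fscd_step D t (Loop c) (Decide c)"
    if "\<not> loop_cond D t c"
| decide_common:
    "fscd_step D t (Decide c) (Return (card (holes_in c (side D t s')) \<ge> 1))"
    if "robot_at D c s'" and "\<exists>B\<in>sb_components D. s' \<in> verts B \<and> t \<in> verts B"
| decide_path:
    "fscd_step D t (Decide c)
       (Return (card (holes_in c (side D t s')) \<ge> max_corridor D Bs vs + 1))"
    if "robot_at D c s'" and "\<not> (\<exists>B\<in>sb_components D. s' \<in> verts B \<and> t \<in> verts B)"
      and "sbc_path D s' t Bs vs"

text \<open>Every run, however the choices are resolved, is finite and ends by returning \<open>b\<close>.\<close>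

definition fscd_returns :: "'a graph \<Rightarrow> 'a \<Rightarrow> 'a config \<Rightarrow> bool \<Rightarrow> bool" where
  "fscd_returns D t f b \<longleftrightarrow>
     (\<nexists>\<sigma>. \<sigma> 0 = Loop f \<and> (\<forall>n. fscd_step D t (\<sigma> n) (\<sigma> (Suc n)))) \<and>
     (\<forall>S. (fscd_step D t)\<^sup>*\<^sup>* (Loop f) S \<and> (\<nexists>S'. fscd_step D t S S') \<longrightarrow> S = Return b)"

end

(*
  Reversibility: a hole can be pulled around a closed walk, and doing so acts on configurations by a
  permutation that does not depend on the configuration. Since this permutation has finite order,
  every move in a strongly connected digraph can be undone. Hence reachability of configurations is
  an equivalence relation, it is the same in the digraph and in the underlying undirected graph, and
  the moves made in the loop of FSCD do not affect solvability.

  Sufficiency: as long as the robot stays put, the holes of a connected region next to it can be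
  distributed there arbitrarily. With l + 1 holes the robot travels from one place where it can step
  aside (a block with at least three vertices, or a branch) to the next one, the holes passing it
  each time.

  Necessity: when the robot enters a corridor with l cut vertices for the last time, each step leaves
  a hole behind that cannot overtake it, so there have to be l + 1 holes.

  Termination: at a cut vertex the set of vertices that the robot separates from t shrinks strictly;
  otherwise the robot's position is kept and a hole leaves its non-t-side.
*)
theory Submission
  imports Defs "HOL-Combinatorics.Cycles"
begin

section \<open>Blocks of an undirected graph\<close>

text \<open>The exit from the loop is what makes a count on the t-side decisive: then either the
  t-side consists of holes only, or all holes lie on it. In the first case it contains
  \<open>t\<close> and every cut vertex of the path, more than any corridor has; in the second, a
  lower bound for all holes is one for the t-side. Directions shape the rest. Solvability may be
  studied in the underlying graph, but the transfers of the algorithm must not move the robot, and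
  undoing a move around a closed walk might. They need directed walks that avoid the robot. These
  come from projecting walks to a block: a walk that leaves a block returns where it left, and
  cutting out the excursions keeps the directions. The same projection makes every block strongly
  connected, so that moves can be undone inside a block, where the robot is free to move. The
  constant \<open>l + 1\<close> is one hole for each cut vertex of the corridor and one for the
  vertex beyond it onto which the robot steps. After the crossing the cut vertices and the robot's
  former place are holes, so the supply is restored.\<close>

lemma rtrancl_on_cong:
  assumes "\<And>x y. x \<in> F \<Longrightarrow> y \<in> F \<Longrightarrow> (x, y) \<in> R \<longleftrightarrow> (x, y) \<in> R'"
  shows "rtrancl_on F R = rtrancl_on F R'"
proof -
  have imp: "(a, b) \<in> rtrancl_on F R'" if "(a, b) \<in> rtrancl_on F R"
    "\<And>x y. x \<in> F \<Longrightarrow> y \<in> F \<Longrightarrow> (x, y) \<in> R \<Longrightarrow> (x, y) \<in> R'" for a b R R'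
    using that(1) by (induction rule: rtrancl_on_induct) (auto intro: rtrancl_on_into_rtrancl_on that(2))
  show ?thesis using imp[of _ _ R R'] imp[of _ _ R' R] assms by auto
qed

lemma rtrancl_on_rtrancl: "(a, b) \<in> rtrancl_on F R \<Longrightarrow> (a, b) \<in> (R \<inter> F \<times> F)\<^sup>*"
  by (induction rule: rtrancl_on_induct) (auto intro: rtrancl_into_rtrancl)

text \<open>What follows the last visit of the walk to \<open>a\<close> avoids
  \<open>a\<close>.\<close>

lemma rtrancl_on_last_exit:
  assumes "(a, y) \<in> rtrancl_on (insert a S) R" "y \<noteq> a"
  obtains p where "(a, p) \<in> R" "(p, y) \<in> rtrancl_on (S - {a}) R"
proof -
  have "y \<noteq> a \<longrightarrow> (\<exists>p. (a, p) \<in> R \<and> (p, y) \<in> rtrancl_on (S - {a}) R)"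
    using assms(1)
  proof (induction rule: rtrancl_on_induct)
    case (step y z)
    show ?case
    proof
      assume "z \<noteq> a"
      show "\<exists>p. (a, p) \<in> R \<and> (p, z) \<in> rtrancl_on (S - {a}) R"
      proof (cases "y = a")
        case True
        then show ?thesis using step \<open>z \<noteq> a\<close> by auto
      next
        case False
        then show ?thesis using step \<open>z \<noteq> a\<close>
          by (metis insertE insert_Diff_single insert_iff rtrancl_on_into_rtrancl_on)
      qed
    qed
  qed simp
  then show thesis using assms that by blast
qed

locale ugraph =
  fixes V :: "'a set" and E :: "('a \<times> 'a) set"
  assumes fin: "finite V" and symE: "sym E" and EV: "E \<subseteq> V \<times> V"
    and con: "u \<in> V \<Longrightarrow> w \<in> V \<Longrightarrow> (u, w) \<in> rtrancl_on V E"
begin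

abbreviation conn :: "'a set \<Rightarrow> 'a \<Rightarrow> 'a \<Rightarrow> bool" where
  "conn S u w \<equiv> (u, w) \<in> rtrancl_on S E"

lemma conn_sym: "conn S u w \<Longrightarrow> conn S w u"
  using rtrancl_on_sym[OF symE] by (blast dest: symD)

lemmas conn_trans = rtrancl_on_trans[of _ _ _ E]

lemma conn_mono: "conn S u w \<Longrightarrow> S \<subseteq> S' \<Longrightarrow> conn S' u w"
  by (rule rtrancl_on_mono[of E E S S']) auto

lemma conn_edge: "(u, w) \<in> E \<Longrightarrow> u \<in> S \<Longrightarrow> w \<in> S \<Longrightarrow> conn S u w"
  by (meson rtrancl_on.intros)

text \<open>
  A block is a maximal set of vertices no two of which are separated by a third vertex. In contrast
  to maximal biconnected subgraphs, this makes the intersection properties of blocks immediate; the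
  two notions agree by \<open>block_project\<close>, see \<open>V_sbc_eq\<close>.
\<close>

definition insep :: "'a \<Rightarrow> 'a \<Rightarrow> bool" where
  "insep x y \<longleftrightarrow> x \<in> V \<and> y \<in> V \<and> (\<forall>z. z \<noteq> x \<longrightarrow> z \<noteq> y \<longrightarrow> conn (V - {z}) x y)"

definition clump :: "'a set \<Rightarrow> bool" where
  "clump S \<longleftrightarrow> (\<forall>x\<in>S. \<forall>y\<in>S. insep x y)"

definition block :: "'a set \<Rightarrow> bool" where
  "block S \<longleftrightarrow> S \<noteq> {} \<and> clump S \<and> (\<forall>S'. clump S' \<longrightarrow> S \<subseteq> S' \<longrightarrow> S' = S)"

lemma insep_sym: "insep x y \<Longrightarrow> insep y x"
  unfolding insep_def using conn_sym by metis

lemma insep_refl: "x \<in> V \<Longrightarrow> insep x x"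
  unfolding insep_def by auto

lemma insep_edge: "(x, y) \<in> E \<Longrightarrow> insep x y"
  unfolding insep_def using EV by (auto intro!: conn_edge)

lemma insepD: "insep x y \<Longrightarrow> z \<noteq> x \<Longrightarrow> z \<noteq> y \<Longrightarrow> conn (V - {z}) x y"
  unfolding insep_def by auto

lemma clump_subset: "clump S \<Longrightarrow> S \<subseteq> V"
  unfolding clump_def insep_def by auto

lemma block_subset: "block B \<Longrightarrow> B \<subseteq> V"
  unfolding block_def using clump_subset by auto

lemma block_insep: "block B \<Longrightarrow> x \<in> B \<Longrightarrow> y \<in> B \<Longrightarrow> insep x y"
  unfolding block_def clump_def by auto

lemma block_conn:
  "block B \<Longrightarrow> x \<in> B \<Longrightarrow> y \<in> B \<Longrightarrow> z \<noteq> x \<Longrightarrow> z \<noteq> y \<Longrightarrow> conn (V - {z}) x y"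
  using block_insep insepD by blast

lemma block_maximal: "block B \<Longrightarrow> clump S \<Longrightarrow> B \<subseteq> S \<Longrightarrow> S = B"
  unfolding block_def by auto

lemma block_exists:
  assumes "clump S" "S \<noteq> {}"
  obtains B where "block B" "S \<subseteq> B"
proof -
  have "finite {S'. clump S' \<and> S \<subseteq> S'}"
    by (rule finite_subset[of _ "Pow V"]) (use fin clump_subset in auto)
  then obtain B where "clump B" "S \<subseteq> B" "\<forall>S'. clump S' \<and> S \<subseteq> S' \<longrightarrow> B \<subseteq> S' \<longrightarrow> B = S'"
    using finite_has_maximal2[of "{S'. clump S' \<and> S \<subseteq> S'}" S] assms(1) by auto
  then have "block B" unfolding block_def using assms by blast
  with \<open>S \<subseteq> B\<close> show thesis using that by blast
qed

lemma block_edge: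
  assumes "(x, y) \<in> E"
  obtains B where "block B" "x \<in> B" "y \<in> B"
proof -
  have "clump {x, y}"
    unfolding clump_def using insep_edge[OF assms] insep_sym insep_refl EV assms by auto
  then show thesis using block_exists[of "{x, y}"] that by auto
qed

text \<open>Given such a walk, no \<open>z\<close> could separate \<open>a\<close> in
  \<open>B\<close> from \<open>b\<close> in \<open>B'\<close>: for \<open>z \<noteq> w\<close> go
  through \<open>w\<close>, for \<open>z = w\<close> use the walk from \<open>x\<close> to
  \<open>y\<close>. Then \<open>B \<union> B'\<close> would be a clump, against maximality.\<close>

lemma block_sep:
  assumes "block B" "block B'" "B \<noteq> B'" "w \<in> B" "w \<in> B'" "x \<in> B" "x \<noteq> w" "y \<in> B'" "y \<noteq> w"
  shows "\<not> conn (V - {w}) x y"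
proof
  assume xy: "conn (V - {w}) x y"
  have cross: "insep a b" if a: "a \<in> B" and b: "b \<in> B'" for a b
    unfolding insep_def
  proof (intro conjI allI impI)
    show "a \<in> V" "b \<in> V" using a b assms block_subset by auto
    fix z assume z: "z \<noteq> a" "z \<noteq> b"
    show "conn (V - {z}) a b"
    proof (cases "z = w")
      case True
      then have "conn (V - {w}) a x" "conn (V - {w}) y b"
        using block_conn[of B a x w] block_conn[of B' y b w] assms a b z by auto
      then show ?thesis using True xy by (blast intro: conn_trans)
    next
      case False
      then have "conn (V - {z}) a w" "conn (V - {z}) w b"
        using block_conn[of B a w z] block_conn[of B' w b z] assms a b z by auto
      then show ?thesis by (blast intro: conn_trans)
    qed
  qed
  have "clump (B \<union> B')"
    unfolding clump_def using cross insep_sym block_insep assms(1,2) by (metis Un_iff)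
  then have "B \<union> B' = B" "B \<union> B' = B'" using block_maximal assms(1,2) by blast+
  then show False using assms(3) by simp
qed

text \<open>By \<open>block_sep\<close>, removing \<open>a\<close> would separate a second common
  vertex \<open>b\<close> from itself.\<close>

lemma block_inter:
  assumes "block B" "block B'" "B \<noteq> B'" "a \<in> B" "a \<in> B'" "b \<in> B" "b \<in> B'"
  shows "a = b"
proof (rule ccontr)
  assume "a \<noteq> b"
  moreover have "conn (V - {a}) b b" using assms \<open>a \<noteq> b\<close> block_subset by auto
  ultimately show False using block_sep[of B B' a b b] assms by auto
qed

text \<open>A return to the block at another vertex would make \<open>p\<close> inseparable from all
  of \<open>B\<close>: if \<open>a\<close> is removed, use the walk to \<open>b\<close>, otherwise
  the edge to \<open>a\<close>. Then \<open>insert p B\<close> would be a larger clump.\<close>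

lemma block_ear:
  assumes B: "block B" and a: "a \<in> B" and p: "p \<notin> B" and ap: "(a, p) \<in> E"
    and b: "b \<in> B" "b \<noteq> a"
  shows "\<not> conn (V - {a}) p b"
proof
  assume pb: "conn (V - {a}) p b"
  have pV: "p \<in> V" using ap EV by auto
  have *: "insep p s" if s: "s \<in> B" for s
    unfolding insep_def
  proof (intro conjI allI impI)
    show "p \<in> V" "s \<in> V" using pV s B block_subset by auto
    fix z assume z: "z \<noteq> p" "z \<noteq> s"
    show "conn (V - {z}) p s"
    proof (cases "z = a")
      case True
      then show ?thesis using pb block_conn[OF B b(1) s, of z] b z by (auto intro: conn_trans)
    next
      case False
      then have "conn (V - {z}) p a"
        using ap z pV a B block_subset by (intro conn_sym[OF conn_edge]) auto
      then show ?thesis using block_conn[OF B a s, of z] False z by (auto intro: conn_trans)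
    qed
  qed
  have "clump (insert p B)"
    unfolding clump_def using * insep_sym insep_refl[OF pV] block_insep[OF B] by auto
  then show False using block_maximal[OF B] p by auto
qed

text \<open>Every walk that starts in a block leaves and reenters it at the same vertex, so it can be
  shortcut to a walk inside the block, followed by an excursion from the last vertex.\<close>

lemma block_project:
  assumes B: "block B" and x: "x \<in> B" and R: "R \<subseteq> E" and xy: "(x, y) \<in> rtrancl_on (V - Z) R"
  obtains a where "a \<in> B" "(x, a) \<in> rtrancl_on (B - Z) R" "(a, y) \<in> rtrancl_on (insert a (V - B)) R"
proof -
  have "\<exists>a\<in>B. (x, a) \<in> rtrancl_on (B - Z) R \<and> (a, y) \<in> rtrancl_on (insert a (V - B)) R"
    using xy
  proof (induction rule: rtrancl_on_induct)
    case base
    then show ?case using x by auto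
  next
    case (step y z)
    then obtain a where a: "a \<in> B" "(x, a) \<in> rtrancl_on (B - Z) R"
      "(a, y) \<in> rtrancl_on (insert a (V - B)) R" by blast
    have yz: "(y, z) \<in> E" using step R by auto
    show ?case
    proof (cases "z \<in> insert a (V - B)")
      case True
      then show ?thesis using a step by (meson rtrancl_on_into_rtrancl_on)
    next
      case False
      then have z: "z \<in> B" "z \<noteq> a" using step by auto
      \<comment> \<open>An excursion from \<open>a\<close> that comes back at
        \<open>z \<noteq> a\<close> would be an ear. This argument forgets the directions and works
        in \<open>E\<close>, while the walk that is kept remains one of \<open>R\<close>.\<close>
      have "y = a"
      proof (rule ccontr)
        assume "y \<noteq> a"
        have "(a, y) \<in> rtrancl_on (insert a (V - B)) E" by (rule rtrancl_on_mono[OF R subset_refl a(3)])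
        then obtain p where p: "(a, p) \<in> E" "conn (V - B - {a}) p y"
          using rtrancl_on_last_exit \<open>y \<noteq> a\<close> by metis
        have "p \<notin> B" using p(2) in_rtrancl_on_in_F by fastforce
        have "conn (V - {a}) p y" using p(2) by (rule conn_mono) auto
        moreover have "conn (V - {a}) y z" using yz step \<open>y \<noteq> a\<close> z by (intro conn_edge) auto
        ultimately show False
          using block_ear[OF B a(1) \<open>p \<notin> B\<close> p(1) z] conn_trans by blast
      qed
      then have "(x, z) \<in> rtrancl_on (B - Z) R"
        using a step z by (auto intro: rtrancl_on_into_rtrancl_on)
      then show ?thesis using z by auto
    qed
  qed
  then show thesis using that by blast
qed

text \<open>If the walk ends in the block, the excursion left over by \<open>block_project\<close>
  is trivial. With the arcs of a digraph for \<open>R\<close> this carries strong connectivity over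
  to a block, with \<open>Z = {z}\<close> it gives biconnectivity.\<close>

lemma block_reach:
  assumes "block B" "x \<in> B" "y \<in> B" "R \<subseteq> E" "(x, y) \<in> rtrancl_on (V - Z) R"
  shows "(x, y) \<in> rtrancl_on (B - Z) R"
proof -
  obtain a where "(x, a) \<in> rtrancl_on (B - Z) R" "(a, y) \<in> rtrancl_on (insert a (V - B)) R"
    using block_project[OF assms(1,2,4,5)] by blast
  moreover have "y = a" using calculation(2) assms(3) in_rtrancl_on_in_F by fastforce
  ultimately show ?thesis by simp
qed

lemma block_conn_inside:
  assumes "block B" "x \<in> B" "y \<in> B" "z \<noteq> x" "z \<noteq> y"
  shows "conn (B - {z}) x y"
  using block_reach[OF assms(1-3) subset_refl block_conn[OF assms]] .

text \<open>\<open>a\<close> is the vertex at which \<open>h\<close> hangs on the block. Along this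
  walk objects are moved without disturbing the block elsewhere, in particular without moving a
  robot on another vertex of it.\<close>

lemma block_attach:
  assumes "block B" "R \<subseteq> E" "h \<in> V" "\<And>u w. u \<in> V \<Longrightarrow> w \<in> V \<Longrightarrow> (u, w) \<in> rtrancl_on V R"
  obtains a where "a \<in> B" "(a, h) \<in> rtrancl_on (insert a (V - B)) R"
proof -
  obtain x where x: "x \<in> B" using assms(1) block_def by auto
  then have "(x, h) \<in> rtrancl_on (V - {}) R" using assms block_subset[OF assms(1)] by auto
  then show thesis using block_project[OF assms(1) x assms(2)] that by metis
qed

lemma block_at: "v \<in> V \<Longrightarrow> \<exists>B. block B \<and> v \<in> B"
  using block_exists[of "{v}"] insep_refl unfolding clump_def by blast

text \<open>A vertex outside \<open>S\<close> cannot interrupt a walk inside \<open>S\<close>, so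
  only the removal of vertices of \<open>S\<close> has to be considered.\<close>

lemma clump_of_biconnected:
  assumes "S \<subseteq> V" "R \<subseteq> E"
    "\<And>x y. x \<in> S \<Longrightarrow> y \<in> S \<Longrightarrow> (x, y) \<in> rtrancl_on S R"
    "\<And>x y z. z \<in> S \<Longrightarrow> x \<in> S \<Longrightarrow> y \<in> S \<Longrightarrow> x \<noteq> z \<Longrightarrow> y \<noteq> z \<Longrightarrow> (x, y) \<in> rtrancl_on (S - {z}) R"
  shows "clump S"
  unfolding clump_def insep_def
proof (intro ballI conjI allI impI)
  fix x y z assume xy: "x \<in> S" "y \<in> S" and z: "z \<noteq> x" "z \<noteq> y"
  have "(x, y) \<in> rtrancl_on (S - {z}) R"
    using assms(3)[OF xy] assms(4)[of z x y] xy z by (cases "z \<in> S") auto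
  then show "conn (V - {z}) x y"
    using assms(1,2) rtrancl_on_mono[of R E "S - {z}" "V - {z}"] by blast
qed (use assms in auto)

text \<open>Connectedness provides an edge at any vertex, and the block of that edge would properly
  contain a one-vertex block.\<close>

lemma block_card:
  assumes "block B" "2 \<le> card V"
  shows "2 \<le> card B"
proof -
  have finB: "finite B" using assms(1) block_subset fin finite_subset by blast
  obtain x where x: "x \<in> B" using assms(1) block_def by auto
  then have xV: "x \<in> V" using assms(1) block_subset by auto
  obtain y where y: "y \<in> V" "y \<noteq> x"
    using assms(2) fin by (metis card_le_Suc0_iff_eq not_less_eq_eq numeral_2_eq_2 xV)
  have "conn (insert x V) x y" using con[OF xV y(1)] xV by (simp add: insert_absorb)
  then obtain p where p: "(x, p) \<in> E" "conn (V - {x}) p y" using rtrancl_on_last_exit y by metis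
  have px: "p \<noteq> x" using p(2) in_rtrancl_on_in_F by fastforce
  show ?thesis
  proof (rule ccontr)
    assume "\<not> 2 \<le> card B"
    then have "card B \<le> Suc 0" by simp
    then have "B = {x}" using x finB by (auto simp: card_le_Suc0_iff_eq)
    obtain B' where B': "block B'" "x \<in> B'" "p \<in> B'" using block_edge[OF p(1)] by blast
    then have "B' = B" using block_maximal[OF assms(1), of B'] \<open>B = {x}\<close> unfolding block_def by auto
    then show False using B' \<open>B = {x}\<close> px by auto
  qed
qed

text \<open>Without \<open>u\<close>, the vertex \<open>w\<close> is still joined to a third vertex
  of the block; the last departure from \<open>w\<close> gives the neighbour. Later \<open>u\<close>
  is the next cut vertex of the path, and \<open>x\<close> a place where the robot does not obstruct
  it.\<close>

lemma block_neighbour: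
  assumes B: "block B" and w: "w \<in> B" and u: "u \<noteq> w" and c: "\<exists>y\<in>B. y \<noteq> w \<and> y \<noteq> u"
  obtains x where "x \<in> B" "x \<noteq> w" "x \<noteq> u" "(w, x) \<in> E"
proof -
  obtain y where y: "y \<in> B" "y \<noteq> w" "y \<noteq> u" using c by blast
  have "conn (B - {u}) w y" using block_conn_inside[OF B w y(1)] u y by auto
  then have "conn (insert w (B - {u})) w y" using w u by (simp add: insert_absorb)
  then obtain p where p: "(w, p) \<in> E" "conn (B - {u} - {w}) p y" using rtrancl_on_last_exit y by metis
  then have "p \<in> B - {u} - {w}" using in_rtrancl_on_in_F by fastforce
  then show thesis using p that by auto
qed

lemma block_neighbour':
  assumes B: "block B" and w: "w \<in> B" and c: "2 \<le> card B"
  obtains x where "x \<in> B" "x \<noteq> w" "(w, x) \<in> E"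
proof -
  obtain y where y: "y \<in> B" "y \<noteq> w"
    using c w by (metis card_le_Suc0_iff_eq card.infinite not_less_eq_eq numeral_2_eq_2 zero_le)
  have "conn (V - {}) w y" using con w y B block_subset by auto
  then have "conn (B - {}) w y" by (rule block_reach[OF B w y(1) subset_refl])
  then have "conn (insert w B) w y" using w by (simp add: insert_absorb)
  then obtain p where p: "(w, p) \<in> E" "conn (B - {w}) p y" using rtrancl_on_last_exit y by metis
  then have "p \<in> B - {w}" using in_rtrancl_on_in_F by fastforce
  then show thesis using p that by auto
qed

end

section \<open>Moves and their reversibility\<close>

text \<open>Subsumes \<open>moves\<close> and \<open>moves_within\<close> and allows any arc set, so
  that the same lemmas serve the digraph, its symmetric closure and their restrictions to a
  block.\<close>

definition go :: "('a \<times> 'a) set \<Rightarrow> 'a set \<Rightarrow> 'a config \<Rightarrow> 'a config \<Rightarrow> bool" where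
  "go A Y c c' \<longleftrightarrow> (\<exists>v w. (v, w) \<in> A \<and> c v \<noteq> Hole \<and> c w = Hole \<and> c' = c(v := Hole, w := c v) \<and>
     (c v = Robot \<longrightarrow> w \<in> Y))"

lemma moves_within_go: "moves_within D X Y = (go (arcs_ends D \<inter> X \<times> X) Y)\<^sup>*\<^sup>*"
  unfolding moves_within_def go_def move_def by (rule arg_cong[of _ _ rtranclp]) (auto simp: fun_eq_iff)

lemma moves_go: "moves D = (go (arcs_ends D) UNIV)\<^sup>*\<^sup>*"
  unfolding moves_def go_def move_def by (rule arg_cong[of _ _ rtranclp]) (auto simp: fun_eq_iff)

lemma go_mono: "go A Y c c' \<Longrightarrow> A \<subseteq> A' \<Longrightarrow> Y \<subseteq> Y' \<Longrightarrow> go A' Y' c c'"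
  unfolding go_def by blast

lemma go_star_mono: "(go A Y)\<^sup>*\<^sup>* c c' \<Longrightarrow> A \<subseteq> A' \<Longrightarrow> Y \<subseteq> Y' \<Longrightarrow> (go A' Y')\<^sup>*\<^sup>* c c'"
  by (rule rtranclp_mono[THEN predicate2D, of "go A Y"]) (auto intro: go_mono)

text \<open>Since \<open>w\<close> holds a hole, the move swaps two cells; this is how moves become
  permutations of the vertices.\<close>

lemma upd_transpose: "c w = Hole \<Longrightarrow> c(v := Hole, w := c v) = c \<circ> Transposition.transpose v w"
  by (auto simp: fun_eq_iff Transposition.transpose_def)

lemma go_transpose:
  assumes "(v, w) \<in> A" "c w = Hole"
  shows "(go A UNIV)\<^sup>*\<^sup>* c (c \<circ> Transposition.transpose v w)"
proof (cases "c v = Hole")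
  case True
  then have "c \<circ> Transposition.transpose v w = c"
    using assms by (auto simp: fun_eq_iff Transposition.transpose_def)
  then show ?thesis by simp
next
  case False
  then have "go A UNIV c (c \<circ> Transposition.transpose v w)"
    unfolding go_def using assms upd_transpose[of c w v] False by (intro exI[of _ v] exI[of _ w]) auto
  then show ?thesis by blast
qed

text \<open>The permutation depends on the walk only, not on the configuration; this is what makes the
  moves of a hole around a closed walk invertible.\<close>

lemma hole_walk:
  assumes "(u, h) \<in> A\<^sup>*"
  shows "\<exists>\<rho>. permutation \<rho> \<and> \<rho> u = h \<and> (\<forall>c. c h = Hole \<longrightarrow> (go A UNIV)\<^sup>*\<^sup>* c (c \<circ> \<rho>))"
  using assms
proof (induction rule: converse_rtrancl_induct)
  case base
  show ?case by (rule exI[of _ id]) (auto simp: permutation_id)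
next
  case (step u u')
  then obtain \<rho> where \<rho>: "permutation \<rho>" "\<rho> u' = h" "\<And>c. c h = Hole \<Longrightarrow> (go A UNIV)\<^sup>*\<^sup>* c (c \<circ> \<rho>)"
    by blast
  \<comment> \<open>Objects move along the arcs, so the hole moves against them:
    \<open>\<rho>\<close> takes it from \<open>h\<close> to \<open>u'\<close>, the prepended arc
    from there to \<open>u\<close>.\<close>
  have "(go A UNIV)\<^sup>*\<^sup>* c (c \<circ> (\<rho> \<circ> Transposition.transpose u u'))" if "c h = Hole" for c
  proof -
    have "(go A UNIV)\<^sup>*\<^sup>* (c \<circ> \<rho>) (c \<circ> \<rho> \<circ> Transposition.transpose u u')"
      by (rule go_transpose[OF step(1)]) (simp add: \<rho>(2) that)
    with \<rho>(3)[of c] that show ?thesis unfolding comp_assoc by (meson rtranclp_trans)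
  qed
  moreover have "permutation (\<rho> \<circ> Transposition.transpose u u')"
    by (intro permutation_compose \<rho>(1) permutation_swap_id)
  moreover have "(\<rho> \<circ> Transposition.transpose u u') u = h" using \<rho>(2) by simp
  ultimately show ?case by blast
qed

lemma go_reverse:
  assumes "go A UNIV c c'" "\<And>v w. (v, w) \<in> A \<Longrightarrow> (w, v) \<in> A\<^sup>*"
  shows "(go A UNIV)\<^sup>*\<^sup>* c' c"
proof -
  obtain v w where vw: "(v, w) \<in> A" "c w = Hole" "c' = c(v := Hole, w := c v)"
    using assms(1) unfolding go_def by blast
  let ?t = "Transposition.transpose v w"
  obtain \<rho> where \<rho>: "permutation \<rho>" "\<rho> w = v" "\<And>c. c v = Hole \<Longrightarrow> (go A UNIV)\<^sup>*\<^sup>* c (c \<circ> \<rho>)"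
    using hole_walk[OF assms(2)[OF vw(1)]] by blast
  \<comment> \<open>One round of the hole: the move takes it from \<open>w\<close> to
    \<open>v\<close>, then it is pulled back to \<open>w\<close>. As \<open>\<tau>\<close> fixes
    \<open>w\<close>, the round can be repeated.\<close>
  define \<tau> where "\<tau> = ?t \<circ> \<rho>"
  have \<tau>w: "\<tau> w = w" using \<rho>(2) by (simp add: \<tau>_def)
  have half: "(go A UNIV)\<^sup>*\<^sup>* (d \<circ> ?t) (d \<circ> \<tau>)" if "d w = Hole" for d
    using \<rho>(3)[of "d \<circ> ?t"] that by (simp add: \<tau>_def comp_assoc)
  have round: "(go A UNIV)\<^sup>*\<^sup>* d (d \<circ> \<tau>)" if "d w = Hole" for d
    using go_transpose[of v w A d] vw(1) that half[of d] by auto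
  have iter: "(go A UNIV)\<^sup>*\<^sup>* d (d \<circ> (\<tau> ^^ n))" if "d w = Hole" for n d
    using that
  proof (induction n arbitrary: d)
    case (Suc n)
    have "(go A UNIV)\<^sup>*\<^sup>* (d \<circ> \<tau>) (d \<circ> \<tau> \<circ> (\<tau> ^^ n))"
      by (rule Suc.IH) (simp add: Suc.prems \<tau>w)
    with round[of d, OF Suc.prems] have "(go A UNIV)\<^sup>*\<^sup>* d (d \<circ> \<tau> \<circ> (\<tau> ^^ n))"
      by (rule rtranclp_trans)
    moreover have "d \<circ> \<tau> \<circ> (\<tau> ^^ n) = d \<circ> (\<tau> ^^ Suc n)"
      by (simp add: comp_assoc)
    ultimately show ?case by (simp only:)
  qed simp
  have "permutation \<tau>" unfolding \<tau>_def by (intro permutation_compose \<rho>(1) permutation_swap_id)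
  then obtain n where n: "\<tau> ^^ n = id" "n > 0" using permutation_is_nilpotent by blast
  then obtain m where m: "n = Suc m" using not0_implies_Suc by blast
  \<comment> \<open>\<open>n\<close> rounds restore \<open>c\<close>. Without their very first move
    there remain the rest of the first round and \<open>m\<close> full rounds, and these start at
    \<open>c'\<close>.\<close>
  have "(go A UNIV)\<^sup>*\<^sup>* (c \<circ> \<tau>) (c \<circ> \<tau> \<circ> (\<tau> ^^ m))" using iter[of "c \<circ> \<tau>"] vw \<tau>w by simp
  moreover have "c \<circ> \<tau> \<circ> (\<tau> ^^ m) = c" using n m by (simp add: comp_assoc)
  ultimately have "(go A UNIV)\<^sup>*\<^sup>* (c \<circ> \<tau>) c" by simp
  with half[of c, OF vw(2)] have "(go A UNIV)\<^sup>*\<^sup>* (c \<circ> ?t) c" by (rule rtranclp_trans)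
  then show ?thesis using upd_transpose[of c w v] vw by simp
qed

lemma go_star_sym:
  assumes "(go A UNIV)\<^sup>*\<^sup>* c c'" "\<And>v w. (v, w) \<in> A \<Longrightarrow> (w, v) \<in> A\<^sup>*"
  shows "(go A UNIV)\<^sup>*\<^sup>* c' c"
  using assms(1)
proof induction
  case (step y z)
  then show ?case using go_reverse[OF step(2) assms(2)] by auto
qed simp

text \<open>A move against an arc undoes a move along it, so \<open>go_reverse\<close> supplies
  it.\<close>

lemma go_star_symmetrize:
  assumes "(go (A \<union> A\<inverse>) UNIV)\<^sup>*\<^sup>* c c'" "\<And>v w. (v, w) \<in> A \<Longrightarrow> (w, v) \<in> A\<^sup>*"
  shows "(go A UNIV)\<^sup>*\<^sup>* c c'"
  using assms(1)
proof induction
  case (step y z)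
  have "(go A UNIV)\<^sup>*\<^sup>* y z"
  proof -
    obtain v w where vw: "(v, w) \<in> A \<union> A\<inverse>" "y v \<noteq> Hole" "y w = Hole" "z = y(v := Hole, w := y v)"
      using step(2) unfolding go_def by blast
    show ?thesis
    proof (cases "(v, w) \<in> A")
      case True
      then have "go A UNIV y z" unfolding go_def using vw by blast
      then show ?thesis by blast
    next
      case False
      then have "(w, v) \<in> A" using vw by auto
      moreover have "y = z(w := Hole, v := z w)" using vw by (auto simp: fun_eq_iff)
      moreover have "z w \<noteq> Hole" "z v = Hole" using vw by auto
      ultimately have "go A UNIV z y" unfolding go_def by blast
      then show ?thesis using go_reverse assms(2) by blast
    qed
  qed
  then show ?case using step by auto
qed simp

text \<open>Look at the last but one vertex \<open>x\<close>. If it is a hole, bring the obstacle of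
  \<open>u\<close> to \<open>x\<close> and then on to \<open>h\<close>; otherwise its obstacle goes
  to \<open>h\<close>, and the hole now at \<open>x\<close> is transferred to \<open>u\<close>.
  Obstacles being indistinguishable, the net effect is the same. The robot is not on the walk, hence
  \<open>Y\<close> is arbitrary.\<close>

lemma transfer_walk:
  assumes "(u, h) \<in> rtrancl_on F A" "\<And>x. x \<in> F \<Longrightarrow> c x \<noteq> Robot" "c h = Hole"
  shows "(go (A \<inter> F \<times> F) Y)\<^sup>*\<^sup>* c (c(h := c u, u := Hole))"
  using assms
proof (induction arbitrary: c rule: rtrancl_on_induct)
  case base
  then have eq: "c(u := c u, u := Hole) = c" by auto
  show ?case unfolding eq by blast
next
  case (step x h)
  show ?case
  proof (cases "c u = Hole")
    case True
    then have eq: "c(h := c u, u := Hole) = c" using step by auto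
    show ?thesis unfolding eq by blast
  next
    case False
    have uF: "u \<in> F" using step(1) in_rtrancl_on_in_F by fastforce
    have cu: "c u = Obstacle" using step.prems(1)[OF uF] False cell.exhaust by blast
    have uh: "u \<noteq> h" using cu step by auto
    show ?thesis
    proof (cases "c x = Hole")
      case True
      let ?d = "c(x := c u, u := Hole)"
      have 1: "(go (A \<inter> F \<times> F) Y)\<^sup>*\<^sup>* c ?d" using step.IH[of c] step.prems True by blast
      have "u \<noteq> x" using True cu by auto
      show ?thesis
      proof (cases "x = h")
        case True
        show ?thesis using 1 unfolding True .
      next
        case xh: False
        have eq: "c(h := c u, u := Hole) = ?d(x := Hole, h := ?d x)"
          using \<open>u \<noteq> x\<close> uh xh True by (auto simp: fun_eq_iff)
        have "go (A \<inter> F \<times> F) Y ?d (?d(x := Hole, h := ?d x))"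
          unfolding go_def using step uh xh \<open>u \<noteq> x\<close> cu by (intro exI[of _ x] exI[of _ h]) auto
        then show ?thesis unfolding eq
          by (rule rtranclp.rtrancl_into_rtrancl[of "go (A \<inter> F \<times> F) Y" c ?d, OF 1])
      qed
    next
      case False
      have xF: "x \<in> F" using step by auto
      have cx: "c x = Obstacle" using step.prems(1)[OF xF] False cell.exhaust by blast
      have xh: "x \<noteq> h" using cx step by auto
      let ?d = "c(x := Hole, h := c x)"
      have 1: "go (A \<inter> F \<times> F) Y c ?d"
        unfolding go_def using step cx xh by (intro exI[of _ x] exI[of _ h]) auto
      have 2: "(go (A \<inter> F \<times> F) Y)\<^sup>*\<^sup>* ?d (?d(x := ?d u, u := Hole))"
        by (rule step.IH) (use step.prems xh cx in auto)
      have eq: "?d(x := ?d u, u := Hole) = c(h := c u, u := Hole)"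
        using cx cu uh xh by (auto simp: fun_eq_iff)
      show ?thesis using 2 unfolding eq
        by (rule converse_rtranclp_into_rtranclp[of "go (A \<inter> F \<times> F) Y" c ?d, OF 1])
    qed
  qed
qed

text \<open>The walk may revisit vertices, even \<open>p\<close>: whatever the robot leaves is a
  hole, so only its first and its current place matter.\<close>

lemma slide_walk:
  assumes "(p, q) \<in> rtrancl_on (insert p H) A" "c p = Robot" "\<And>x. x \<in> H \<Longrightarrow> c x = Hole"
  shows "(go A UNIV)\<^sup>*\<^sup>* c (c(p := Hole, q := Robot))"
  using assms(1)
proof (induction rule: rtrancl_on_induct)
  case base
  have eq: "c(p := Hole, p := Robot) = c" using assms by auto
  show ?case unfolding eq by blast
next
  case (step x x')
  show ?case
  proof (cases "x' = x")
    case False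
    let ?d = "c(p := Hole, x := Robot)"
    have "?d x' = Hole" using step assms(3) False by auto
    moreover have "c(p := Hole, x' := Robot) = ?d(x := Hole, x' := ?d x)"
      using step(3) assms(3) False by (auto simp: fun_eq_iff)
    ultimately have "go A UNIV ?d (c(p := Hole, x' := Robot))"
      unfolding go_def using step(2) by (intro exI[of _ x] exI[of _ x']) auto
    then show ?thesis
      by (rule rtranclp.rtrancl_into_rtrancl[of "go A UNIV" c ?d, OF step(5)])
  next
    case True
    show ?thesis unfolding True by (rule step(5))
  qed
qed

section \<open>What moves preserve: cells off the arcs, numbers of cells of each kind, the single
  robot\<close>

lemma go_outside: "go A Y c c' \<Longrightarrow> A \<subseteq> X \<times> X \<Longrightarrow> x \<notin> X \<Longrightarrow> c' x = c x"
  unfolding go_def by auto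

lemma go_star_outside: "(go A Y)\<^sup>*\<^sup>* c c' \<Longrightarrow> A \<subseteq> X \<times> X \<Longrightarrow> x \<notin> X \<Longrightarrow> c' x = c x"
  by (induction rule: rtranclp_induct) (simp_all add: go_outside)

lemma go_cells:
  assumes "go A Y c c'" "A \<subseteq> X \<times> X"
  shows "card {x \<in> X. c' x = k} = card {x \<in> X. c x = k}"
proof -
  obtain v w where vw: "(v, w) \<in> A" "c w = Hole" "c' = c(v := Hole, w := c v)"
    using assms(1) unfolding go_def by blast
  let ?t = "Transposition.transpose v w"
  have c': "c' = c \<circ> ?t" using vw upd_transpose by metis
  have tX: "?t x \<in> X \<longleftrightarrow> x \<in> X" for x
    using vw assms by (auto simp: Transposition.transpose_def)
  have "{x \<in> X. c' x = k} = ?t ` {x \<in> X. c x = k}"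
  proof (intro equalityI subsetI)
    fix x assume "x \<in> {x \<in> X. c' x = k}"
    then have "?t x \<in> {x \<in> X. c x = k}" using tX c' by auto
    then show "x \<in> ?t ` {x \<in> X. c x = k}" by (metis image_eqI transpose_involutory)
  qed (use tX c' in auto)
  moreover have "inj_on ?t {x \<in> X. c x = k}" by (rule inj_on_transpose)
  ultimately show ?thesis by (simp only: card_image)
qed

lemma go_star_cells:
  assumes "(go A Y)\<^sup>*\<^sup>* c c'" "A \<subseteq> X \<times> X"
  shows "card {x \<in> X. c' x = k} = card {x \<in> X. c x = k}"
  using assms(1)
proof induction
  case (step y z)
  then show ?case using go_cells[OF step(2) assms(2), of k] by simp
qed simp

definition robot_only :: "'a set \<Rightarrow> 'a config \<Rightarrow> 'a \<Rightarrow> bool" where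
  "robot_only V c v \<longleftrightarrow> {x \<in> V. c x = Robot} = {v}"

lemma robot_onlyD: "robot_only V c v \<Longrightarrow> c v = Robot" "robot_only V c v \<Longrightarrow> v \<in> V"
  "robot_only V c v \<Longrightarrow> x \<in> V \<Longrightarrow> c x = Robot \<longleftrightarrow> x = v"
  unfolding robot_only_def by auto

lemma go_robot:
  assumes "go A Y c c'" "A \<subseteq> V \<times> V" "robot_only V c v"
  obtains "robot_only V c' v" | w where "(v, w) \<in> A" "w \<in> Y" "c w = Hole" "c' = c(v := Hole, w := Robot)" "robot_only V c' w"
proof -
  obtain x w where xw: "(x, w) \<in> A" "c x \<noteq> Hole" "c w = Hole" "c' = c(x := Hole, w := c x)" "c x = Robot \<longrightarrow> w \<in> Y"
    using assms(1) unfolding go_def by blast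
  have R: "\<And>y. y \<in> V \<Longrightarrow> c y = Robot \<longleftrightarrow> y = v" "v \<in> V" using assms(3) unfolding robot_only_def by auto
  show thesis
  proof (cases "x = v")
    case True
    then have "c x = Robot" using R by auto
    moreover have "robot_only V c' w"
      unfolding robot_only_def using xw R True assms(2) by (auto split: if_splits)
    ultimately show thesis using xw True that(2) by auto
  next
    case False
    have "w \<noteq> v" using xw(3) R by force
    then have "robot_only V c' v"
      unfolding robot_only_def using xw R False assms(2) by (auto split: if_splits)
    then show thesis using that(1) by auto
  qed
qed

lemma go_star_robot:
  assumes "(go A Y)\<^sup>*\<^sup>* c c'" "A \<subseteq> V \<times> V" "robot_only V c v"
  shows "\<exists>v'. robot_only V c' v' \<and> (v' = v \<or> v' \<in> Y)"
  using assms(1)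
proof induction
  case base
  then show ?case using assms by auto
next
  case (step y z)
  then obtain v' where v': "robot_only V y v'" "v' = v \<or> v' \<in> Y" by blast
  from go_robot[OF step(2) assms(2) v'(1)] show ?case using v' by metis
qed

section \<open>Moving the robot along a path of blocks\<close>

context ugraph
begin

abbreviation reach :: "'a config \<Rightarrow> 'a config \<Rightarrow> bool" where
  "reach \<equiv> (go E UNIV)\<^sup>*\<^sup>*"

text \<open>With the robot at \<open>p\<close>, this is the component beside it whose holes can be
  rearranged while the robot rests. It is empty for \<open>g = p\<close>.\<close>

definition region :: "'a \<Rightarrow> 'a \<Rightarrow> 'a set" where
  "region p g = {u. conn (V - {p}) u g}"

definition hole_count :: "'a config \<Rightarrow> 'a \<Rightarrow> 'a \<Rightarrow> nat" where
  "hole_count c p g = card {x \<in> region p g. c x = Hole}"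

lemma region_subset: "region p g \<subseteq> V - {p}"
  unfolding region_def by (auto dest: in_rtrancl_on_in_F)

lemma finite_region: "finite (region p g)"
  using region_subset fin finite_subset by (metis finite_Diff)

lemma region_connected:
  assumes "x \<in> region p g" "y \<in> region p g"
  shows "conn (region p g) x y"
proof -
  have "conn (region p g) u g" if "conn (V - {p}) u g" for u
    using that
  proof (induction rule: converse_rtrancl_on_induct)
    case base
    then show ?case unfolding region_def by auto
  next
    case (step x y)
    then have "x \<in> region p g" unfolding region_def
      by (auto intro: converse_rtrancl_on_into_rtrancl_on)
    with step show ?case by (blast intro: converse_rtrancl_on_into_rtrancl_on)
  qed
  then show ?thesis using assms conn_sym conn_trans unfolding region_def by blast
qed

text \<open>While some vertex of \<open>S\<close> is not a hole, counting yields a hole of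
  \<open>T\<close> outside \<open>S\<close>. Transferring it to that vertex changes nothing else, so
  the number of unfilled vertices of \<open>S\<close> drops.\<close>

lemma rearrange:
  assumes T: "T \<subseteq> V" "\<And>x y. x \<in> T \<Longrightarrow> y \<in> T \<Longrightarrow> conn T x y"
    and "\<And>x. x \<in> T \<Longrightarrow> c x \<noteq> Robot" and S: "S \<subseteq> T" and "card S \<le> card {x \<in> T. c x = Hole}"
  shows "\<exists>c'. reach c c' \<and> (\<forall>x\<in>S. c' x = Hole) \<and> (\<forall>x. x \<notin> T \<longrightarrow> c' x = c x) \<and> (\<forall>x\<in>T. c' x \<noteq> Robot)"
  using assms(3,5)
proof (induction "card {x \<in> S. c x \<noteq> Hole}" arbitrary: c rule: less_induct)
  case less
  have finT: "finite T" by (rule finite_subset[OF T(1) fin])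
  have finS: "finite S" by (rule finite_subset[OF S finT])
  show ?case
  proof (cases "\<forall>x\<in>S. c x = Hole")
    case True
    then show ?thesis using less.prems by blast
  next
    case False
    then obtain u where u: "u \<in> S" "c u \<noteq> Hole" by blast
    have "\<exists>h\<in>T. c h = Hole \<and> h \<notin> S"
    proof (rule ccontr)
      assume "\<not> ?thesis"
      then have "{x \<in> T. c x = Hole} \<subset> S" using u by blast
      then have "card {x \<in> T. c x = Hole} < card S" using finS psubset_card_mono by blast
      then show False using less.prems(2) by simp
    qed
    then obtain h where h: "h \<in> T" "c h = Hole" "h \<notin> S" by blast
    have cu: "c u = Obstacle" using less.prems(1) u S cell.exhaust by (metis subset_eq)
    have uh: "u \<noteq> h" using u h by auto
    let ?d = "c(h := c u, u := Hole)"
    have "(go (E \<inter> T \<times> T) UNIV)\<^sup>*\<^sup>* c ?d"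
      using transfer_walk[of u h T E c UNIV] T(2) u S h less.prems(1) by blast
    then have cd: "reach c ?d" by (rule go_star_mono) auto
    have 1: "?d x \<noteq> Robot" if "x \<in> T" for x using that less.prems(1) cu by auto
    have "{x \<in> T. ?d x = Hole} = insert u ({x \<in> T. c x = Hole} - {h})"
      using u S cu uh by auto
    then have "card {x \<in> T. ?d x = Hole} = Suc (card ({x \<in> T. c x = Hole} - {h}))"
      using finT cu by simp
    also have "\<dots> = card {x \<in> T. c x = Hole}"
      using h finT by (intro card.remove[symmetric]) auto
    finally have 2: "card S \<le> card {x \<in> T. ?d x = Hole}" using less.prems(2) by simp
    have "{x \<in> S. ?d x \<noteq> Hole} \<subset> {x \<in> S. c x \<noteq> Hole}" using u h uh by auto
    then have 3: "card {x \<in> S. ?d x \<noteq> Hole} < card {x \<in> S. c x \<noteq> Hole}"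
      using finS by (intro psubset_card_mono) auto
    obtain c' where c': "reach ?d c'" "\<forall>x\<in>S. c' x = Hole" "\<forall>x. x \<notin> T \<longrightarrow> c' x = ?d x"
      "\<forall>x\<in>T. c' x \<noteq> Robot"
      using less.hyps[OF 3 1 2] by blast
    have "c' x = c x" if "x \<notin> T" for x using c'(3) that h(1) u(1) S by auto
    moreover have "reach c c'" using cd c'(1) by (rule rtranclp_trans)
    ultimately show ?thesis using c' by blast
  qed
qed

lemma rearrange_region:
  assumes R: "robot_only V c p" and "S \<subseteq> region p g" "card S \<le> hole_count c p g"
  obtains c' where "reach c c'" "\<And>x. x \<in> S \<Longrightarrow> c' x = Hole" "robot_only V c' p"
proof -
  have "\<exists>c'. reach c c' \<and> (\<forall>x\<in>S. c' x = Hole) \<and> (\<forall>x. x \<notin> region p g \<longrightarrow> c' x = c x) \<and> (\<forall>x\<in>region p g. c' x \<noteq> Robot)"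
    using assms region_subset[of p g] region_connected
    by (intro rearrange) (auto simp: hole_count_def robot_onlyD(3)[OF R])
  then obtain c' where c': "reach c c'" "\<forall>x\<in>S. c' x = Hole" "\<forall>x. x \<notin> region p g \<longrightarrow> c' x = c x" "\<forall>x\<in>region p g. c' x \<noteq> Robot"
    by blast
  have "c' x = Robot \<longleftrightarrow> x = p" if "x \<in> V" for x
    using c'(3,4) robot_onlyD(3)[OF R that] region_subset[of p g] by (cases "x \<in> region p g") auto
  then have "robot_only V c' p" unfolding robot_only_def using robot_onlyD(2)[OF R] by auto
  then show thesis using c' that by blast
qed

lemma robot_only_slide:
  assumes "robot_only V c p" "q \<in> V" "q \<noteq> p"
  shows "robot_only V (c(p := Hole, q := Robot)) q"
  using assms robot_onlyD(3)[OF assms(1)] unfolding robot_only_def by auto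

lemma hole_count_ge:
  assumes "finite S" "S \<subseteq> region p g" "\<And>x. x \<in> S \<Longrightarrow> c x = Hole"
  shows "card S \<le> hole_count c p g"
  unfolding hole_count_def by (rule card_mono) (use assms finite_region in auto)

text \<open>For a step from \<open>y\<close> to \<open>z\<close>, bring holes onto \<open>Q\<close>
  and \<open>z\<close>. After it, \<open>Q\<close> and \<open>y\<close> are holes, and
  \<open>y\<close> is on the same side of \<open>z\<close> as \<open>g\<close>, because
  \<open>z\<close> does not separate vertices of the block. So the supply of one hole more than
  \<open>Q\<close> is kept.\<close>

lemma block_walk:
  assumes B: "block B" "g \<in> B" "p \<in> B" and R: "robot_only V c p" and fQ: "finite Q"
    and Q: "\<And>y. y \<in> B \<Longrightarrow> y \<noteq> g \<Longrightarrow> Q \<subseteq> region y g"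
    and n: "Suc (card Q) \<le> hole_count c p g" and py: "conn (B - {g}) p y"
  shows "\<exists>c'. reach c c' \<and> robot_only V c' y \<and> Suc (card Q) \<le> hole_count c' y g"
  using py
proof (induction rule: rtrancl_on_induct)
  case base
  then show ?case using R n by blast
next
  case (step y z)
  then obtain c1 where c1: "reach c c1" "robot_only V c1 y" "Suc (card Q) \<le> hole_count c1 y g" by blast
  show ?case
  proof (cases "z = y")
    case True
    then show ?thesis using c1 by blast
  next
    case False
    have zQ: "z \<notin> Q" and yQ: "y \<notin> Q" using Q region_subset step by blast+
    have zc: "z \<in> region y g" "y \<in> region z g"
      unfolding region_def using block_conn[OF B(1) _ B(2)] False step by auto
    have "insert z Q \<subseteq> region y g" using zc Q step by auto
    moreover have "card (insert z Q) \<le> hole_count c1 y g" using c1 zQ fQ by simp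
    ultimately obtain c2 where c2: "reach c1 c2" "\<And>x. x \<in> insert z Q \<Longrightarrow> c2 x = Hole" "robot_only V c2 y"
      using rearrange_region[OF c1(2)] by metis
    let ?d = "c2(y := Hole, z := Robot)"
    have zV: "z \<in> V" using step B block_subset by auto
    have "(y, z) \<in> rtrancl_on (insert y {z}) E" using step(2) by (intro conn_edge) auto
    then have "reach c2 ?d"
      by (rule slide_walk) (use robot_onlyD(1)[OF c2(3)] c2(2) in auto)
    moreover have "robot_only V ?d z" using robot_only_slide[OF c2(3) zV False] .
    moreover have "card (insert y Q) \<le> hole_count ?d z g"
      using zc Q step zQ c2(2) False fQ by (intro hole_count_ge) auto
    ultimately show ?thesis using c1(1) c2(1) fQ yQ by (metis card_insert_disjoint rtranclp_trans)
  qed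
qed

lemma two_le_card_if_distinct: "finite B \<Longrightarrow> x \<in> B \<Longrightarrow> y \<in> B \<Longrightarrow> x \<noteq> y \<Longrightarrow> 2 \<le> card B"
  by (metis card_le_Suc0_iff_eq not_less_eq_eq numeral_2_eq_2)

lemma block_arrive:
  assumes B: "block B" "g \<in> B" "p \<in> B" "p \<noteq> g" and R: "robot_only V c p" and fQ: "finite Q"
    and Q: "\<And>y. y \<in> B \<Longrightarrow> y \<noteq> g \<Longrightarrow> Q \<subseteq> region y g"
    and n: "Suc (card Q) \<le> hole_count c p g"
  obtains y c' where "y \<in> B" "y \<noteq> g" "(y, g) \<in> E" "reach c c'" "robot_only V c' y"
    "Suc (card Q) \<le> hole_count c' y g"
proof -
  have "finite B" using B(1) block_subset fin finite_subset by blast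
  then have "2 \<le> card B" using two_le_card_if_distinct[of B p g] B by simp
  then obtain y where y: "y \<in> B" "y \<noteq> g" "(g, y) \<in> E" using block_neighbour'[OF B(1,2)] by blast
  then have "conn (B - {g}) p y" using block_conn_inside[OF B(1,3) y(1), of g] B by auto
  from block_walk[OF B(1-3) R fQ Q n this] show thesis
    using that[OF y(1,2) symD[OF symE y(3)]] by blast
qed

text \<open>With \<open>Q\<close> empty, a single hole takes the robot to a neighbour of
  \<open>t\<close>; then that hole is brought onto \<open>t\<close> itself.\<close>

lemma block_goal:
  assumes B: "block B" "t \<in> B" "p \<in> B" "p \<noteq> t" and R: "robot_only V c p"
    and n: "1 \<le> hole_count c p t"
  shows "\<exists>c'. reach c c' \<and> c' t = Robot"
proof -
  obtain y c1 where y: "y \<in> B" "y \<noteq> t" "(y, t) \<in> E" "reach c c1" "robot_only V c1 y"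
    "Suc (card ({} :: 'a set)) \<le> hole_count c1 y t"
    by (rule block_arrive[OF B R, of "{}"]) (use n in auto)
  have "t \<in> region y t" unfolding region_def using y B block_subset by auto
  then obtain c2 where c2: "reach c1 c2" "\<And>x. x \<in> {t} \<Longrightarrow> c2 x = Hole" "robot_only V c2 y"
    using rearrange_region[OF y(5), of "{t}" t] y(6) by auto
  have "(y, t) \<in> rtrancl_on (insert y {t}) E" using y(3) by (intro conn_edge) auto
  then have "reach c2 (c2(y := Hole, t := Robot))"
    by (rule slide_walk) (use robot_onlyD(1)[OF c2(3)] c2(2) in auto)
  then show ?thesis using y(4) c2(1) by (intro exI[of _ "c2(y := Hole, t := Robot)"]) auto
qed

end

text \<open>\<open>v i\<close> joins \<open>S i\<close> to \<open>S (Suc i)\<close>. Only the target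
  is fixed: on its way the robot may also start from a block that branches off the path.\<close>

locale block_path = ugraph +
  fixes S :: "nat \<Rightarrow> 'a set" and v :: "nat \<Rightarrow> 'a" and r :: nat and t :: 'a
  assumes r: "0 < r"
    and blk: "\<And>i. i \<le> r \<Longrightarrow> block (S i)"
    and S_inj: "\<And>i j. i \<le> r \<Longrightarrow> j \<le> r \<Longrightarrow> S i = S j \<Longrightarrow> i = j"
    and v_inj: "\<And>i j. i < r \<Longrightarrow> j < r \<Longrightarrow> v i = v j \<Longrightarrow> i = j"
    and vS: "\<And>i. i < r \<Longrightarrow> v i \<in> S i"
    and vS': "\<And>i. i < r \<Longrightarrow> v i \<in> S (Suc i)"
    and t: "t \<in> S r" "t \<noteq> v (r - 1)"
begin

section \<open>Separation along a path of blocks\<close>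

lemma S_sub: "i \<le> r \<Longrightarrow> S i \<subseteq> V"
  using blk block_subset by blast

lemma vV: "i < r \<Longrightarrow> v i \<in> V"
  using vS[of i] S_sub[of i] by auto

lemma ahead_conn_next:
  assumes "i < k" "k \<le> r" "x \<in> S k" "x \<noteq> v i" "y \<in> S (Suc i)" "y \<noteq> v i"
  shows "conn (V - {v i}) x y"
proof -
  have "Suc i \<le> k" using assms(1) by simp
  then show ?thesis using assms(2-4)
  proof (induction k arbitrary: x rule: dec_induct)
    case base
    then show ?case using block_conn[OF blk[of "Suc i"] _ assms(5), of x "v i"] assms(6) by auto
  next
    case (step k)
    then have k: "v k \<in> S k" "v k \<in> S (Suc k)" "v k \<noteq> v i" using vS vS' v_inj[of k i] by auto
    have "conn (V - {v i}) x (v k)"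
      using block_conn[OF blk[of "Suc k"] step(5) k(2), of "v i"] step k by auto
    moreover have "conn (V - {v i}) (v k) y" using step k by auto
    ultimately show ?case by (rule conn_trans)
  qed
qed

lemma behind_conn:
  assumes "k \<le> i" "i < r" "x \<in> S k" "x \<noteq> v i" "y \<in> S i" "y \<noteq> v i"
  shows "conn (V - {v i}) x y"
  using assms(1,3,4)
proof (induction k arbitrary: x rule: inc_induct)
  case base
  then show ?case using block_conn[OF blk[of i] _ assms(5), of x "v i"] assms by auto
next
  case (step k)
  then have k: "v k \<in> S k" "v k \<in> S (Suc k)" "v k \<noteq> v i" using vS vS' v_inj[of k i] assms(2) by auto
  have "conn (V - {v i}) x (v k)"
    using block_conn[OF blk[of k] step(4) k(1), of "v i"] step k assms(2) by auto
  moreover have "conn (V - {v i}) (v k) y" using step k by auto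
  ultimately show ?case by (rule conn_trans)
qed

lemma front_exists:
  assumes "i < r" obtains y where "y \<in> S (Suc i)" "y \<noteq> v i"
proof (cases "Suc i = r")
  case True
  then show thesis using t that by auto
next
  case False
  then show thesis using that[of "v (Suc i)"] vS[of "Suc i"] v_inj[of "Suc i" i] assms by auto
qed

lemma ahead_conn:
  assumes "i < k" "k \<le> r" "x \<in> S k" "x \<noteq> v i" "i < l" "l \<le> r" "y \<in> S l" "y \<noteq> v i"
  shows "conn (V - {v i}) x y"
proof -
  have "i < r" using assms by linarith
  then obtain z where z: "z \<in> S (Suc i)" "z \<noteq> v i" using front_exists by blast
  show ?thesis using conn_trans[OF ahead_conn_next[OF assms(1-4) z] conn_sym[OF ahead_conn_next[OF assms(5-8) z]]] .
qed

text \<open>Everything ahead of \<open>v i\<close> is joined to \<open>S (Suc i)\<close> without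
  \<open>v i\<close>, which reduces this to \<open>block_sep\<close>. The block \<open>B\<close> is
  arbitrary so that it covers both \<open>S i\<close> and branches at \<open>v i\<close>.\<close>

lemma front_sep:
  assumes "i < r" "block B" "v i \<in> B" "B \<noteq> S (Suc i)" "x \<in> B" "x \<noteq> v i"
    and "i < k" "k \<le> r" "y \<in> S k" "y \<noteq> v i"
  shows "\<not> conn (V - {v i}) x y"
proof
  assume xy: "conn (V - {v i}) x y"
  obtain z where z: "z \<in> S (Suc i)" "z \<noteq> v i" using front_exists assms(1) by blast
  have "conn (V - {v i}) x z" using xy ahead_conn_next[of i k y z] assms z conn_trans by blast
  then show False using block_sep[of B "S (Suc i)" "v i" x z] assms z blk vS' by auto
qed

text \<open>Replace \<open>x\<close> by a vertex of \<open>S i\<close> on the same side of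
  \<open>v i\<close>, namely \<open>x\<close> itself or the preceding cut vertex, and apply
  \<open>front_sep\<close> to \<open>S i\<close>.\<close>

lemma ahead_sep_behind:
  assumes "k \<le> i" "i < k'" "k' \<le> r" "x \<in> S k" "x \<noteq> v i" "y \<in> S k'" "y \<noteq> v i"
  shows "\<not> conn (V - {v i}) x y"
proof
  assume xy: "conn (V - {v i}) x y"
  obtain z where z: "z \<in> S i" "z \<noteq> v i"
  proof (cases "k = i")
    case True
    then show thesis using that assms by auto
  next
    case False
    then obtain j where "i = Suc j" using assms(1) by (cases i) auto
    then show thesis using that[of "v j"] vS'[of j] v_inj[of j i] assms by auto
  qed
  have "conn (V - {v i}) z x" using behind_conn[of k i x z] assms z conn_sym by auto
  then have "conn (V - {v i}) z y" using xy conn_trans by blast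
  then show False
    using front_sep[of i "S i" z k' y] assms z blk[of i] vS[of i] S_inj[of i "Suc i"] by auto
qed

text \<open>In any other block of the path, \<open>v m\<close> would lie both behind and ahead of a
  neighbouring cut vertex and so be separated from itself.\<close>

lemma v_in_S:
  assumes "v m \<in> S k" "m < r" "k \<le> r"
  shows "k = m \<or> k = Suc m"
proof (rule ccontr)
  assume *: "\<not> ?thesis"
  then consider "Suc m < k" | "k < m" by linarith
  then show False
  proof cases
    case 1
    then have "v m \<noteq> v (Suc m)" using v_inj[of m "Suc m"] assms by auto
    then show False
      using ahead_sep_behind[of "Suc m" "Suc m" k "v m" "v m"] 1 assms vS'[of m] vV[of m] by auto
  next
    case 2
    then obtain j where j: "m = Suc j" by (cases m) auto
    then have "v m \<noteq> v j" using v_inj[of m j] assms by auto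
    then show False
      using ahead_sep_behind[of k j m "v m" "v m"] j 2 assms vS[of m] vV[of m] by auto
  qed
qed

lemma t_ne_v: "i < r \<Longrightarrow> t \<noteq> v i"
  using v_in_S[of i r] t r by (cases "i = r - 1") auto

lemma chain:
  assumes "m \<le> k" "k < r" "\<And>j. m \<le> j \<Longrightarrow> j \<le> k \<Longrightarrow> p \<noteq> v j"
  shows "conn (V - {p}) (v k) (v m)"
  using assms
proof (induction k rule: dec_induct)
  case base
  then show ?case using vV[of m] by auto
next
  case (step k)
  have "conn (V - {p}) (v (Suc k)) (v k)"
    using block_conn[OF blk[of "Suc k"] vS[of "Suc k"] vS'[of k], of p] step by auto
  moreover have "conn (V - {p}) (v k) (v m)" using step by auto
  ultimately show ?case by (rule conn_trans)
qed

section \<open>Sufficiency: from one stopping place to the next\<close>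

definition branching_at :: "'a \<Rightarrow> bool" where
  "branching_at w \<longleftrightarrow> (\<exists>B. block B \<and> w \<in> B \<and> (\<forall>i\<le>r. B \<noteq> S i))"

text \<open>Indices start at \<open>0\<close> here, at \<open>1\<close> in the definition of \<open>corridor\<close>.\<close>

definition corr :: "nat \<Rightarrow> nat \<Rightarrow> bool" where
  "corr a b \<longleftrightarrow> a \<le> b \<and> b < r \<and>
     (a = 0 \<or> 3 \<le> card (S a) \<or> branching_at (v a)) \<and>
     (Suc b = r \<or> 3 \<le> card (S (Suc b)) \<or> branching_at (v b)) \<and>
     (\<forall>k. a < k \<and> k \<le> b \<longrightarrow> card (S k) = 2) \<and>
     (\<forall>k. a < k \<and> k < b \<longrightarrow> \<not> branching_at (v k))"

lemma finite_S: "i \<le> r \<Longrightarrow> finite (S i)"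
  using S_sub fin finite_subset by metis

lemma card_S: assumes "i \<le> r" shows "2 \<le> card (S i)"
proof (cases i)
  case 0
  have "v 0 \<in> S 0" "0 < r" using vS r by auto
  obtain y where "y \<in> S 1" "y \<noteq> v 0" using front_exists[OF r] by auto
  then have "2 \<le> card V"
    using two_le_card_if_distinct[OF fin, of y "v 0"] S_sub[of 1] vV[OF r] r by auto
  then show ?thesis using block_card blk assms by blast
next
  case (Suc j)
  then have "j < r" using assms by simp
  then obtain y where "y \<in> S i" "y \<noteq> v j" using front_exists Suc by blast
  then show ?thesis using two_le_card_if_distinct[OF finite_S[OF assms]] vS'[OF \<open>j < r\<close>] Suc by blast
qed

lemma thin_edge:
  assumes "Suc k < r" "card (S (Suc k)) = 2"
  shows "S (Suc k) = {v k, v (Suc k)}" "(v k, v (Suc k)) \<in> E"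
proof -
  have 1: "v k \<in> S (Suc k)" "v (Suc k) \<in> S (Suc k)" "v k \<noteq> v (Suc k)"
    using assms vS' vS v_inj[of k "Suc k"] by auto
  then show 2: "S (Suc k) = {v k, v (Suc k)}"
    using assms(2) finite_S[of "Suc k"] assms(1)
    by (metis card_2_iff doubleton_eq_iff insertE singletonD)
  obtain x where "x \<in> S (Suc k)" "x \<noteq> v k" "(v k, x) \<in> E"
    using block_neighbour'[of "S (Suc k)" "v k"] 1 blk[of "Suc k"] assms by auto
  then show "(v k, v (Suc k)) \<in> E" using 2 by auto
qed

text \<open>\<open>b\<close> is the first place where the robot can step aside again; by minimality,
  everything in between is thin and unbranched. A branch counts only if \<open>m < b\<close>, since
  one at \<open>v m\<close> may be where the robot comes from.\<close>

lemma next_stop: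
  assumes m: "m < r" and start: "m = 0 \<or> 3 \<le> card (S m) \<or> branching_at (v m)"
  obtains b where "m \<le> b" "b < r" "Suc b = r \<or> 3 \<le> card (S (Suc b)) \<or> m < b \<and> branching_at (v b)"
    "\<And>k. m \<le> k \<Longrightarrow> k < b \<Longrightarrow> card (S (Suc k)) = 2" "corr m b"
proof -
  define stop where "stop b \<longleftrightarrow> 3 \<le> card (S (Suc b)) \<or> Suc b = r \<or> (m < b \<and> branching_at (v b))" for b
  obtain b where b: "m \<le> b" "b < r" "stop b" "\<And>k. m \<le> k \<Longrightarrow> k < b \<Longrightarrow> \<not> stop k"
  proof -
    have "m \<le> r - 1 \<and> r - 1 < r \<and> stop (r - 1)" using m unfolding stop_def by auto
    then have "\<exists>b. (m \<le> b \<and> b < r \<and> stop b) \<and> (\<forall>k<b. \<not> (m \<le> k \<and> k < r \<and> stop k))"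
      using exists_least_iff[of "\<lambda>b. m \<le> b \<and> b < r \<and> stop b"] by blast
    then obtain b where b: "m \<le> b" "b < r" "stop b" "\<And>k. k < b \<Longrightarrow> \<not> (m \<le> k \<and> k < r \<and> stop k)"
      by blast
    have "\<not> stop k" if "m \<le> k" "k < b" for k using b(4)[OF that(2)] that b(2) by simp
    then show thesis using that[OF b(1-3)] by blast
  qed
  have thin: "card (S (Suc k)) = 2" if "m \<le> k" "k < b" for k
    using b(4)[OF that] card_S[of "Suc k"] b(2) that unfolding stop_def by auto
  have "corr m b"
    unfolding corr_def
  proof (intro conjI allI impI)
    show "Suc b = r \<or> 3 \<le> card (S (Suc b)) \<or> branching_at (v b)" using b(3) stop_def by blast
    show "card (S k) = 2" if "m < k \<and> k \<le> b" for k using thin[of "k - 1"] that by auto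
    show "\<not> branching_at (v k)" if "m < k \<and> k < b" for k using b(4)[of k] that stop_def by auto
  qed (use b start in auto)
  then show thesis using that[of b] b(1-3) thin unfolding stop_def by blast
qed

text \<open>
  The robot is beside \<open>v m\<close>, in the preceding block of the path or in a branch. The minimum is there
  because fewer than \<open>K\<close> vertices may be left between \<open>v m\<close> and \<open>t\<close>.
\<close>

definition station :: "nat \<Rightarrow> nat \<Rightarrow> 'a set \<Rightarrow> 'a \<Rightarrow> 'a config \<Rightarrow> bool" where
  "station K m B p c \<longleftrightarrow> m < r \<and> block B \<and> v m \<in> B \<and> B \<noteq> S (Suc m) \<and> p \<in> B \<and> p \<noteq> v m \<and>
     (m = 0 \<or> 3 \<le> card (S m) \<or> branching_at (v m)) \<and> robot_only V c p \<and>
     min K (Suc (r - m)) \<le> hole_count c p (v m)"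

text \<open>Holes are brought onto \<open>Q\<close>, which contains the corridor, and onto
  \<open>x\<close>; then the robot slides from \<open>y\<close> to \<open>x\<close>. It leaves holes
  on \<open>Q\<close> and on \<open>y\<close>, as many as were used.\<close>

lemma pass:
  assumes R: "robot_only V c y" and m: "m \<le> b" "b < r" and y: "(y, v m) \<in> E"
    and e: "\<And>k. m \<le> k \<Longrightarrow> k < b \<Longrightarrow> (v k, v (Suc k)) \<in> E" and x: "(v b, x) \<in> E"
    and Q: "Q \<subseteq> region y (v m)" "finite Q" "v ` {m..b} \<subseteq> Q" "x \<notin> Q" "x \<noteq> y" "x \<in> region y (v m)"
    and n: "Suc (card Q) \<le> hole_count c y (v m)"
  obtains c' where "reach c c'" "robot_only V c' x" "\<And>q. q \<in> insert y Q \<Longrightarrow> c' q = Hole"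
proof -
  have "insert x Q \<subseteq> region y (v m)" "card (insert x Q) \<le> hole_count c y (v m)" using Q n by auto
  then obtain c1 where c1: "reach c c1" "\<And>q. q \<in> insert x Q \<Longrightarrow> c1 q = Hole" "robot_only V c1 y"
    using rearrange_region[OF R] by metis
  let ?H = "insert y (insert x Q)"
  have vQ: "v k \<in> Q" if "m \<le> k" "k \<le> b" for k using Q(3) that by auto
  have xV: "x \<in> V" using x EV by auto
  have "conn ?H y (v k)" if "m \<le> k" "k \<le> b" for k
    using that
  proof (induction k rule: dec_induct)
    case base
    show ?case by (rule conn_edge) (use y vQ m in auto)
  next
    case (step k)
    have "conn ?H (v k) (v (Suc k))" by (rule conn_edge) (use e step vQ in auto)
    then show ?case using step conn_trans by (meson Suc_leD)
  qed
  moreover have "conn ?H (v b) x" by (rule conn_edge) (use x vQ m in auto)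
  ultimately have yx: "conn ?H y x" using m conn_trans by blast
  have "reach c1 (c1(y := Hole, x := Robot))"
    by (rule slide_walk[OF yx]) (use c1(2) robot_onlyD(1)[OF c1(3)] in auto)
  moreover have "robot_only V (c1(y := Hole, x := Robot)) x"
    by (rule robot_only_slide[OF c1(3) xV Q(5)])
  moreover have "(c1(y := Hole, x := Robot)) q = Hole" if "q \<in> insert y Q" for q
    using that c1(2) Q(4,5) by auto
  ultimately show thesis
    using that[of "c1(y := Hole, x := Robot)"] rtranclp_trans[OF c1(1)] by blast
qed

text \<open>A cut vertex ahead of \<open>v m\<close> that coincided with \<open>y\<close> would be
  separated from itself by \<open>front_sep\<close>. Hence removing \<open>y\<close> does not
  interrupt the chain of cut vertices.\<close>

lemma train_region:
  assumes "m < r" "block B" "v m \<in> B" "B \<noteq> S (Suc m)" "y \<in> B" "y \<noteq> v m" "m \<le> k" "k < r"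
  shows "y \<noteq> v k" "v k \<in> region y (v m)"
proof -
  have *: "y \<noteq> v j" if "m \<le> j" "j < r" for j
  proof
    assume "y = v j"
    then have "m < j" using that assms(6) by (cases "m = j") auto
    then have "\<not> conn (V - {v m}) y y"
      using front_sep[OF assms(1-6), of j y] vS[of j] that assms(6) \<open>y = v j\<close> by auto
    then show False using assms block_subset by auto
  qed
  show "y \<noteq> v k" using *[OF assms(7,8)] .
  show "v k \<in> region y (v m)" unfolding region_def using chain[of m k y] assms * by auto
qed

text \<open>\<open>K\<close> has to suffice for the \<open>b - a + 1\<close> cut vertices of every
  corridor and for one vertex beyond it. The induction is on the number of cut vertices
  left.\<close>

lemma station_reach:
  assumes K: "\<And>a b. corr a b \<Longrightarrow> b - a + 2 \<le> K"
  shows "station K m B p c \<Longrightarrow> \<exists>c'. reach c c' \<and> c' t = Robot"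
proof (induction "r - m" arbitrary: m B p c rule: less_induct)
  case less
  note st = less.prems[unfolded station_def]
  have m: "m < r" and B: "block B" "v m \<in> B" "B \<noteq> S (Suc m)" and p: "p \<in> B" "p \<noteq> v m"
    and start: "m = 0 \<or> 3 \<le> card (S m) \<or> branching_at (v m)" and R: "robot_only V c p"
    and n: "min K (Suc (r - m)) \<le> hole_count c p (v m)" using st by auto
  obtain b where b: "m \<le> b" "b < r" "Suc b = r \<or> 3 \<le> card (S (Suc b)) \<or> m < b \<and> branching_at (v b)"
    and thin: "\<And>k. m \<le> k \<Longrightarrow> k < b \<Longrightarrow> card (S (Suc k)) = 2" and "corr m b"
    using next_stop[OF m start] by metis
  then have bK: "b - m + 2 \<le> K" using K by blast
  \<comment> \<open>\<open>n\<close> holes are to lie on the cut vertices from \<open>v m\<close>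
    on, one more on the vertex to which the robot crosses. By \<open>bn\<close> these cut vertices
    include the corridor and do not run past the end of the path.\<close>
  define n where "n = min K (Suc (r - m)) - 1"
  have n1: "Suc n = min K (Suc (r - m))" using bK n_def by auto
  have bn: "Suc b \<le> m + n" "m + n \<le> r" using bK b(1,2) m unfolding n_def by auto
  define Q where "Q = v ` {m..<m + n}"
  have finQ: "finite Q" unfolding Q_def by simp
  have "inj_on v {m..<m + n}" by (rule inj_onI) (use bn v_inj in auto)
  then have cardQ: "card Q = n" unfolding Q_def by (simp add: card_image)
  have QB: "Q \<subseteq> region y (v m)" if "y \<in> B" "y \<noteq> v m" for y
    using train_region(2)[OF m B that] bn unfolding Q_def by auto
  obtain y c1 where y: "y \<in> B" "y \<noteq> v m" "(y, v m) \<in> E" "reach c c1" "robot_only V c1 y"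
      "Suc (card Q) \<le> hole_count c1 y (v m)"
    by (rule block_arrive[OF B(1,2) p R finQ QB]) (use n n1 cardQ in auto)
  have yv: "y \<noteq> v k" if "m \<le> k" "k < r" for k using train_region(1)[OF m B y(1,2) that] .
  have edges: "(v k, v (Suc k)) \<in> E" if "m \<le> k" "k < b" for k
    using thin_edge(2)[of k] thin[OF that] that b(2) by auto
  have vbQ: "v ` {m..b} \<subseteq> Q" unfolding Q_def using bn by auto
  \<comment> \<open>Common to all ways in which the corridor can end. After the crossing,
    \<open>y\<close> and \<open>Q\<close> provide \<open>n + 1\<close> holes on the side of
    \<open>x\<close> that contains all cut vertices from \<open>v m\<close> on; so \<open>x\<close>
    can be used as a station for \<open>v b\<close> as well as for \<open>v (Suc b)\<close>.\<close>
  have advance: "\<exists>c2. reach c c2 \<and> robot_only V c2 x \<and> (\<forall>q\<in>insert y Q. c2 q = Hole) \<and>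
      (\<forall>m'. m \<le> m' \<longrightarrow> m' < r \<longrightarrow> min K (Suc (r - m')) \<le> hole_count c2 x (v m'))"
    if x: "(v b, x) \<in> E" "\<And>k. m \<le> k \<Longrightarrow> k < r \<Longrightarrow> x \<noteq> v k" "x \<noteq> y" for x
  proof -
    have "conn (V - {y}) x (v b)"
      using x yv[of b] b EV by (intro conn_sym[OF conn_edge]) auto
    moreover have "conn (V - {y}) (v b) (v m)" using chain[of m b y] b yv by auto
    ultimately have xr: "x \<in> region y (v m)" unfolding region_def using conn_trans by blast
    have xQ: "x \<notin> Q"
    proof
      assume "x \<in> Q"
      then obtain k where "m \<le> k" "k < m + n" "x = v k" unfolding Q_def by auto
      then show False using x(2)[of k] bn by auto
    qed
    obtain c2 where c2: "reach c1 c2" "robot_only V c2 x" "\<And>q. q \<in> insert y Q \<Longrightarrow> c2 q = Hole"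
      by (rule pass[OF y(5) b(1,2) y(3) edges x(1) QB[OF y(1,2)] finQ vbQ xQ x(3) xr y(6)]) auto
    have yQ: "y \<notin> Q"
    proof
      assume "y \<in> Q"
      then obtain k where "m \<le> k" "k < m + n" "y = v k" unfolding Q_def by auto
      then show False using yv[of k] bn by auto
    qed
    have "min K (Suc (r - m')) \<le> hole_count c2 x (v m')" if m': "m \<le> m'" "m' < r" for m'
    proof -
      have ch: "conn (V - {x}) (v k) (v m)" if "m \<le> k" "k < r" for k
        using chain[of m k x] that x(2) by auto
      have "conn (V - {x}) y (v m)" using y(3) x(2)[of m] x(3) m EV by (intro conn_edge) auto
      then have to_m: "conn (V - {x}) q (v m)" if "q \<in> insert y Q" for q
      proof (cases "q = y")
        case False
        then have "q \<in> Q" using that by simp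
        then obtain k where "m \<le> k" "k < m + n" "q = v k" unfolding Q_def by auto
        then show ?thesis using ch[of k] bn by auto
      qed simp
      have "conn (V - {x}) q (v m')" if "q \<in> insert y Q" for q
        using conn_trans[OF to_m[OF that] conn_sym[OF ch[OF m']]] .
      then have "insert y Q \<subseteq> region x (v m')" unfolding region_def by blast
      then have "card (insert y Q) \<le> hole_count c2 x (v m')"
        using c2(3) finQ by (intro hole_count_ge) auto
      then show ?thesis using cardQ yQ finQ n1 m' by auto
    qed
    moreover have "reach c c2" using y(4) c2(1) by (rule rtranclp_trans)
    ultimately show ?thesis using c2 by blast
  qed
  \<comment> \<open>For a step into the next block: \<open>v m\<close> separates \<open>y\<close>
    from everything ahead, and \<open>v (Suc b)\<close> is the only other cut vertex of the path in
    that block.\<close>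
  have on_path: "x \<noteq> y \<and> (\<forall>k. m \<le> k \<longrightarrow> k < r \<longrightarrow> (Suc b < r \<longrightarrow> x \<noteq> v (Suc b)) \<longrightarrow> x \<noteq> v k)"
    if x: "x \<in> S (Suc b)" "x \<noteq> v b" for x
  proof (intro conjI allI impI notI)
    have "x \<noteq> v m" using v_in_S[of m "Suc b"] x b m by (cases "m = b") auto
    then have "\<not> conn (V - {v m}) y x"
      using front_sep[OF m B y(1,2), of "Suc b" x] x b by auto
    moreover assume "x = y"
    ultimately show False using x b S_sub[of "Suc b"] \<open>x \<noteq> v m\<close> by auto
  next
    fix k assume "m \<le> k" "k < r" "Suc b < r \<longrightarrow> x \<noteq> v (Suc b)" "x = v k"
    then show False using v_in_S[of k "Suc b"] x b by auto
  qed
  consider (last) "Suc b = r" | (wide) "Suc b < r" "3 \<le> card (S (Suc b))"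
    | (branch) "Suc b < r" "m < b" "branching_at (v b)"
    using b(2,3) by force
  then show ?case
  proof cases
    case last
    obtain x where x: "x \<in> S (Suc b)" "x \<noteq> v b" "(v b, x) \<in> E"
      using block_neighbour'[of "S (Suc b)" "v b"] blk[of "Suc b"] vS'[of b] card_S[of "Suc b"] b by auto
    have "x \<noteq> y" "\<And>k. m \<le> k \<Longrightarrow> k < r \<Longrightarrow> x \<noteq> v k" using on_path[OF x(1,2)] last by auto
    then obtain c2 where c2: "reach c c2" "robot_only V c2 x" "\<forall>q\<in>insert y Q. c2 q = Hole"
      using advance[OF x(3)] by blast
    show ?thesis
    proof (cases "x = t")
      case True
      then show ?thesis using c2(1) robot_onlyD(1)[OF c2(2)] by (intro exI[of _ c2]) simp
    next
      case False
      \<comment> \<open>The robot has just left \<open>v b\<close>, so there is a hole; one hole is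
        enough inside the block of \<open>t\<close>.\<close>
      have "v b \<in> region x t"
        unfolding region_def
        using block_conn[OF blk[of r] _ t(1), of "v b" x] vS'[of b] last False x(2) by auto
      moreover have "v b \<in> Q" using vbQ b(1) by (meson atLeastAtMost_iff image_subset_iff order_refl)
      ultimately have "card {v b} \<le> hole_count c2 x t"
        using c2(3) by (intro hole_count_ge) auto
      then have n1: "1 \<le> hole_count c2 x t" by simp
      have "x \<in> S r" using x(1) last by simp
      then obtain c3 where "reach c2 c3" "c3 t = Robot"
        using block_goal[OF blk[OF order_refl] t(1) _ False c2(2) n1] by blast
      then show ?thesis using rtranclp_trans[OF c2(1)] by blast
    qed
  next
    case wide
    \<comment> \<open>The robot parks on a third vertex, from which both cut vertices of the path
      remain accessible to the holes.\<close>
    have "\<not> S (Suc b) \<subseteq> {v b, v (Suc b)}"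
    proof
      assume "S (Suc b) \<subseteq> {v b, v (Suc b)}"
      then have "card (S (Suc b)) \<le> card {v b, v (Suc b)}" by (intro card_mono) auto
      also have "\<dots> \<le> 2" by (simp add: card_insert_if)
      finally show False using wide by simp
    qed
    moreover have "v (Suc b) \<noteq> v b" using v_inj[of "Suc b" b] wide by auto
    ultimately obtain x where x: "x \<in> S (Suc b)" "x \<noteq> v b" "x \<noteq> v (Suc b)" "(v b, x) \<in> E"
      using block_neighbour[of "S (Suc b)" "v b" "v (Suc b)"] blk[of "Suc b"] vS'[of b] b wide by auto
    have "x \<noteq> y" "\<And>k. m \<le> k \<Longrightarrow> k < r \<Longrightarrow> x \<noteq> v k" using on_path[OF x(1,2)] x(3) by auto
    then obtain c2 where c2: "reach c c2" "robot_only V c2 x"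
        "\<forall>m'. m \<le> m' \<longrightarrow> m' < r \<longrightarrow> min K (Suc (r - m')) \<le> hole_count c2 x (v m')"
      using advance[OF x(4)] by blast
    have st: "station K (Suc b) (S (Suc b)) x c2"
      unfolding station_def
      using c2 wide x blk[of "Suc b"] vS[of "Suc b"] S_inj[of "Suc b" "Suc (Suc b)"] b(1) by auto
    have lt: "r - Suc b < r - m" using wide b(1) by linarith
    obtain c3 where "reach c2 c3" "c3 t = Robot" using less.hyps[OF lt st] by blast
    then show ?thesis using rtranclp_trans[OF c2(1)] by blast
  next
    case branch
    obtain B' where B': "block B'" "v b \<in> B'" "\<And>i. i \<le> r \<Longrightarrow> B' \<noteq> S i"
      using branch(3) branching_at_def by blast
    have "2 \<le> card V" using card_S[of 0] card_mono[OF fin S_sub[of 0]] by simp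
    then obtain x where x: "x \<in> B'" "x \<noteq> v b" "(v b, x) \<in> E"
      using block_neighbour'[OF B'(1,2)] block_card[OF B'(1)] by blast
    obtain b' where b': "b = Suc b'" using branch(2) by (cases b) auto
    have prev: "v b' \<in> S b" "v b' \<noteq> v b" using vS'[of b'] v_inj[of b' b] b(2) b' by auto
    have xsep: "\<not> conn (V - {v b}) x (v b')"
      using block_sep[of B' "S b" "v b" x "v b'"] B' x prev blk[of b] vS[of b] b(2) by auto
    have xv: "x \<noteq> v k" if k: "m \<le> k" "k < r" for k
    proof
      assume xk: "x = v k"
      have "k \<noteq> b" using x(2) xk by auto
      then consider "b < k" | "k < b" by linarith
      then show False
      proof cases
        case 1
        then show False
          using front_sep[of b B' x k x] B' x k xk b(2) vS[of k] vV[of k] by auto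
      next
        case 2
        then have "conn (V - {v b}) x (v b')"
          using behind_conn[of k b x "v b'"] vS[of k] xk x(2) prev k b(2) by auto
        then show False using xsep by blast
      qed
    qed
    \<comment> \<open>\<open>v b\<close> separates the branch from what precedes it on the path, and
      \<open>y\<close>, being adjacent to \<open>v m\<close>, belongs to the latter.\<close>
    have "x \<noteq> y"
    proof
      assume "x = y"
      have vmb: "v m \<noteq> v b" using v_inj[of m b] branch(2) b(2) m by auto
      then have "conn (V - {v b}) y (v m)"
        using y(3) yv[OF b(1,2)] EV by (intro conn_edge) auto
      moreover have "conn (V - {v b}) (v m) (v b')"
        using behind_conn[of m b "v m" "v b'"] vS[of m] m vmb prev b by auto
      ultimately show False using xsep \<open>x = y\<close> conn_trans by blast
    qed
    then obtain c2 where c2: "reach c c2" "robot_only V c2 x"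
        "\<forall>m'. m \<le> m' \<longrightarrow> m' < r \<longrightarrow> min K (Suc (r - m')) \<le> hole_count c2 x (v m')"
      using advance[OF x(3) xv] by blast
    \<comment> \<open>The station is one for \<open>v b\<close>, which the robot has to cross again
      on leaving the branch. There is progress because \<open>m < b\<close>.\<close>
    have st: "station K b B' x c2"
      unfolding station_def using c2 b B' x branch by auto
    have lt: "r - b < r - m" using branch m by linarith
    obtain c3 where "reach c2 c3" "c3 t = Robot" using less.hyps[OF lt st] by blast
    then show ?thesis using rtranclp_trans[OF c2(1)] by blast
  qed
qed

end

section \<open>Lower bound on the number of holes\<close>

context block_path
begin

text \<open>Count the holes ahead of the robot. While it stands on \<open>v m\<close>, they are cut
  off from the others, and each step forward uses up one of them. With at most
  \<open>b - a + 1\<close> holes in all, none is left ahead when the robot stands on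
  \<open>v b\<close>.\<close>

lemma corridor_holes:
  assumes ab: "corr a b" and s: "s \<in> S 0" "s \<noteq> v 0" and R0: "robot_only V c0 s"
    and mv: "reach c0 c1" and R1: "robot_only V c1 t"
  shows "b - a + 2 \<le> card {x \<in> V. c0 x = Hole}"
proof (rule ccontr)
  define N where "N = card {x \<in> V. c0 x = Hole}"
  assume "\<not> ?thesis"
  then have N: "N \<le> b - a + 1" unfolding N_def by simp
  have ab': "a \<le> b" "b < r" using ab unfolding corr_def by auto
  have thin: "card (S k) = 2" if "a < k" "k \<le> b" for k using ab that unfolding corr_def by auto
  have nobr: "\<not> branching_at (v k)" if "a < k" "k < b" for k using ab that unfolding corr_def by auto
  define R where "R = region (v a) t"
  have RV: "R \<subseteq> V - {v a}" unfolding R_def by (rule region_subset)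
  have finR: "finite R" unfolding R_def by (rule finite_region)
  have tR: "t \<in> R"
    unfolding R_def region_def using t_ne_v[of a] t S_sub[of r] ab' by auto
  have vR: "v m \<in> R" if "a < m" "m \<le> b" for m
    unfolding R_def region_def
    using ahead_conn[of a m "v m" r t] that ab' vS[of m] v_inj[of m a] t t_ne_v[of a] by auto
  have edge_R: "y = v a \<or> y \<in> R" if "(x, y) \<in> E" "x \<in> R" for x y
  proof (rule disjCI)
    assume "y \<notin> R"
    show "y = v a"
    proof (rule ccontr)
      assume "y \<noteq> v a"
      then have "conn (V - {v a}) y x" using that RV EV by (intro conn_sym[OF conn_edge]) auto
      then have "y \<in> R" using that(2) conn_trans unfolding R_def region_def by blast
      then show False using \<open>y \<notin> R\<close> by blast
    qed
  qed
  have first: "y = v (Suc a)" if edge: "(v a, y) \<in> E" and that: "y \<in> R" "a < b" for y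
  proof -
    have ya: "y \<noteq> v a" using that(1) RV by auto
    obtain C where C: "block C" "v a \<in> C" "y \<in> C" using block_edge[OF edge] by blast
    have "C = S (Suc a)"
    proof (rule ccontr)
      assume "C \<noteq> S (Suc a)"
      then have "\<not> conn (V - {v a}) y t"
        using front_sep[of a C y r t] C ya ab' t t_ne_v[of a] by auto
      then show False using that(1) unfolding R_def region_def by auto
    qed
    then show ?thesis using thin_edge(1)[of a] thin[of "Suc a"] that ab' C ya by auto
  qed
  have inner: "y \<in> {v (m - 1), v m, v (Suc m)}" if edge: "(v m, y) \<in> E" and that: "a < m" "m < b" for m y
  proof -
    obtain C where C: "block C" "v m \<in> C" "y \<in> C" using block_edge[OF edge] by blast
    have "\<exists>i\<le>r. C = S i" using nobr[OF that] C unfolding branching_at_def by blast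
    then obtain i where i: "i \<le> r" "C = S i" by blast
    then have "i = m \<or> i = Suc m" using v_in_S C(2) that ab' by auto
    moreover have "S m = {v (m - 1), v m}"
      using thin_edge(1)[of "m - 1"] thin[of m] that ab' by auto
    moreover have "S (Suc m) = {v m, v (Suc m)}"
      using thin_edge(1)[of m] thin[of "Suc m"] that ab' by auto
    ultimately show ?thesis using i C(3) by auto
  qed
  \<comment> \<open>What lies ahead of a robot on \<open>v m\<close>; for \<open>m = a\<close> this
    is all of \<open>R\<close>.\<close>
  define F where "F m = R - v ` {Suc a..m}" for m
  have finF: "finite (F m)" for m unfolding F_def using finR by simp
  have vF: "v k \<notin> F m" if "a \<le> k" "k \<le> m" for k m
    unfolding F_def using that RV by (cases "k = a") auto
  have step_back: "Suc k = m" if "(v k, v m) \<in> E" "a \<le> k" "k < m" "m \<le> b" for k m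
  proof (cases "k = a")
    case True
    then have "v m = v (Suc a)" using first vR that by auto
    then show ?thesis using v_inj[of m "Suc a"] True that ab' by auto
  next
    case False
    then have "v m \<in> {v (k - 1), v k, v (Suc k)}" using inner[of k "v m"] that by auto
    moreover have "k - 1 < r" "k < r" "Suc k < r" "m < r" using that ab' by auto
    moreover have "m \<noteq> k - 1" "m \<noteq> k" using that by auto
    ultimately show ?thesis using v_inj[of m "k - 1"] v_inj[of m k] v_inj[of m "Suc k"] by auto
  qed
  \<comment> \<open>\<open>F m\<close> can be left only through \<open>v m\<close>. So a robot
    standing there keeps holes from crossing between \<open>F m\<close> and the rest.\<close>
  have closed: "w \<in> F m" if "x \<in> F m" "(x, w) \<in> E" "w \<noteq> v m" "a \<le> m" "m \<le> b" for x w m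
  proof (rule ccontr)
    assume w: "w \<notin> F m"
    have xR: "x \<in> R" using that(1) F_def by auto
    have wx: "(w, x) \<in> E" using that(2) symE by (meson symD)
    have "\<exists>k. a \<le> k \<and> k < m \<and> w = v k"
    proof (cases "w = v a")
      case True
      then show ?thesis using that by (intro exI[of _ a]) (cases "a = m", auto)
    next
      case False
      then have "w \<in> R" using edge_R[OF that(2) xR] by auto
      then obtain k where "Suc a \<le> k" "k \<le> m" "w = v k" using w unfolding F_def by auto
      then show ?thesis using that(3) by (intro exI[of _ k]) (cases "k = m", auto)
    qed
    then obtain k where k: "a \<le> k" "k < m" "w = v k" by blast
    show False
    proof (cases "k = a")
      case True
      then have "x = v (Suc a)" using first wx k xR that by auto
      then show False using vF[of "Suc a" m] that(1) k True by auto
    next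
      case False
      then have "x \<in> {v (k - 1), v k, v (Suc k)}" using inner[of k x] wx k that by auto
      moreover have "a \<le> k - 1" "k - 1 \<le> m" using k False by auto
      ultimately show False using vF[of "k - 1" m] vF[of k m] vF[of "Suc k" m] that(1) k by auto
    qed
  qed
  define h where "h m c = card {x \<in> F m. c x = Hole}" for m and c :: "'a config"
  \<comment> \<open>Behind the robot at \<open>v m\<close> there are at least as many holes as it has made steps from
    outside the corridor.\<close>
  define inv where "inv c \<longleftrightarrow> (\<exists>p. robot_only V c p \<and>
    (p \<notin> insert (v a) R \<or> (\<exists>m. a \<le> m \<and> m \<le> b \<and> p = v m \<and> h m c + (m - a + 1) \<le> N)))" for c
  have "inv c0"
  proof -
    have "s \<noteq> v a"
      using v_in_S[of a 0] s ab' by auto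
    moreover have "s \<notin> R"
      using ahead_sep_behind[of 0 a r s t] s \<open>s \<noteq> v a\<close> ab' t t_ne_v[of a] unfolding R_def region_def by auto
    ultimately show ?thesis unfolding inv_def using R0 by blast
  qed
  moreover have "inv c'" if inv: "inv c" and step: "go E UNIV c c'" and cN: "card {x \<in> V. c x = Hole} = N" for c c'
  proof -
    obtain p where p: "robot_only V c p"
      "p \<notin> insert (v a) R \<or> (\<exists>m. a \<le> m \<and> m \<le> b \<and> p = v m \<and> h m c + (m - a + 1) \<le> N)"
      using inv unfolding inv_def by blast
    from go_robot[OF step EV p(1)] show ?thesis
    proof cases
      case 1
      obtain x w where xw: "(x, w) \<in> E" "c x \<noteq> Hole" "c w = Hole" "c' = c(x := Hole, w := c x)"
        using step unfolding go_def by blast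
      have "c p = Robot" "c' p = Robot" using robot_onlyD(1)[OF p(1)] robot_onlyD(1)[OF 1] by auto
      then have xp: "x \<noteq> p" and wp: "w \<noteq> p" using xw by (auto split: if_splits)
      have "h m c' = h m c" if m: "a \<le> m" "m \<le> b" "p = v m" for m
      proof -
        have wx: "(w, x) \<in> E" using xw(1) symE by (meson symD)
        have iff: "x \<in> F m \<longleftrightarrow> w \<in> F m"
          using closed[of x m w] closed[of w m x] xw(1) wx xp wp m by auto
        have c': "c' = c \<circ> Transposition.transpose x w" using xw upd_transpose by metis
        have "{y \<in> F m. c' y = Hole} = Transposition.transpose x w ` {y \<in> F m. c y = Hole}"
        proof -
          have "Transposition.transpose x w y \<in> F m \<longleftrightarrow> y \<in> F m" for y
            using iff by (auto simp: Transposition.transpose_def)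
          then show ?thesis unfolding c'
            by (auto simp: image_iff) (metis transpose_involutory)
        qed
        then show ?thesis unfolding h_def by (simp only: card_image inj_on_transpose)
      qed
      then show ?thesis unfolding inv_def using p 1 by (metis (no_types, lifting))
    next
      case (2 w)
      have cp: "c p = Robot" using robot_onlyD(1)[OF p(1)] .
      have wp: "w \<noteq> p" using cp 2(3) by auto
      show ?thesis
      proof (cases "p \<in> insert (v a) R")
        case False
        then have wR: "w \<notin> R" using edge_R[of w p] 2(1) symE by (auto dest: symD)
        show ?thesis
        proof (cases "w = v a")
          case True
          \<comment> \<open>The hole on \<open>v a\<close> that the robot takes lies outside
            \<open>R\<close>; it accounts for the summand 1 of the invariant.\<close>
          have "{x \<in> R. c' x = Hole} = {x \<in> R. c x = Hole}" using 2(4) wR False by auto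
          then have "h a c' = card {x \<in> R. c x = Hole}" unfolding h_def F_def by simp
          also have "\<dots> < card (insert w {x \<in> R. c x = Hole})" using wR finR by simp
          also have "\<dots> \<le> N" unfolding cN[symmetric]
            by (rule card_mono) (use fin RV 2(1,3) EV in auto)
          finally have "h a c' + (a - a + 1) \<le> N" by simp
          then show ?thesis unfolding inv_def using 2(5) True ab' by blast
        next
          case False
          then show ?thesis unfolding inv_def using 2(5) wR by blast
        qed
      next
        case True
        then obtain m where m: "a \<le> m" "m \<le> b" "p = v m" "h m c + (m - a + 1) \<le> N" using p(2) by blast
        have pF: "p \<notin> F m" using vF m by auto
        consider (forward) "w \<in> F m" | (backward) k where "a \<le> k" "k < m" "w = v k" | (out) "w \<notin> insert (v a) R"
        proof -
          have "\<exists>k. a \<le> k \<and> k < m \<and> w = v k" if wF: "w \<notin> F m" "w \<in> insert (v a) R"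
          proof (cases "w = v a")
            case True
            then show ?thesis using wp m by (intro exI[of _ a]) (cases "a = m", auto)
          next
            case False
            then obtain k where "Suc a \<le> k" "k \<le> m" "w = v k" using wF unfolding F_def by auto
            then show ?thesis using wp m by (intro exI[of _ k]) (cases "k = m", auto)
          qed
          then show thesis using forward backward out by blast
        qed
        then show ?thesis
        proof cases
          case forward
          have "w \<in> {x \<in> F m. c x = Hole}" using forward 2(3) by simp
          then have rem: "Suc (card ({x \<in> F m. c x = Hole} - {w})) = h m c"
            unfolding h_def using finF by (intro card.remove[symmetric]) auto
          \<comment> \<open>For \<open>m = b\<close> the invariant and the assumed bound on
            \<open>N\<close> leave no hole in \<open>F b\<close>, but \<open>w\<close> is
            one.\<close>
          have mb: "m < b"
          proof (rule ccontr)
            assume "\<not> m < b"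
            then have "m = b" using m(2) by simp
            then show False using rem m(4) N by linarith
          qed
          have wm: "w = v (Suc m)"
          proof (cases "m = a")
            case True
            then show ?thesis using first 2(1) m mb forward unfolding F_def by auto
          next
            case False
            then have "w \<in> {v (m - 1), v m, v (Suc m)}" using inner[of m w] 2(1) m mb by auto
            moreover have "a \<le> m - 1" "m - 1 \<le> m" using m(1) False by auto
            ultimately show ?thesis using vF[of "m - 1" m] vF[of m m] forward m(1) by auto
          qed
          \<comment> \<open>The step consumes the hole \<open>w\<close> ahead, which balances the
            increase of \<open>m\<close>.\<close>
          have "{x \<in> F (Suc m). c' x = Hole} = {x \<in> F m. c x = Hole} - {w}"
          proof -
            have "F (Suc m) = F m - {w}"
              unfolding F_def wm using m(1) by (auto simp: atLeastAtMostSuc_conv)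
            then show ?thesis using 2(4) pF by auto
          qed
          then have "h (Suc m) c' + (Suc m - a + 1) \<le> N"
            using rem m(1,4) unfolding h_def by simp
          then show ?thesis unfolding inv_def using 2(5) wm mb m(1)
            by (intro exI[of _ w] conjI disjI2 exI[of _ "Suc m"]) auto
        next
          case (backward k)
          have "(v k, v m) \<in> E" using 2(1) backward m(3) symE by (auto dest: symD)
          then have km: "m = Suc k" using step_back[of k m] backward m by auto
          have "p \<notin> v ` {Suc a..k}"
          proof
            assume "p \<in> v ` {Suc a..k}"
            then obtain j where "j \<le> k" "v m = v j" using m(3) by auto
            then show False using v_inj[of m j] km m(2) ab' by auto
          qed
          moreover have "p \<in> R" using vR[of m] m backward(1) km by auto
          \<comment> \<open>Conversely, on a step back the vertex left by the robot becomes an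
            additional hole ahead.\<close>
          ultimately have "F k = insert p (F m)"
            unfolding F_def using m(3) km backward(1) by (auto simp: atLeastAtMostSuc_conv)
          moreover have "w \<notin> F m" "w \<noteq> p" using vF[of k m] backward wp by auto
          ultimately have "{x \<in> F k. c' x = Hole} = insert p {x \<in> F m. c x = Hole}"
            using 2(4) by auto
          then have "h k c' = Suc (h m c)" unfolding h_def using pF finF by simp
          then have "h k c' + (k - a + 1) \<le> N" using m(1,4) km backward(1) by simp
          then show ?thesis unfolding inv_def using 2(5) backward m(2)
            by (intro exI[of _ w] conjI disjI2 exI[of _ k]) auto
        next
          case out
          then show ?thesis unfolding inv_def using 2(5) by blast
        qed
      qed
    qed
  qed
  ultimately have "inv c1 \<and> card {x \<in> V. c1 x = Hole} = N" using mv
  proof (induction rule: rtranclp_induct[OF mv])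
    case 1
    then show ?case using N_def by blast
  next
    case (2 y z)
    then show ?case using go_cells[OF 2(2) EV] by metis
  qed
  then obtain p where p: "robot_only V c1 p"
      "p \<notin> insert (v a) R \<or> (\<exists>m. a \<le> m \<and> m \<le> b \<and> p = v m \<and> h m c1 + (m - a + 1) \<le> N)"
    unfolding inv_def by blast
  have "p = t" using p(1) R1 unfolding robot_only_def by auto
  then obtain m where "m \<le> b" "t = v m" using p(2) tR by auto
  then show False using t_ne_v[of m] ab' by auto
qed

end

section \<open>Blocks and the strongly biconnected components\<close>

context ugraph
begin

text \<open>\<open>C\<close> meets \<open>B\<close> in at most one vertex, and that vertex does not
  disconnect \<open>B\<close>. This serves the sides of a vertex that is not a cut vertex, where a
  whole block is deleted.\<close>

lemma block_avoid:
  assumes "block B" "block C" "B \<noteq> C" "x \<in> B" "y \<in> B" "x \<notin> C" "y \<notin> C"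
  shows "conn (V - C) x y"
proof -
  obtain z where z: "B \<inter> C \<subseteq> {z}" "z \<noteq> x" "z \<noteq> y"
  proof (cases "B \<inter> C = {}")
    case True
    obtain z where "z \<in> C" using assms(2) block_def by auto
    then show thesis using that[of z] True assms by auto
  next
    case False
    then obtain z where "z \<in> B" "z \<in> C" by blast
    then show thesis using that[of z] block_inter[OF assms(1-3)] assms by auto
  qed
  have "conn (B - {z}) x y" using block_conn_inside[OF assms(1,4,5)] z by blast
  then show ?thesis by (rule conn_mono) (use z(1) block_subset[OF assms(1)] in blast)
qed

definition cut_vertices :: "'a set" where
  "cut_vertices = {w. \<exists>B B'. block B \<and> block B' \<and> B \<noteq> B' \<and> w \<in> B \<and> w \<in> B'}"

lemma exit_cut:
  assumes "block B" "a \<in> B" "p \<notin> B" "(a, p) \<in> E"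
  shows "a \<in> cut_vertices"
  using block_edge[OF assms(4)] assms unfolding cut_vertices_def by blast

text \<open>A walk can leave its block only at a cut vertex, so nothing hangs on the block at
  \<open>v\<close>. With the robot on \<open>v\<close>, the walk obtained here avoids it.\<close>

lemma not_cut_attach:
  assumes "block B" "v \<in> B" "v \<notin> cut_vertices" "R \<subseteq> E" "h \<in> V - {v}"
    "\<And>u w. u \<in> V \<Longrightarrow> w \<in> V \<Longrightarrow> (u, w) \<in> rtrancl_on V R"
  obtains a where "a \<in> B" "a \<noteq> v" "(a, h) \<in> rtrancl_on (insert a (V - B)) R"
proof -
  obtain a where a: "a \<in> B" "(a, h) \<in> rtrancl_on (insert a (V - B)) R"
    using block_attach[of B R h] assms by blast
  have "a \<noteq> v"
  proof
    assume "a = v"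
    then have "h \<noteq> a" using assms(5) by auto
    then obtain p where p: "(a, p) \<in> R" "(p, h) \<in> rtrancl_on (V - B - {a}) R"
      using rtrancl_on_last_exit[OF a(2)] by blast
    then have "p \<notin> B" using in_rtrancl_on_in_F by fastforce
    then have "a \<in> cut_vertices" using exit_cut assms p a by blast
    then show False using \<open>a = v\<close> assms by blast
  qed
  then show thesis using a that by blast
qed

text \<open>Both vertices hang on the block of \<open>v\<close> at vertices other than
  \<open>v\<close>, and these are joined without \<open>v\<close>.\<close>

lemma not_cut_conn:
  assumes "v \<notin> cut_vertices" "u \<in> V - {v}" "w \<in> V - {v}" "v \<in> V"
  shows "conn (V - {v}) u w"
proof -
  obtain B where B: "block B" "v \<in> B" using block_at assms by blast
  have hang: "\<exists>a\<in>B. a \<noteq> v \<and> conn (V - {v}) a h" if h: "h \<in> V - {v}" for h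
  proof -
    obtain a where "a \<in> B" "a \<noteq> v" "conn (insert a (V - B)) a h"
      by (rule not_cut_attach[OF B assms(1) subset_refl h con])
    moreover have "insert a (V - B) \<subseteq> V - {v}" using calculation B block_subset by auto
    ultimately show ?thesis using conn_mono by blast
  qed
  obtain a where a: "a \<in> B" "a \<noteq> v" "conn (V - {v}) a u" using hang assms by blast
  obtain b where b: "b \<in> B" "b \<noteq> v" "conn (V - {v}) b w" using hang assms by blast
  have "conn (V - {v}) a b" using block_conn[OF B(1) a(1) b(1)] a b by auto
  then show ?thesis using conn_trans[OF conn_sym[OF a(3)] conn_trans[OF _ b(3)]] by blast
qed

lemma not_cut_block_unique:
  assumes "v \<notin> cut_vertices" "block B" "block B'" "v \<in> B" "v \<in> B'"
  shows "B = B'"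
  using assms unfolding cut_vertices_def by blast

lemma not_cut_region:
  assumes "v \<notin> cut_vertices" "v \<in> V" "g \<in> V" "g \<noteq> v"
  shows "region v g = V - {v}"
  using assms not_cut_conn region_subset unfolding region_def by blast

text \<open>Regarding a block as a graph of its own makes \<open>block_goal\<close> applicable to moves inside it.\<close>

lemma block_ugraph:
  assumes B: "block B"
  shows "ugraph B (E \<inter> B \<times> B)" "ugraph.block B (E \<inter> B \<times> B) B"
proof -
  have eq: "rtrancl_on F (E \<inter> B \<times> B) = rtrancl_on F E" if "F \<subseteq> B" for F
    by (rule rtrancl_on_cong) (use that in auto)
  interpret s: ugraph B "E \<inter> B \<times> B"
  proof
    show "finite B" using block_subset[OF B] fin finite_subset by blast
    show "sym (E \<inter> B \<times> B)" using symE by (auto simp: sym_def)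
    fix u w assume uw: "u \<in> B" "w \<in> B"
    then have "conn (V - {}) u w" using con block_subset[OF B] by auto
    then have "conn (B - {}) u w" by (rule block_reach[OF B uw subset_refl])
    then show "(u, w) \<in> rtrancl_on B (E \<inter> B \<times> B)" using eq by simp
  qed auto
  show "ugraph B (E \<inter> B \<times> B)" by unfold_locales
  have "s.insep x y" if "x \<in> B" "y \<in> B" for x y
    unfolding s.insep_def using that block_conn_inside[OF B that] eq[of "B - {_}"] by auto
  then have "s.clump B" unfolding s.clump_def by blast
  moreover have "B \<noteq> {}" using B block_def by blast
  ultimately show "s.block B" unfolding s.block_def using s.clump_subset by blast
qed

lemma block_inside_goal:
  assumes B: "block B" and R: "robot_only B c p" and v: "v \<in> B" and h: "h \<in> B" "c h = Hole"
  shows "\<exists>c'. (go (E \<inter> B \<times> B) UNIV)\<^sup>*\<^sup>* c c' \<and> c' v = Robot"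
proof (cases "p = v")
  case True
  then show ?thesis using robot_onlyD(1)[OF R] by blast
next
  case False
  interpret s: ugraph B "E \<inter> B \<times> B" by (rule block_ugraph[OF B])
  have sB: "s.block B" by (rule block_ugraph[OF B])
  have p: "p \<in> B" using robot_onlyD(2)[OF R] .
  have "h \<noteq> p" using h robot_onlyD(1)[OF R] by auto
  then have "h \<in> s.region p v"
    unfolding s.region_def using s.block_conn[OF sB h(1) v, of p] False by auto
  then have "card {h} \<le> s.hole_count c p v"
    using h by (intro s.hole_count_ge) auto
  then show ?thesis using s.block_goal[OF sB v p False R] by simp
qed

end

text \<open>The robot is just one of the objects, so any obstacle can take its role.\<close>

definition relabels :: "'a config \<Rightarrow> 'a config \<Rightarrow> bool" where
  "relabels c d \<longleftrightarrow> (\<forall>x. (c x = Hole \<longleftrightarrow> d x = Hole) \<and> (d x = Robot \<longrightarrow> c x = Obstacle))"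

text \<open>As long as the robot is not restricted, whether a move is possible depends only on which
  vertices are holes. So the moves can be copied one by one.\<close>

lemma go_relabel:
  assumes "(go A UNIV)\<^sup>*\<^sup>* d d'" "relabels c d"
  shows "\<exists>c'. (go A UNIV)\<^sup>*\<^sup>* c c' \<and> relabels c' d'"
  using assms(1)
proof induction
  case base
  then show ?case using assms by blast
next
  case (step y z)
  then obtain c1 where c1: "(go A UNIV)\<^sup>*\<^sup>* c c1" "relabels c1 y" by blast
  obtain v w where vw: "(v, w) \<in> A" "y v \<noteq> Hole" "y w = Hole" "z = y(v := Hole, w := y v)"
    using step(2) unfolding go_def by blast
  let ?d = "c1(v := Hole, w := c1 v)"
  have "c1 v \<noteq> Hole" "c1 w = Hole" using c1(2) vw unfolding relabels_def by auto
  then have "go A UNIV c1 ?d" unfolding go_def using vw(1) by blast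
  moreover have "relabels ?d z" using c1(2) vw unfolding relabels_def by auto
  ultimately show ?case using rtranclp.rtrancl_into_rtrancl[OF c1(1)] by blast
qed

context ugraph
begin

lemma block_inside_obstacle:
  assumes B: "block B" and p: "p \<in> B" "c p = Obstacle" and v: "v \<in> B" and h: "h \<in> B" "c h = Hole"
  shows "\<exists>c'. (go (E \<inter> B \<times> B) UNIV)\<^sup>*\<^sup>* c c' \<and> c' v = Obstacle"
proof -
  \<comment> \<open>The obstacle at \<open>p\<close> plays the robot, and a real robot counts as an
    obstacle; it may therefore be displaced inside the block.\<close>
  let ?d = "\<lambda>x. if x = p then Robot else if c x = Hole then Hole else Obstacle"
  have "robot_only B ?d p" unfolding robot_only_def using p by auto
  have "?d h = Hole" using h p by auto
  with \<open>robot_only B ?d p\<close> obtain d' where d': "(go (E \<inter> B \<times> B) UNIV)\<^sup>*\<^sup>* ?d d'" "d' v = Robot"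
    using block_inside_goal[OF B _ v h(1), of ?d p] by blast
  have "relabels c ?d" unfolding relabels_def using p by auto
  then show ?thesis using go_relabel[OF d'(1)] d'(2) unfolding relabels_def by blast
qed

end

section \<open>The blocks of a strongly connected digraph and the notions of the statement\<close>

locale sc_digraph =
  fixes P :: "'a pair_pre_digraph"
  assumes pd: "pair_digraph P" and sc: "strongly_connected (with_proj P)"
begin

lemma wfP: "pair_wf_digraph P"
  using pd unfolding pair_digraph_def pair_fin_digraph_def by blast

lemma wfD: "wf_digraph (with_proj P)"
  using wfP by (simp add: wf_digraph_wp_iff)

abbreviation "D \<equiv> with_proj P"
abbreviation "V \<equiv> pverts P"
abbreviation "A \<equiv> parcs P"
abbreviation "E \<equiv> parcs P \<union> (parcs P)\<inverse>"

lemma AV: "A \<subseteq> V \<times> V"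
  using pair_wf_digraph.arc_fst_in_verts[OF wfP] pair_wf_digraph.arc_snd_in_verts[OF wfP] by force

lemma strong: "u \<in> V \<Longrightarrow> w \<in> V \<Longrightarrow> (u, w) \<in> rtrancl_on V A"
  using sc unfolding strongly_connected_def reachable_def by simp

sublocale ugraph V E
proof
  show "finite V" using pd by (simp add: pair_digraph_def pair_fin_digraph.pair_finite_verts)
  show "sym E" by (auto simp: sym_def)
  show "E \<subseteq> V \<times> V" using AV by auto
  show "(u, w) \<in> rtrancl_on V E" if "u \<in> V" "w \<in> V" for u w
    using strong[OF that] rtrancl_on_mono[of A E V V] by blast
qed

lemma parcs_underlying [simp]: "parcs (mk_symmetric D) = E"
  by (auto simp: parcs_mk_symmetric)

lemma wf_underlying: "wf_digraph (underlying D)"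
  using wf_digraph.wellformed_mk_symmetric[OF wfD] by (simp only: wf_digraph_wp_iff)

lemma biconnected_clump:
  assumes H: "subgraph H (underlying D)" and bi: "biconnected H"
  shows "clump (verts H)" "verts H \<noteq> {}"
proof -
  have HE: "arcs_ends H \<subseteq> E" using arcs_ends_mono[OF H] by simp
  then have HE': "symcl (arcs_ends H) \<subseteq> E" unfolding symcl_def by auto
  have cn: "connected H" "\<nexists>x. cut_vertex H x" using bi unfolding biconnected_def by auto
  show "verts H \<noteq> {}" using cn(1) connected_conv by blast
  show "clump (verts H)"
  proof (rule clump_of_biconnected[OF _ subset_refl])
    show "verts H \<subseteq> V" using subgraph_imp_subverts[OF H] by simp
    show "conn (verts H) x y" if "x \<in> verts H" "y \<in> verts H" for x y
      using cn(1)[unfolded connected_conv] that rtrancl_on_mono[OF HE' subset_refl] by blast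
    show "conn (verts H - {z}) x y" if "z \<in> verts H" "x \<in> verts H" "y \<in> verts H" "x \<noteq> z" "y \<noteq> z" for x y z
    proof -
      have "connected (pre_digraph.del_vert H z)"
        using cn(2) that unfolding cut_vertex_def by blast
      then have path: "(x, y) \<in> rtrancl_on (verts H - {z}) (symcl (arcs_ends (pre_digraph.del_vert H z)))"
        using that by (auto simp: connected_conv pre_digraph.del_vert_def)
      have "arcs_ends (pre_digraph.del_vert H z) \<subseteq> arcs_ends H"
        by (auto simp: arcs_ends_conv pre_digraph.del_vert_def)
      then have "symcl (arcs_ends (pre_digraph.del_vert H z)) \<subseteq> E"
        using HE unfolding symcl_def by auto
      from rtrancl_on_mono[OF this subset_refl path] show ?thesis .
    qed
  qed
qed

lemma arcs_ends_restrict: "arcs_ends (underlying D \<restriction> S) = E \<inter> S \<times> S"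
  by (auto simp: arcs_ends_conv parcs_underlying)

lemma block_biconnected:
  assumes B: "block B"
  shows "biconnected (underlying D \<restriction> B)"
  unfolding biconnected_def
proof (intro conjI notI)
  have sub: "R \<subseteq> symcl R" for R :: "('a \<times> 'a) set" unfolding symcl_def by auto
  have eq: "rtrancl_on F (E \<inter> F' \<times> F') = rtrancl_on F E" if "F \<subseteq> F'" for F F'
    by (rule rtrancl_on_cong) (use that in auto)
  show "symmetric (underlying D \<restriction> B)"
    unfolding symmetric_def arcs_ends_restrict using symE by (auto simp: sym_def)
  show "connected (underlying D \<restriction> B)"
    unfolding connected_conv arcs_ends_restrict
  proof (intro conjI ballI)
    show "verts (underlying D \<restriction> B) \<noteq> {}" using B block_def by auto
    fix u w assume "u \<in> verts (underlying D \<restriction> B)" "w \<in> verts (underlying D \<restriction> B)"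
    then have "u \<in> B" "w \<in> B" by auto
    then have "(u, w) \<in> rtrancl_on B (E \<inter> B \<times> B)" using ugraph.con[OF block_ugraph(1)[OF B]] by blast
    then show "(u, w) \<in> rtrancl_on (verts (underlying D \<restriction> B)) (symcl (E \<inter> B \<times> B))"
      using rtrancl_on_mono[OF sub subset_refl] by fastforce
  qed
  assume "\<exists>x. cut_vertex (underlying D \<restriction> B) x"
  then obtain x where x: "x \<in> B" "B \<noteq> {x}" "\<not> connected (pre_digraph.del_vert (underlying D \<restriction> B) x)"
    unfolding cut_vertex_def by auto
  have "arcs_ends (pre_digraph.del_vert (underlying D \<restriction> B) x) = E \<inter> (B - {x}) \<times> (B - {x})"
    by (auto simp: arcs_ends_conv pre_digraph.del_vert_def parcs_underlying)
  moreover have "(u, w) \<in> rtrancl_on (B - {x}) (symcl (E \<inter> (B - {x}) \<times> (B - {x})))"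
    if "u \<in> B - {x}" "w \<in> B - {x}" for u w
  proof -
    have "conn (B - {x}) u w" using block_conn_inside[OF B] that by auto
    then show ?thesis using eq[OF subset_refl, of "B - {x}"] rtrancl_on_mono[OF sub subset_refl] by blast
  qed
  ultimately have "connected (pre_digraph.del_vert (underlying D \<restriction> B) x)"
    using x(1,2) unfolding connected_conv by (auto simp: pre_digraph.del_vert_def)
  then show False using x(3) by blast
qed

lemma underlying_restrict: "S \<subseteq> V \<Longrightarrow> underlying (D \<restriction> S) = underlying D \<restriction> S"
  by (intro pre_digraph.equality) (auto simp: parcs_mk_symmetric with_proj_def induce_subgraph_def)

lemma block_strongly_biconnected:
  assumes B: "block B"
  shows "strongly_biconnected (D \<restriction> B)"
  unfolding strongly_biconnected_def
proof
  show "biconnected (underlying (D \<restriction> B))"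
    using block_biconnected[OF B] underlying_restrict[OF block_subset[OF B]] by simp
  show "strongly_connected (D \<restriction> B)"
    unfolding strongly_connected_def
  proof (intro conjI ballI)
    show "verts (D \<restriction> B) \<noteq> {}" using B block_def by auto
    fix u w assume "u \<in> verts (D \<restriction> B)" "w \<in> verts (D \<restriction> B)"
    then have uw: "u \<in> B" "w \<in> B" by auto
    have "(u, w) \<in> rtrancl_on (V - {}) A" using strong uw block_subset[OF B] by auto
    then have "(u, w) \<in> rtrancl_on (B - {}) A" by (rule block_reach[OF B uw Un_upper1])
    moreover have "rtrancl_on B A = rtrancl_on B (arcs_ends (D \<restriction> B))"
      by (rule rtrancl_on_cong) (auto simp: arcs_ends_conv)
    ultimately show "u \<rightarrow>\<^sup>*\<^bsub>D \<restriction> B\<^esub> w" unfolding reachable_def by simp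
  qed
qed

text \<open>A subgraph with \<open>Q\<close> lies in a block and hence in the subgraph induced by
  it, which has \<open>Q\<close> as well. Used for biconnected subgraphs of the underlying graph and
  for strongly biconnected ones of \<open>D\<close>, it shows that both kinds of components have the
  same vertex sets.\<close>

lemma max_subgraph_blocks:
  assumes wf: "wf_digraph G" and GV: "verts G = V"
    and C: "\<And>H. subgraph H G \<Longrightarrow> Q H \<Longrightarrow> clump (verts H) \<and> verts H \<noteq> {}"
    and Q: "\<And>S. block S \<Longrightarrow> Q (G \<restriction> S)"
  shows "{B. pre_digraph.max_subgraph G Q B} = {G \<restriction> S | S. block S}"
proof (intro equalityI subsetI)
  have sub: "subgraph (G \<restriction> S) G" if "block S" for S
    using wf GV block_subset[OF that] by (auto intro: wf_digraph.subgraph_induce_subgraphI)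
  fix B
  {
    assume "B \<in> {B. pre_digraph.max_subgraph G Q B}"
    then have B: "subgraph B G" "Q B" "\<And>H'. H' \<noteq> B \<Longrightarrow> subgraph B H' \<Longrightarrow> subgraph H' G \<Longrightarrow> Q H' \<Longrightarrow> False"
      unfolding pre_digraph.max_subgraph_def by auto
    obtain S where S: "block S" "verts B \<subseteq> S" using C[OF B(1,2)] block_exists by blast
    have "subgraph B (G \<restriction> S)"
    proof (rule subgraphI)
      have th: "tail B = tail G" "head B = head G"
        using B(1) unfolding subgraph_def compatible_def by auto
      show "arcs B \<subseteq> arcs (G \<restriction> S)"
      proof
        fix e assume e: "e \<in> arcs B"
        have "wf_digraph B" using B(1) by auto
        then have "tail B e \<in> S" "head B e \<in> S"
          using S(2) wf_digraph.tail_in_verts[OF _ e] wf_digraph.head_in_verts[OF _ e] by auto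
        then show "e \<in> arcs (G \<restriction> S)" using e B(1) th by auto
      qed
      show "compatible (G \<restriction> S) B" using th by (simp add: compatible_def)
      show "wf_digraph (G \<restriction> S)" by (rule wf_digraph.wellformed_induce_subgraph[OF wf])
    qed (use B(1) S(2) in auto)
    then have "G \<restriction> S = B" using B(3) sub Q S(1) by blast
    then show "B \<in> {G \<restriction> S | S. block S}" using S(1) by blast
  next
    assume "B \<in> {G \<restriction> S | S. block S}"
    then obtain S where S: "block S" "B = G \<restriction> S" by blast
    have "H' = B" if H': "subgraph B H'" "subgraph H' G" "Q H'" for H'
    proof -
      have "S \<subseteq> verts H'" using subgraph_imp_subverts[OF H'(1)] S by simp
      then have v: "verts H' = S" using block_maximal[OF S(1)] C[OF H'(2,3)] by blast
      have th: "tail H' = tail G" "head H' = head G" using H'(2) unfolding subgraph_def compatible_def by auto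
      have "arcs H' \<subseteq> {e \<in> arcs G. tail G e \<in> S \<and> head G e \<in> S}"
      proof
        fix e assume e: "e \<in> arcs H'"
        have "wf_digraph H'" using H'(2) by auto
        then have "tail H' e \<in> S" "head H' e \<in> S"
          using v wf_digraph.tail_in_verts[OF _ e] wf_digraph.head_in_verts[OF _ e] by auto
        then show "e \<in> {e \<in> arcs G. tail G e \<in> S \<and> head G e \<in> S}" using e H'(2) th by auto
      qed
      moreover have "{e \<in> arcs G. tail G e \<in> S \<and> head G e \<in> S} \<subseteq> arcs H'"
        using H'(1) S unfolding subgraph_def by auto
      ultimately show ?thesis
        using v th S by (intro pre_digraph.equality) auto
    qed
    then show "B \<in> {B. pre_digraph.max_subgraph G Q B}"
      unfolding pre_digraph.max_subgraph_def using S sub Q by blast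
  }
qed

lemma V_sbc_eq: "V_sbc D = {underlying D \<restriction> S | S. block S}"
  unfolding V_sbc_def
  by (rule max_subgraph_blocks[OF wf_underlying])
    (use biconnected_clump block_biconnected in auto)

lemma sb_components_eq: "sb_components D = {D \<restriction> S | S. block S}"
  unfolding sb_components_def
proof (rule max_subgraph_blocks)
  show "wf_digraph D" by (rule wfD)
  fix H assume H: "subgraph H D" "strongly_biconnected H"
  have "subgraph (underlying H) (underlying D)" by (rule subgraph_mk_symmetric[OF H(1)])
  then show "clump (verts H) \<and> verts H \<noteq> {}"
    using biconnected_clump[of "underlying H"] H(2) unfolding strongly_biconnected_def by simp
qed (use block_strongly_biconnected in auto)

lemma W_sbc_eq: "W_sbc D = cut_vertices"
  unfolding W_sbc_def V_sbc_eq cut_vertices_def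
proof (intro Collect_cong iffI)
  fix w
  let ?U = "\<lambda>S. underlying D \<restriction> S"
  {
    assume "\<exists>B\<in>{?U S |S. block S}. \<exists>B'\<in>{?U S |S. block S}. B \<noteq> B' \<and> w \<in> verts B \<and> w \<in> verts B'"
    then obtain S S' where "block S" "block S'" "?U S \<noteq> ?U S'" "w \<in> S" "w \<in> S'" by auto
    then show "\<exists>B B'. block B \<and> block B' \<and> B \<noteq> B' \<and> w \<in> B \<and> w \<in> B'" by blast
  next
    assume "\<exists>B B'. block B \<and> block B' \<and> B \<noteq> B' \<and> w \<in> B \<and> w \<in> B'"
    then obtain S S' where S: "block S" "block S'" "S \<noteq> S'" "w \<in> S" "w \<in> S'" by blast
    then have "?U S \<noteq> ?U S'" "w \<in> verts (?U S)" "w \<in> verts (?U S')"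
      by (auto dest: arg_cong[of _ _ verts])
    then show "\<exists>B\<in>{?U S |S. block S}. \<exists>B'\<in>{?U S |S. block S}. B \<noteq> B' \<and> w \<in> verts B \<and> w \<in> verts B'"
      using S(1,2) by blast
  }
qed

lemma E_sbc_iff: "(B, w) \<in> E_sbc D \<longleftrightarrow> (\<exists>S. block S \<and> B = underlying D \<restriction> S \<and> w \<in> S \<and> w \<in> cut_vertices)"
  unfolding E_sbc_def W_sbc_eq V_sbc_eq by auto

lemma side_cut: "v \<in> cut_vertices \<Longrightarrow> side D w v = region v w"
proof -
  assume v: "v \<in> cut_vertices"
  have "arcs_ends (pre_digraph.del_vert (underlying D) v) = E \<inter> (V - {v}) \<times> (V - {v})"
    using EV by (auto simp: arcs_ends_conv pre_digraph.del_vert_def parcs_underlying)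
  moreover have "rtrancl_on (V - {v}) (E \<inter> (V - {v}) \<times> (V - {v})) = rtrancl_on (V - {v}) E"
    by (rule rtrancl_on_cong) auto
  ultimately show ?thesis
    using v region_subset[of v w] unfolding side_def W_sbc_eq reachable_def region_def
    by (auto simp: pre_digraph.del_vert_def)
qed

lemma side_not_cut:
  assumes "v \<notin> cut_vertices" "block B" "v \<in> B"
  shows "side D w v = {u \<in> V. u \<noteq> v \<and> (u \<in> B \<or> conn (V - B) u w)}"
proof -
  have *: "\<And>S. block S \<Longrightarrow> v \<in> S \<longleftrightarrow> S = B" using not_cut_block_unique assms by blast
  have "arcs_ends (underlying D \<restriction> (V - B)) = E \<inter> (V - B) \<times> (V - B)" by (rule arcs_ends_restrict)
  moreover have "rtrancl_on (V - B) (E \<inter> (V - B) \<times> (V - B)) = rtrancl_on (V - B) E"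
    by (rule rtrancl_on_cong) auto
  ultimately have r: "u \<rightarrow>\<^sup>*\<^bsub>underlying (D \<restriction> (V - B))\<^esub> w \<longleftrightarrow> conn (V - B) u w" for u
    unfolding underlying_restrict[OF Diff_subset] reachable_def by simp
  have "side D w v = {u \<in> V. u \<noteq> v \<and> (\<exists>S. block S \<and> v \<in> S \<and>
      (u \<in> S \<or> u \<rightarrow>\<^sup>*\<^bsub>underlying (D \<restriction> (V - S))\<^esub> w))}"
    using assms(1) unfolding side_def W_sbc_eq sb_components_eq by auto
  also have "\<dots> = {u \<in> V. u \<noteq> v \<and> (u \<in> B \<or> conn (V - B) u w)}"
    using * assms r by blast
  finally show ?thesis .
qed

lemma moves_reach: "moves D c c' \<longleftrightarrow> reach c c'"
proof
  show "reach c c'" if "moves D c c'" using that go_star_mono[of A UNIV c c' E UNIV] by (simp add: moves_go)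
  show "moves D c c'" if "reach c c'"
  proof -
    have "(w, v) \<in> A\<^sup>*" if "(v, w) \<in> A" for v w
      by (rule rtrancl_on_rtranclI[OF strong]) (use that AV in auto)
    then show ?thesis using go_star_symmetrize[OF that] by (simp add: moves_go)
  qed
qed

lemma reach_sym: "reach c c' \<Longrightarrow> reach c' c"
  by (erule go_star_sym) (use symE in \<open>auto simp: sym_def\<close>)

lemma moves_within_reach: "moves_within D X Y c c' \<Longrightarrow> reach c c'"
  unfolding moves_within_go by (erule go_star_mono) auto

text \<open>By \<open>block_reach\<close>, an arc inside the block lies on a closed directed walk
  inside the block. So moves against arcs can be simulated without leaving it.\<close>

lemma block_moves_within:
  assumes B: "block B" and c: "(go (E \<inter> B \<times> B) UNIV)\<^sup>*\<^sup>* c c'"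
  shows "moves_within D B B c c'"
proof -
  let ?A = "A \<inter> B \<times> B"
  have "(w, v) \<in> ?A\<^sup>*" if "(v, w) \<in> ?A" for v w
  proof -
    have wv: "w \<in> B" "v \<in> B" using that by auto
    have "(w, v) \<in> rtrancl_on (V - {}) A" using strong wv block_subset[OF B] by auto
    then have "(w, v) \<in> rtrancl_on (B - {}) A" by (rule block_reach[OF B wv Un_upper1])
    then show ?thesis using rtrancl_on_rtrancl[of w v B A] by simp
  qed
  moreover have "?A \<union> ?A\<inverse> = E \<inter> B \<times> B" by auto
  ultimately have "(go ?A UNIV)\<^sup>*\<^sup>* c c'" using go_star_symmetrize[of ?A c c'] c by simp
  moreover have "go ?A UNIV \<le> go ?A B" unfolding go_def by blast
  ultimately show ?thesis unfolding moves_within_go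
    using rtranclp_mono[of "go ?A UNIV" "go ?A B"] by auto
qed

end

section \<open>Correctness of the decision\<close>

context ugraph
begin

text \<open>The path in the tree is obtained as a shortest sequence of consecutively intersecting blocks.\<close>

definition block_chain :: "'a \<Rightarrow> 'a \<Rightarrow> nat \<Rightarrow> (nat \<Rightarrow> 'a set) \<Rightarrow> (nat \<Rightarrow> 'a) \<Rightarrow> bool" where
  "block_chain s t n S v \<longleftrightarrow> s \<in> S 0 \<and> t \<in> S n \<and> (\<forall>i\<le>n. block (S i)) \<and>
     (\<forall>i<n. v i \<in> S i \<and> v i \<in> S (Suc i))"

lemma block_chain_exists:
  assumes "s \<in> V" "t \<in> V"
  shows "\<exists>n S v. block_chain s t n S v"
  using con[OF assms]
proof (induction rule: rtrancl_on_induct)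
  case base
  then obtain B where "block B" "s \<in> B" using block_at by blast
  then have "block_chain s s 0 (\<lambda>_. B) (\<lambda>_. s)" unfolding block_chain_def by simp
  then show ?case by blast
next
  case (step y z)
  then obtain n S v where c: "block_chain s y n S v" by blast
  obtain B where B: "block B" "y \<in> B" "z \<in> B" using block_edge[OF step(2)] by blast
  have "block_chain s z (Suc n) (S(Suc n := B)) (v(n := y))"
    using c B unfolding block_chain_def by (auto simp: less_Suc_eq le_Suc_eq)
  then show ?case by blast
qed

text \<open>If the vertex by which the chain leaves \<open>S j\<close>, or \<open>t\<close> for
  \<open>j = n\<close>, already lies in \<open>S i\<close>, the blocks after \<open>S i\<close> up
  to \<open>S j\<close> can be cut out. For a shortest chain this gives the distinctness properties
  of a path.\<close>

lemma block_chain_shortcut: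
  assumes c: "block_chain s t n S v" and ij: "i < j" "j \<le> n"
    and j: "j < n \<Longrightarrow> v j \<in> S i" "j = n \<Longrightarrow> t \<in> S i"
  shows "\<exists>n'<n. \<exists>S v. block_chain s t n' S v"
proof -
  let ?d = "j - i"
  let ?S = "\<lambda>k. if k \<le> i then S k else S (k + ?d)" and ?v = "\<lambda>k. if k < i then v k else v (k + ?d)"
  have "block_chain s t (n - ?d) ?S ?v"
    unfolding block_chain_def
  proof (intro conjI allI impI)
    show "t \<in> ?S (n - ?d)"
    proof (cases "j = n")
      case True
      then show ?thesis using j(2) ij by auto
    next
      case False
      then have "\<not> n - ?d \<le> i" "n - ?d + ?d = n" using ij by auto
      then show ?thesis using c unfolding block_chain_def by simp
    qed
    show "block (?S k)" if "k \<le> n - ?d" for k using c ij that unfolding block_chain_def by auto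
    show "?v k \<in> ?S k" if "k < n - ?d" for k
      using c ij j(1) that unfolding block_chain_def by (cases "k = i") auto
    show "?v k \<in> ?S (Suc k)" if "k < n - ?d" for k
      using c ij that unfolding block_chain_def by auto
  qed (use c block_chain_def in auto)
  moreover have "n - ?d < n" using ij by linarith
  ultimately show ?thesis by blast
qed

lemma block_path_exists:
  assumes st: "s \<in> V" "t \<in> V" and nc: "\<not> (\<exists>B. block B \<and> s \<in> B \<and> t \<in> B)"
  obtains n S v where "block_path V E S v n t" "s \<in> S 0" "s \<noteq> v 0"
proof -
  have "\<exists>n. (\<exists>S v. block_chain s t n S v) \<and> (\<forall>k<n. \<not> (\<exists>S v. block_chain s t k S v))"
    using block_chain_exists[OF st] exists_least_iff[of "\<lambda>n. \<exists>S v. block_chain s t n S v"] by blast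
  then obtain n S v where c: "block_chain s t n S v" and mn: "\<And>k. k < n \<Longrightarrow> \<not> (\<exists>S v. block_chain s t k S v)"
    by blast
  note cd = c[unfolded block_chain_def]
  have n: "0 < n" using cd nc by (cases n) auto
  have cut_short: "\<not> ((j < n \<longrightarrow> v j \<in> S i) \<and> (j = n \<longrightarrow> t \<in> S i))" if "i < j" "j \<le> n" for i j
    using block_chain_shortcut[OF c that] mn by blast
  \<comment> \<open>Otherwise the first block could be dropped.\<close>
  have "s \<noteq> v 0"
  proof
    assume "s = v 0"
    then have "block_chain s t (n - 1) (\<lambda>k. S (Suc k)) (\<lambda>k. v (Suc k))"
      using cd n unfolding block_chain_def by auto
    then show False using mn[of "n - 1"] n by auto
  qed
  moreover have "block_path V E S v n t"
  proof
    show "block (S i)" if "i \<le> n" for i using cd that by blast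
    have Sne: "S i \<noteq> S j" if "i < j" "j \<le> n" for i j
      using cut_short[OF that] cd that by auto
    show "i = j" if "i \<le> n" "j \<le> n" "S i = S j" for i j
      using Sne[of i j] Sne[of j i] that by (cases i j rule: linorder_cases) auto
    have vne: "v i \<noteq> v j" if "i < j" "j < n" for i j
    proof
      assume "v i = v j"
      moreover have "v i \<in> S i" using cd that by auto
      ultimately show False using cut_short[of i j] that by auto
    qed
    show "i = j" if "i < n" "j < n" "v i = v j" for i j
      using vne[of i j] vne[of j i] that by (cases i j rule: linorder_cases) auto
    show "t \<noteq> v (n - 1)"
      using cut_short[of "n - 1" n] cd n by auto
  qed (use cd n in auto)
  ultimately show thesis using that cd by blast
qed

end

context sc_digraph
begin

lemma sbc_path_exists:
  assumes st: "s \<in> V" "t \<in> V" and nc: "\<not> (\<exists>B. block B \<and> s \<in> B \<and> t \<in> B)"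
  shows "\<exists>Bs vs. sbc_path D s t Bs vs"
proof -
  obtain n S v where bp: "block_path V E S v n t" and s: "s \<in> S 0" "s \<noteq> v 0"
    using block_path_exists[OF st nc] by blast
  interpret bp: block_path V E S v n t by (rule bp)
  let ?B = "\<lambda>i. underlying D \<restriction> S i"
  let ?Bs = "map ?B [0..<Suc n]" and ?vs = "map v [0..<n]"
  have cut_vertices: "v i \<in> cut_vertices" if "i < n" for i
    using bp.blk[of i] bp.blk[of "Suc i"] bp.vS[OF that] bp.vS'[OF that] bp.S_inj[of i "Suc i"] that
    unfolding cut_vertices_def by fastforce
  have nth: "?Bs ! i = ?B i" if "i \<le> n" for i using that by (simp del: upt_Suc)
  have "sbc_path D s t ?Bs ?vs"
    unfolding sbc_path_def
  proof (intro conjI allI impI)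
    show "?vs \<noteq> []" using bp.r by simp
    show "length ?Bs = length ?vs + 1" by simp
    have "S i = S j" if "?B i = ?B j" for i j
      using arg_cong[OF that, of verts] by simp
    then show "distinct ?Bs"
      unfolding distinct_map using bp.S_inj by (auto intro!: inj_onI simp del: upt_Suc)
    show "distinct ?vs" unfolding distinct_map using bp.v_inj by (auto intro!: inj_onI)
    show "(?Bs ! i, ?vs ! i) \<in> E_sbc D" if "i < length ?vs" for i
      using that nth[of i] bp.blk[of i] bp.vS[of i] cut_vertices[of i] unfolding E_sbc_iff by auto
    show "(?Bs ! (i + 1), ?vs ! i) \<in> E_sbc D" if "i < length ?vs" for i
      using that nth[of "Suc i"] bp.blk[of "Suc i"] bp.vS'[of i] cut_vertices[of i] unfolding E_sbc_iff by auto
    show "s \<in> verts (hd ?Bs)" using s(1) by (simp add: hd_map del: upt_Suc)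
    show "t \<in> verts (last ?Bs)" using bp.t(1) by simp
    show "s \<noteq> hd ?vs" using s(2) bp.r by (simp add: hd_map)
    show "t \<noteq> last ?vs" using bp.t(2) bp.r by (simp add: last_map)
  qed
  then show ?thesis by blast
qed

lemma sb_verts: "B \<in> sb_components D \<Longrightarrow> block (verts B)"
  unfolding sb_components_eq by auto

lemma sb_of_block: "block S \<Longrightarrow> \<exists>B\<in>sb_components D. verts B = S"
  unfolding sb_components_eq by force

lemma t_in_side:
  assumes "v \<in> V" "t \<in> V" "t \<noteq> v"
  shows "t \<in> side D t v"
proof (cases "v \<in> cut_vertices")
  case True
  then show ?thesis using side_cut[OF True, of t] assms unfolding region_def by auto
next
  case False
  obtain B where "block B" "v \<in> B" using block_at assms by blast
  then show ?thesis using side_not_cut[OF False] assms by auto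
qed

text \<open>The inclusion can be strict if \<open>v\<close> is not a cut vertex: the region is then
  all of \<open>V - {v}\<close>, but the side omits what hangs on the block of \<open>v\<close> away
  from \<open>t\<close>.\<close>

lemma side_subset_region:
  assumes "v \<in> V" "t \<in> V" "t \<noteq> v"
  shows "side D t v \<subseteq> region v t"
proof (cases "v \<in> cut_vertices")
  case True
  then show ?thesis using side_cut by blast
next
  case False
  then show ?thesis using not_cut_region[OF False assms] unfolding side_def by auto
qed

lemma side_subset: "side D t v \<subseteq> V"
  unfolding side_def by auto

lemma no_holes_stuck:
  assumes "reach c c'" "\<And>x. x \<in> V \<Longrightarrow> c x \<noteq> Hole"
  shows "c' = c"
  using assms(1)
proof (induction rule: rtranclp_induct)
  case (step y z)
  then show ?case using assms(2) EV unfolding go_def by blast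
qed simp

text \<open>The two alternatives correspond to the two conjuncts of the loop condition, one of which
  has failed.\<close>

lemma exit_holes:
  assumes R: "robot_only V c v" and t: "t \<in> V" "t \<noteq> v" and ex: "\<not> loop_cond D t c"
  shows "(\<forall>x\<in>side D t v. c x = Hole) \<or> {x \<in> V. c x = Hole} = holes_in c (side D t v)"
proof -
  have "robot_at D c v" using robot_onlyD[OF R] unfolding robot_at_def by simp
  then consider "obstacles_in c (side D t v) = {}" | "holes_in c (non_side D t v) = {}"
    using ex unfolding loop_cond_def by blast
  then show ?thesis
  proof cases
    case 1
    have "c x = Hole" if "x \<in> side D t v" for x
    proof -
      have "x \<in> V" "x \<noteq> v" using that unfolding side_def by auto
      then have "c x \<noteq> Robot" "c x \<noteq> Obstacle"
        using robot_onlyD(3)[OF R] 1 that unfolding obstacles_in_def by auto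
      then show ?thesis by (cases "c x") auto
    qed
    then show ?thesis by blast
  next
    case 2
    have "x \<in> side D t v" if "x \<in> V" "c x = Hole" for x
    proof -
      have "x \<noteq> v" using robot_onlyD(1)[OF R] that by auto
      then show ?thesis using 2 that unfolding holes_in_def non_side_def by auto
    qed
    then show ?thesis using side_subset unfolding holes_in_def by blast
  qed
qed

lemma decide_common_correct:
  assumes R: "robot_only V c s" and t: "t \<in> V" "t \<noteq> s" and ex: "\<not> loop_cond D t c"
    and B: "block B" "s \<in> B" "t \<in> B"
  shows "1 \<le> card (holes_in c (side D t s)) \<longleftrightarrow> (\<exists>c'. reach c c' \<and> c' t = Robot)"
proof
  have sV: "s \<in> V" using robot_onlyD(2)[OF R] .
  assume "1 \<le> card (holes_in c (side D t s))"
  also have "\<dots> \<le> hole_count c s t"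
    using side_subset_region[OF sV t] by (intro hole_count_ge)
      (auto simp: holes_in_def intro: finite_subset[OF side_subset fin] finite_subset)
  finally show "\<exists>c'. reach c c' \<and> c' t = Robot"
    using block_goal[OF B(1,3,2) t(2)[symmetric] R] by blast
next
  have sV: "s \<in> V" using robot_onlyD(2)[OF R] .
  assume "\<exists>c'. reach c c' \<and> c' t = Robot"
  then obtain c' where c': "reach c c'" "c' t = Robot" by blast
  show "1 \<le> card (holes_in c (side D t s))"
  proof (rule ccontr)
    assume "\<not> ?thesis"
    moreover have "finite (holes_in c (side D t s))"
      using finite_subset[OF side_subset fin] unfolding holes_in_def by simp
    ultimately have none: "holes_in c (side D t s) = {}" by (simp add: not_le card_eq_0_iff)
    \<comment> \<open>The t-side contains \<open>t\<close> and is therefore not full of holes. By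
      \<open>exit_holes\<close> all holes lie on it, so there are none and nothing can move.\<close>
    then have "c t \<noteq> Hole" using t_in_side[OF sV t] unfolding holes_in_def by blast
    then have "{x \<in> V. c x = Hole} = {}"
      using exit_holes[OF R t ex] none t_in_side[OF sV t] by blast
    then have "c' = c" using no_holes_stuck[OF c'(1)] by blast
    then show False using c'(2) robot_onlyD(3)[OF R t(1)] t(2) by simp
  qed
qed

lemma sbc_path_components:
  assumes "sbc_path D s t Bs vs" "i \<le> length vs"
  shows "Bs ! i \<in> V_sbc D" "block (verts (Bs ! i))" "Bs ! i = underlying D \<restriction> verts (Bs ! i)"
proof -
  have vs: "vs \<noteq> []" "\<And>i. i < length vs \<Longrightarrow> (Bs ! i, vs ! i) \<in> E_sbc D \<and> (Bs ! (i + 1), vs ! i) \<in> E_sbc D"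
    using assms unfolding sbc_path_def by auto
  have "\<exists>S. block S \<and> Bs ! i = underlying D \<restriction> S"
  proof (cases "i < length vs")
    case True
    then show ?thesis using vs(2)[of i] E_sbc_iff by blast
  next
    case False
    then have "i = Suc (length vs - 1)" "length vs - 1 < length vs" using assms vs(1) by (cases vs; simp)+
    then show ?thesis using vs(2)[of "length vs - 1"] E_sbc_iff by (metis Suc_eq_plus1)
  qed
  then obtain S where "block S" "Bs ! i = underlying D \<restriction> S" by blast
  then show "Bs ! i \<in> V_sbc D" "block (verts (Bs ! i))" "Bs ! i = underlying D \<restriction> verts (Bs ! i)"
    unfolding V_sbc_eq by auto
qed

lemma sbc_path_block_path:
  assumes p: "sbc_path D s t Bs vs"
  shows "block_path V E (\<lambda>i. verts (Bs ! i)) ((!) vs) (length vs) t"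
proof -
  have d: "vs \<noteq> []" "length Bs = Suc (length vs)" "distinct Bs" "distinct vs" "t \<in> verts (last Bs)" "t \<noteq> last vs"
    and e: "\<And>i. i < length vs \<Longrightarrow> (Bs ! i, vs ! i) \<in> E_sbc D \<and> (Bs ! Suc i, vs ! i) \<in> E_sbc D"
    using p unfolding sbc_path_def by auto
  have "Bs \<noteq> []" using d(2) by auto
  show ?thesis
  proof
    show "0 < length vs" using d(1) by simp
    show "block (verts (Bs ! i))" if "i \<le> length vs" for i using sbc_path_components[OF p that] by blast
    show "i = j" if "i \<le> length vs" "j \<le> length vs" "verts (Bs ! i) = verts (Bs ! j)" for i j
    proof -
      have "Bs ! i = Bs ! j" using sbc_path_components(3)[OF p] that by metis
      then show ?thesis using d(2,3) that nth_eq_iff_index_eq[of Bs i j] by simp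
    qed
    show "i = j" if "i < length vs" "j < length vs" "vs ! i = vs ! j" for i j
      using d(4) that nth_eq_iff_index_eq by blast
    show "vs ! i \<in> verts (Bs ! i)" "vs ! i \<in> verts (Bs ! Suc i)" if "i < length vs" for i
      using e[OF that] unfolding E_sbc_def by auto
    show "t \<in> verts (Bs ! length vs)" using d(2,5) last_conv_nth[OF \<open>Bs \<noteq> []\<close>] by simp
    show "t \<noteq> vs ! (length vs - 1)" using d(6) last_conv_nth[OF d(1)] by simp
  qed
qed

lemma branching_iff:
  assumes p: "sbc_path D s t Bs vs" and k: "k < length vs"
  shows "branching D Bs (vs ! k) \<longleftrightarrow>
    block_path.branching_at V E (\<lambda>i. verts (Bs ! i)) (length vs) (vs ! k)"
proof -
  interpret bp: block_path V E "\<lambda>i. verts (Bs ! i)" "(!) vs" "length vs" t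
    by (rule sbc_path_block_path[OF p])
  have len: "length Bs = Suc (length vs)" using p unfolding sbc_path_def by simp
  have "vs ! k \<in> cut_vertices" using p k E_sbc_iff unfolding sbc_path_def by blast
  show ?thesis
  proof
    assume "branching D Bs (vs ! k)"
    then obtain B where B: "B \<notin> set Bs" "(B, vs ! k) \<in> E_sbc D" unfolding branching_def by blast
    then obtain S where S: "block S" "B = underlying D \<restriction> S" "vs ! k \<in> S" using E_sbc_iff by blast
    have "S \<noteq> verts (Bs ! i)" if "i \<le> length vs" for i
      using B(1) S(2) sbc_path_components(3)[OF p that] that len by auto
    then show "bp.branching_at (vs ! k)" unfolding bp.branching_at_def using S by blast
  next
    assume "bp.branching_at (vs ! k)"
    then obtain S where S: "block S" "vs ! k \<in> S" "\<And>i. i \<le> length vs \<Longrightarrow> S \<noteq> verts (Bs ! i)"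
      unfolding bp.branching_at_def by blast
    let ?B = "underlying D \<restriction> S"
    have "?B \<notin> set Bs"
    proof
      assume "?B \<in> set Bs"
      then obtain i where "i < length Bs" "Bs ! i = ?B" by (auto simp: in_set_conv_nth)
      then show False using S(3)[of i] len by auto
    qed
    moreover have "(?B, vs ! k) \<in> E_sbc D" using S(1,2) \<open>vs ! k \<in> cut_vertices\<close> E_sbc_iff by blast
    moreover have "?B \<in> V_sbc D" using S(1) V_sbc_eq by blast
    ultimately show "branching D Bs (vs ! k)" unfolding branching_def by blast
  qed
qed

lemma corridor_iff:
  assumes p: "sbc_path D s t Bs vs"
  shows "corridor D Bs vs (Suc a) (Suc b) \<longleftrightarrow>
    block_path.corr V E (\<lambda>i. verts (Bs ! i)) ((!) vs) (length vs) a b"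
proof -
  interpret bp: block_path V E "\<lambda>i. verts (Bs ! i)" "(!) vs" "length vs" t
    by (rule sbc_path_block_path[OF p])
  have shift: "(\<forall>k. Suc a < k \<and> k < Suc b \<longrightarrow> \<not> branching D Bs (vs ! (k - 1))) \<longleftrightarrow>
    (\<forall>k. a < k \<and> k < b \<longrightarrow> \<not> branching D Bs (vs ! k))"
  proof
    assume L: "\<forall>k. Suc a < k \<and> k < Suc b \<longrightarrow> \<not> branching D Bs (vs ! (k - 1))"
    show "\<forall>k. a < k \<and> k < b \<longrightarrow> \<not> branching D Bs (vs ! k)"
      using L[rule_format, of "Suc k" for k] by simp
  next
    assume R: "\<forall>k. a < k \<and> k < b \<longrightarrow> \<not> branching D Bs (vs ! k)"
    show "\<forall>k. Suc a < k \<and> k < Suc b \<longrightarrow> \<not> branching D Bs (vs ! (k - 1))"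
    proof (intro allI impI)
      fix k assume k: "Suc a < k \<and> k < Suc b"
      then obtain j where "k = Suc j" by (cases k) auto
      then show "\<not> branching D Bs (vs ! (k - 1))" using R k by auto
    qed
  qed
  have br: "k < length vs \<Longrightarrow> branching D Bs (vs ! k) \<longleftrightarrow> bp.branching_at (vs ! k)" for k
    by (rule branching_iff[OF p])
  have br': "(\<forall>k. a < k \<and> k < b \<longrightarrow> \<not> branching D Bs (vs ! k)) \<longleftrightarrow>
    (\<forall>k. a < k \<and> k < b \<longrightarrow> \<not> bp.branching_at (vs ! k))" if "b < length vs"
    using br that by auto
  show ?thesis
    unfolding corridor_def bp.corr_def shift
    using br[of a] br[of b] br' by (auto simp: Suc_le_eq less_Suc_eq_le)
qed

lemma max_corridor:
  assumes p: "sbc_path D s t Bs vs"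
  shows "block_path.corr V E (\<lambda>i. verts (Bs ! i)) ((!) vs) (length vs) a b \<Longrightarrow> b - a + 1 \<le> max_corridor D Bs vs"
    and "\<exists>a b. block_path.corr V E (\<lambda>i. verts (Bs ! i)) ((!) vs) (length vs) a b \<and> max_corridor D Bs vs = b - a + 1"
proof -
  interpret bp: block_path V E "\<lambda>i. verts (Bs ! i)" "(!) vs" "length vs" t
    by (rule sbc_path_block_path[OF p])
  have eq: "{j - i + 1 | i j. corridor D Bs vs i j} = {b - a + 1 | a b. bp.corr a b}"
  proof (intro equalityI subsetI)
    fix x assume "x \<in> {j - i + 1 | i j. corridor D Bs vs i j}"
    then obtain i j where ij: "x = j - i + 1" "corridor D Bs vs i j" by blast
    then have "1 \<le> i" "i \<le> j" unfolding corridor_def by auto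
    then obtain a b where "i = Suc a" "j = Suc b" by (cases i; cases j) auto
    then show "x \<in> {b - a + 1 | a b. bp.corr a b}" using ij corridor_iff[OF p] by auto
  next
    fix x assume "x \<in> {b - a + 1 | a b. bp.corr a b}"
    then obtain a b where "x = Suc b - Suc a + 1" "bp.corr a b" by auto
    then show "x \<in> {j - i + 1 | i j. corridor D Bs vs i j}" using corridor_iff[OF p] by blast
  qed
  have fin: "finite {b - a + 1 | a b. bp.corr a b}"
    by (rule finite_subset[of _ "{..length vs}"]) (auto simp: bp.corr_def)
  \<comment> \<open>The stretch up to the first stop is a corridor, so the maximum is taken over a
    nonempty set.\<close>
  have "\<exists>b0. bp.corr 0 b0" using bp.next_stop[OF bp.r] by metis
  then have ne: "{b - a + 1 | a b. bp.corr a b} \<noteq> {}" by blast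
  have mx: "max_corridor D Bs vs = Max {b - a + 1 | a b. bp.corr a b}"
    unfolding max_corridor_def eq ..
  show "bp.corr a b \<Longrightarrow> b - a + 1 \<le> max_corridor D Bs vs" unfolding mx using fin by (intro Max_ge) auto
  show "\<exists>a b. bp.corr a b \<and> max_corridor D Bs vs = b - a + 1" using Max_in[OF fin ne] unfolding mx by blast
qed

text \<open>If there are enough holes, the robot starts as a station for the first cut vertex. For
  the converse use \<open>exit_holes\<close>: if all holes are on the t-side,
  \<open>corridor_holes\<close> bounds their number; if the t-side is full of holes,
  \<open>t\<close> and the cut vertices of the path are already enough.\<close>

lemma decide_path_correct:
  assumes R: "robot_only V c s" and t: "t \<in> V" "t \<noteq> s" and ex: "\<not> loop_cond D t c"
    and p: "sbc_path D s t Bs vs"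
  shows "max_corridor D Bs vs + 1 \<le> card (holes_in c (side D t s)) \<longleftrightarrow> (\<exists>c'. reach c c' \<and> c' t = Robot)"
proof -
  let ?S = "\<lambda>i. verts (Bs ! i)" and ?K = "max_corridor D Bs vs + 1"
  interpret bp: block_path V E ?S "(!) vs" "length vs" t
    by (rule sbc_path_block_path[OF p])
  have sV: "s \<in> V" using robot_onlyD(2)[OF R] .
  have "Bs \<noteq> []" "vs \<noteq> []" using p unfolding sbc_path_def by auto
  then have s: "s \<in> ?S 0" "s \<noteq> vs ! 0" using p hd_conv_nth unfolding sbc_path_def by metis+
  have S01: "block (?S 0)" "vs ! 0 \<in> ?S 0" "?S 0 \<noteq> ?S (Suc 0)"
    using bp.blk[of 0] bp.vS[OF bp.r] bp.S_inj[of 0 "Suc 0"] bp.r by (auto simp: Suc_le_eq)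
  have sv: "s \<noteq> vs ! k" if "k < length vs" for k
    using bp.train_region(1)[OF bp.r S01 s _ that] by simp
  let ?l = "length vs - 1"
  have l: "?l < length vs" "Suc ?l = length vs" using bp.r by auto
  have vt: "conn (V - {s}) (vs ! k) t" if "k < length vs" for k
  proof -
    have "conn (V - {s}) (vs ! ?l) t"
      using block_conn[OF bp.blk[of "length vs"] _ bp.t(1), of "vs ! ?l" s] bp.vS'[OF l(1)] l sv[OF l(1)] t by auto
    moreover have "conn (V - {s}) (vs ! ?l) (vs ! k)" using bp.chain[of k ?l s] that l sv by auto
    ultimately show ?thesis using conn_sym conn_trans by blast
  qed
  have finside: "finite (side D t s)" by (rule finite_subset[OF side_subset fin])
  show ?thesis
  proof
    assume K: "?K \<le> card (holes_in c (side D t s))"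
    have "region s (vs ! 0) = region s t"
      using vt[OF bp.r] conn_sym conn_trans unfolding region_def by blast
    then have "card (holes_in c (side D t s)) \<le> hole_count c s (vs ! 0)"
      using side_subset_region[OF sV t] finside by (intro hole_count_ge) (auto simp: holes_in_def)
    then have "bp.station ?K 0 (?S 0) s c"
      unfolding bp.station_def using K S01 s R bp.r by auto
    moreover have "b - a + 2 \<le> ?K" if "bp.corr a b" for a b using max_corridor(1)[OF p that] by simp
    ultimately show "\<exists>c'. reach c c' \<and> c' t = Robot" using bp.station_reach by blast
  next
    assume "\<exists>c'. reach c c' \<and> c' t = Robot"
    then obtain c' where c': "reach c c'" "c' t = Robot" by blast
    obtain a b where ab: "bp.corr a b" "max_corridor D Bs vs = b - a + 1" using max_corridor(2)[OF p] by blast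
    obtain v' where "robot_only V c' v'" using go_star_robot[OF c'(1) EV R] by blast
    then have "robot_only V c' t" using robot_onlyD(3) t(1) c'(2) by metis
    then have N: "b - a + 2 \<le> card {x \<in> V. c x = Hole}"
      using bp.corridor_holes[OF ab(1) s R c'(1)] by blast
    have "?K \<le> card (holes_in c (side D t s))" if full: "\<forall>x\<in>side D t s. c x = Hole"
    proof -
      \<comment> \<open>Needed if \<open>s\<close> is not a cut vertex: its t-side is then formed by
        deleting all of \<open>S 0\<close>, so the later cut vertices must be joined to
        \<open>t\<close> outside that block.\<close>
      have far: "conn (V - ?S 0) (vs ! k) t" if k: "0 < k" "k < length vs" for k
      proof -
        have out: "vs ! j \<notin> ?S 0" if "0 < j" "j < length vs" for j
          using bp.v_in_S[of j 0] that by auto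
        have tout: "t \<notin> ?S 0"
        proof
          assume "t \<in> ?S 0"
          then have "\<not> conn (V - {vs ! ?l}) t t"
            using bp.ahead_sep_behind[of 0 ?l "length vs" t t] bp.t_ne_v[OF l(1)] bp.t l by auto
          then show False using t(1) bp.t_ne_v[OF l(1)] by auto
        qed
        have "conn (V - ?S 0) (vs ! ?l) t"
          using block_avoid[OF bp.blk[of "length vs"] S01(1), of "vs ! ?l" t] bp.S_inj[of "length vs" 0]
            bp.vS'[OF l(1)] l bp.t(1) out[of ?l] tout k bp.r by auto
        moreover have "conn (V - ?S 0) (vs ! k) (vs ! ?l)"
        proof -
          have "k \<le> ?l" using k by simp
          then show ?thesis using k(1)
          proof (induction k rule: inc_induct)
            case base
            then show ?case using bp.vV[OF l(1)] out[of ?l] l by auto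
          next
            case (step n)
            then have n: "Suc n < length vs" using l by linarith
            have "conn (V - ?S 0) (vs ! n) (vs ! Suc n)"
              using block_avoid[OF bp.blk[of "Suc n"] S01(1), of "vs ! n" "vs ! Suc n"]
                bp.S_inj[of "Suc n" 0] bp.vS'[of n] bp.vS[of "Suc n"] out[of n] out[of "Suc n"] n step by auto
            then show ?case using step conn_trans by blast
          qed
        qed
        ultimately show ?thesis using conn_trans by blast
      qed
      have "vs ! k \<in> side D t s" if k: "k < length vs" for k
      proof (cases "s \<in> cut_vertices")
        case True
        then show ?thesis using vt[OF k] side_cut unfolding region_def by blast
      next
        case False
        then show ?thesis
          using side_not_cut[OF False S01(1) s(1)] far[of k] k S01(2) sv[OF k] bp.vV[OF k] by (cases "k = 0") auto
      qed
      then have "insert t ((!) vs ` {..<length vs}) \<subseteq> side D t s" using t_in_side[OF sV t] by auto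
      then have "card (insert t ((!) vs ` {..<length vs})) \<le> card (holes_in c (side D t s))"
        using full finside unfolding holes_in_def by (intro card_mono) auto
      moreover have "t \<notin> (!) vs ` {..<length vs}" using bp.t_ne_v by auto
      moreover have "card ((!) vs ` {..<length vs}) = length vs"
        using bp.v_inj by (subst card_image) (auto intro: inj_onI)
      moreover have "b - a + 1 \<le> length vs" using ab(1) unfolding bp.corr_def by auto
      ultimately show ?thesis using ab(2) by simp
    qed
    then show "?K \<le> card (holes_in c (side D t s))"
    proof (rule disjE[OF exit_holes[OF R t ex]])
      assume "{x \<in> V. c x = Hole} = holes_in c (side D t s)"
      then show ?thesis using N ab(2) by simp
    qed
  qed
qed

end

section \<open>Runs of the algorithm\<close>

text \<open>The walk runs from \<open>w\<close> to \<open>h\<close> because a hole travels against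
  the arcs.\<close>

lemma transfer_hole_walk:
  assumes "(w, h) \<in> rtrancl_on F (arcs_ends D)" "F \<subseteq> verts D" "\<And>x. x \<in> F \<Longrightarrow> c x \<noteq> Robot" "c h = Hole"
  shows "transfer_hole D h w c (c(h := c w, w := Hole))"
proof -
  have "(go (arcs_ends D \<inter> F \<times> F) {})\<^sup>*\<^sup>* c (c(h := c w, w := Hole))"
    by (rule transfer_walk[where c = c, OF assms(1,3,4)])
  then have "moves_within D (verts D) {} c (c(h := c w, w := Hole))"
    unfolding moves_within_go by (rule go_star_mono) (use assms(2) in auto)
  then show ?thesis
    unfolding transfer_hole_def using assms in_rtrancl_on_in_F(1)[OF assms(1)] by blast
qed

context sc_digraph
begin

section \<open>No instruction of the loop gets stuck\<close>

lemma towards_t: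
  assumes "v \<in> V" "t \<in> V" "v \<noteq> t" "a \<notin> region v t" "a \<noteq> v"
  shows "conn (V - {a}) v t"
proof -
  have "conn (insert v V) v t" using con assms by (simp add: insert_absorb)
  then obtain q where q: "(v, q) \<in> E" "conn (V - {v}) q t" using rtrancl_on_last_exit assms(3) by metis
  then have "q \<in> region v t" "t \<in> region v t" unfolding region_def using assms by auto
  then have "conn (region v t) q t" by (rule region_connected)
  then have "conn (V - {a}) q t" by (rule conn_mono) (use region_subset[of v t] assms(4) in auto)
  moreover have "conn (V - {a}) v q"
    using q(1) \<open>q \<in> region v t\<close> assms EV by (intro conn_edge) auto
  ultimately show ?thesis using conn_trans by blast
qed

text \<open>Seen from \<open>a\<close>, the old region stays connected to \<open>t\<close>, and
  \<open>v\<close> joins it. This drives termination: a robot moving away from \<open>t\<close>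
  separates fewer vertices from it.\<close>

lemma region_grows:
  assumes "v \<in> V" "t \<in> V" "v \<noteq> t" "a \<notin> region v t" "a \<noteq> v"
  shows "region v t \<subset> region a t"
proof -
  have "region v t \<subseteq> region a t"
  proof
    fix u assume u: "u \<in> region v t"
    have "t \<in> region v t" unfolding region_def using assms by auto
    then have "conn (region v t) u t" using u region_connected by blast
    then have "conn (V - {a}) u t" by (rule conn_mono) (use region_subset[of v t] assms(4) in auto)
    then show "u \<in> region a t" unfolding region_def by simp
  qed
  moreover have "v \<in> region a t" using towards_t[OF assms] unfolding region_def by simp
  moreover have "v \<notin> region v t" using region_subset by blast
  ultimately show ?thesis by blast
qed

text \<open>Take a walk from \<open>v\<close> to the hole and the block of the edge by which it
  leaves \<open>v\<close> for the last time. If this block met the t-side of \<open>v\<close>, the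
  hole would be on that side too.\<close>

lemma cut_select_exists:
  assumes R: "robot_only V c v" and t: "t \<in> V" "v \<noteq> t" and v: "v \<in> cut_vertices"
    and h: "h \<in> holes_in c (non_side D t v)"
  shows "\<exists>B\<in>sb_components D. v \<in> verts B \<and> verts B \<inter> side D t v = {} \<and>
    (\<exists>w\<in>verts B. w \<noteq> v \<and> holes_in c (side D w v) \<noteq> {})"
proof -
  have vV: "v \<in> V" using robot_onlyD(2)[OF R] .
  have h': "h \<in> V" "h \<noteq> v" "h \<notin> region v t" "c h = Hole"
    using h side_cut[OF v] unfolding holes_in_def non_side_def by auto
  have "conn (insert v V) v h" using con vV h' by (simp add: insert_absorb)
  then obtain p where p: "(v, p) \<in> E" "conn (V - {v}) p h" using rtrancl_on_last_exit h'(2) by metis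
  obtain S where S: "block S" "v \<in> S" "p \<in> S" using block_edge[OF p(1)] by blast
  obtain B where B: "B \<in> sb_components D" "verts B = S" using sb_of_block[OF S(1)] by blast
  have "p \<noteq> v" using p(2) in_rtrancl_on_in_F by fastforce
  have "x \<notin> region v t" if x: "x \<in> S" for x
  proof
    assume xr: "x \<in> region v t"
    then have "x \<noteq> v" using region_subset by blast
    then have "conn (V - {v}) p x" using block_conn[OF S(1,3) x, of v] \<open>p \<noteq> v\<close> by auto
    then have "conn (V - {v}) h t" using conn_sym[OF p(2)] xr conn_trans unfolding region_def by blast
    then show False using h'(3) unfolding region_def by simp
  qed
  moreover have "h \<in> holes_in c (side D p v)"
    using h'(4) conn_sym[OF p(2)] side_cut[OF v] unfolding holes_in_def region_def by auto
  ultimately show ?thesis using B S side_cut[OF v] \<open>p \<noteq> v\<close> by blast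
qed

text \<open>The witness \<open>a\<close> is the vertex at which the hole hangs on \<open>B\<close>.
  It differs from the robot's vertex, so the hole can be pulled to it past the resting
  robot.\<close>

lemma cut_fetch_exists:
  assumes R: "robot_only V c v" and t: "t \<in> V" "v \<noteq> t" and v: "v \<in> cut_vertices"
    and B: "block B" "v \<in> B" "B \<inter> side D t v = {}" "holes_in c B = {}"
    and w: "w \<in> B" "w \<noteq> v" and h: "h \<in> holes_in c (side D w v)"
  shows "\<exists>a\<in>B \<inter> W_sbc D. h \<in> holes_in c (non_side D t a) \<and>
    transfer_hole D h a c (c(h := c a, a := Hole))"
proof -
  have hs: "h \<in> side D w v" "c h = Hole" using h unfolding holes_in_def by auto
  then have h': "c h = Hole" "conn (V - {v}) h w" "h \<in> V"
    using side_cut[OF v, of w] side_subset[of w v] by (auto simp: region_def)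
  have hB: "h \<notin> B" using B(4) h'(1) unfolding holes_in_def by auto
  obtain a where a: "a \<in> B" "(a, h) \<in> rtrancl_on (insert a (V - B)) A"
    using block_attach[OF B(1) Un_upper1 h'(3) strong] by blast
  have "h \<noteq> a" using hB a by auto
  then obtain p where p: "(a, p) \<in> A" "(p, h) \<in> rtrancl_on (V - B - {a}) A"
    using rtrancl_on_last_exit[OF a(2)] by blast
  have pB: "p \<notin> B" using p(2) in_rtrancl_on_in_F by fastforce
  have ap: "(a, p) \<in> E" using p(1) by simp
  have ph: "conn (V - {a}) p h"
    by (rule rtrancl_on_mono[OF _ _ p(2)]) auto
  have acut: "a \<in> cut_vertices" using exit_cut[OF B(1) a(1) pB ap] .
  \<comment> \<open>If the hole hung on \<open>B\<close> at \<open>v\<close>, its being on the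
    \<open>w\<close>-side of \<open>v\<close> would give an ear.\<close>
  have av: "a \<noteq> v"
  proof
    assume "a = v"
    then have "conn (V - {a}) p w" using ph h'(2) conn_trans by blast
    then show False using block_ear[OF B(1) a(1) pB ap w(1)] w(2) \<open>a = v\<close> by blast
  qed
  have vV: "v \<in> V" using robot_onlyD(2)[OF R] .
  have "a \<notin> region v t" using B(3) a(1) side_cut[OF v] by blast
  then have vt: "conn (V - {a}) v t" using towards_t vV t av by blast
  \<comment> \<open>\<open>v\<close> is joined to \<open>t\<close> without \<open>a\<close>, so the
    hole would be joined to \<open>v\<close> without \<open>a\<close>, which again gives an
    ear.\<close>
  have "h \<notin> region a t"
  proof
    assume "h \<in> region a t"
    then have "conn (V - {a}) h t" unfolding region_def by simp
    then have "conn (V - {a}) p v" using ph conn_sym[OF vt] conn_trans by blast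
    then show False using block_ear[OF B(1) a(1) pB ap B(2)] av by blast
  qed
  then have "h \<in> holes_in c (non_side D t a)"
    unfolding holes_in_def non_side_def side_cut[OF acut] using h' \<open>h \<noteq> a\<close> by auto
  moreover have "transfer_hole D h a c (c(h := c a, a := Hole))"
  proof (rule transfer_hole_walk)
    show "(a, h) \<in> rtrancl_on (insert a (V - B)) (arcs_ends D)" using a(2) by simp
    show "insert a (V - B) \<subseteq> verts D" using a(1) block_subset[OF B(1)] by auto
    show "c x \<noteq> Robot" if "x \<in> insert a (V - B)" for x
    proof -
      have "x \<in> V" "x \<noteq> v" using that a(1) av B(2) block_subset[OF B(1)] by auto
      then show ?thesis using robot_onlyD(3)[OF R] by simp
    qed
  qed (rule h'(1))
  ultimately show ?thesis using a(1) acut W_sbc_eq by blast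
qed

text \<open>On a directed walk in \<open>B\<close> from \<open>v\<close> to the hole, let
  \<open>w'\<close> be the vertex after the last visit to \<open>v\<close>. The rest of the walk
  avoids the robot, so the hole can be pulled back to \<open>w'\<close>.\<close>

lemma cut_move_exists:
  assumes R: "robot_only V c v" and B: "block B" "v \<in> B" and h: "h \<in> holes_in c B"
  shows "\<exists>w'\<in>B. \<exists>c' c''. transfer_hole D h w' c c' \<and> move D v w' c' c''"
proof -
  have h': "h \<in> B" "c h = Hole" using h unfolding holes_in_def by auto
  have cv: "c v = Robot" using robot_onlyD(1)[OF R] .
  then have hv: "h \<noteq> v" using h' by auto
  have "(v, h) \<in> rtrancl_on (V - {}) A" using strong B h' block_subset[OF B(1)] by auto
  then have "(v, h) \<in> rtrancl_on (B - {}) A" by (rule block_reach[OF B h'(1) Un_upper1])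
  then have "(v, h) \<in> rtrancl_on (insert v B) A" using B(2) by (simp add: insert_absorb)
  then obtain w' where w': "(v, w') \<in> A" "(w', h) \<in> rtrancl_on (B - {v}) A"
    using rtrancl_on_last_exit[OF _ hv] by metis
  then have w'B: "w' \<in> B" "w' \<noteq> v" using in_rtrancl_on_in_F by fastforce+
  let ?c = "c(h := c w', w' := Hole)"
  have "transfer_hole D h w' c ?c"
  proof (rule transfer_hole_walk)
    show "(w', h) \<in> rtrancl_on (B - {v}) (arcs_ends D)" using w'(2) by simp
    show "B - {v} \<subseteq> verts D" using block_subset[OF B(1)] by auto
    show "c x \<noteq> Robot" if "x \<in> B - {v}" for x
      using robot_onlyD(3)[OF R, of x] that block_subset[OF B(1)] by auto
  qed (rule h'(2))
  moreover have "move D v w' ?c (?c(v := Hole, w' := ?c v))"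
    unfolding move_def using w'(1) w'B hv cv by auto
  ultimately show ?thesis using w'B(1) by blast
qed

lemma in_fetch_exists:
  assumes R: "robot_only V c v" and v: "v \<notin> cut_vertices" and B: "block B" "v \<in> B" "obstacles_in c B = {}"
    and x: "x \<in> obstacles_in c (side D t v)"
  shows "\<exists>w\<in>B. transfer_obstacle D x w c (c(x := Hole, w := Obstacle))"
proof -
  have x': "x \<in> V - {v}" "c x = Obstacle" using x unfolding obstacles_in_def side_def by auto
  have xB: "x \<notin> B" using x'(2) B(3) unfolding obstacles_in_def by auto
  \<comment> \<open>An obstacle travels along the arcs, from \<open>x\<close> into the block. The
    attaching vertex is therefore sought in the converse digraph.\<close>
  have rev: "(u, w) \<in> rtrancl_on V (A\<inverse>)" if "u \<in> V" "w \<in> V" for u w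
    using strong[OF that(2,1)] by (rule rtrancl_on_converseI)
  obtain a where a: "a \<in> B" "a \<noteq> v" "(a, x) \<in> rtrancl_on (insert a (V - B)) (A\<inverse>)"
    using not_cut_attach[OF B(1,2) v Un_upper2 x'(1) rev] by blast
  let ?F = "insert a (V - B)"
  have path: "(x, a) \<in> rtrancl_on ?F A" using a(3) by (rule rtrancl_on_converseD)
  have FV: "?F \<subseteq> V" using a(1) block_subset[OF B(1)] by auto
  have noR: "c y \<noteq> Robot" if "y \<in> ?F" for y
  proof -
    have "y \<noteq> v" using that a(2) B(2) by auto
    then show ?thesis using robot_onlyD(3)[OF R] that FV by blast
  qed
  have "c a \<noteq> Obstacle" using a(1) B(3) unfolding obstacles_in_def by auto
  then have ca: "c a = Hole" using noR[of a] by (cases "c a") auto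
  have "x \<noteq> a" using a(1) xB by auto
  then have eq: "c(x := Hole, a := Obstacle) = c(a := c x, x := Hole)"
    using x'(2) by (auto simp: fun_eq_iff)
  have "(go (A \<inter> ?F \<times> ?F) {})\<^sup>*\<^sup>* c (c(a := c x, x := Hole))"
    by (rule transfer_walk[where c = c, OF path noR ca])
  then have "moves_within D V {} c (c(x := Hole, a := Obstacle))"
    unfolding eq moves_within_go by (rule go_star_mono) (use FV in auto)
  then have "transfer_obstacle D x a c (c(x := Hole, a := Obstacle))"
    unfolding transfer_obstacle_def using x'(2) ca by simp
  then show ?thesis using a(1) by blast
qed

lemma non_side_not_cut:
  assumes "v \<notin> cut_vertices" "block B" "v \<in> B"
  shows "non_side D t v = {u \<in> V - B. \<not> conn (V - B) u t}"
  using side_not_cut[OF assms] assms(3) unfolding non_side_def by auto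

text \<open>The hole hangs on \<open>B\<close> at some \<open>a \<noteq> v\<close>. Once
  \<open>a\<close> holds an obstacle, exchanging it with the hole gives the required change of both
  counts.\<close>

lemma in_swap_exists:
  assumes R: "robot_only V c v" and v: "v \<notin> cut_vertices" and B: "block B" "v \<in> B"
    and o: "obstacles_in c B \<noteq> {}" and h: "h \<in> holes_in c (non_side D t v)"
  shows "\<exists>c'. moves_within D (B \<union> non_side D t v) B c c' \<and>
    card (holes_in c' B) = card (holes_in c B) + 1 \<and>
    card (holes_in c' (non_side D t v)) + 1 = card (holes_in c (non_side D t v))"
proof -
  let ?N = "non_side D t v"
  have N: "?N = {u \<in> V - B. \<not> conn (V - B) u t}" by (rule non_side_not_cut[OF v B])
  have h': "h \<in> V - B" "\<not> conn (V - B) h t" "c h = Hole" using h unfolding N holes_in_def by auto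
  then have "h \<in> V - {v}" using B(2) by auto
  then obtain a where a: "a \<in> B" "a \<noteq> v" "(a, h) \<in> rtrancl_on (insert a (V - B)) A"
    using not_cut_attach[OF B v Un_upper1 _ strong] by blast
  have "h \<noteq> a" using h'(1) a(1) by auto
  then obtain p where p: "(a, p) \<in> A" "(p, h) \<in> rtrancl_on (V - B - {a}) A"
    using rtrancl_on_last_exit[OF a(3)] by blast
  have "V - B - {a} = V - B" using a(1) by auto
  then have "(p, h) \<in> rtrancl_on (V - B) A" using p(2) by simp
  \<comment> \<open>The part of the walk outside \<open>B\<close> stays in one component of
    \<open>V - B\<close>, which does not contain \<open>t\<close>.\<close>
  then have ph: "(p, h) \<in> rtrancl_on ?N A"
  proof (induction rule: converse_rtrancl_on_induct)
    case base
    then show ?case using h' N by auto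
  next
    case (step x y)
    have "conn (V - B) x y" using step(1,3,4) by (intro conn_edge) auto
    moreover have "y \<in> ?N" by (rule in_rtrancl_on_in_F(1)[OF step(5)])
    then have "\<not> conn (V - B) y t" using N by simp
    ultimately have "\<not> conn (V - B) x t" using conn_sym conn_trans by blast
    then have "x \<in> ?N" using step(3) N by simp
    then show ?case by (rule converse_rtrancl_on_into_rtrancl_on[OF step(1,5)])
  qed
  have ah: "(a, h) \<in> rtrancl_on (insert a ?N) A"
  proof (rule converse_rtrancl_on_into_rtrancl_on[OF p(1)])
    show "(p, h) \<in> rtrancl_on (insert a ?N) A" by (rule rtrancl_on_mono[OF _ _ ph]) auto
  qed simp
  have ca: "c a \<noteq> Robot" using robot_onlyD(3)[OF R] a(1,2) block_subset[OF B(1)] by blast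
  obtain q where q: "q \<in> B" "c q = Obstacle" using o unfolding obstacles_in_def by blast
  \<comment> \<open>If \<open>a\<close> is itself a hole, that hole lets an obstacle of
    \<open>B\<close> be brought to \<open>a\<close>, at the price of possibly moving the robot
    inside \<open>B\<close>.\<close>
  have "\<exists>c1. (go (E \<inter> B \<times> B) UNIV)\<^sup>*\<^sup>* c c1 \<and> c1 a = Obstacle"
  proof (cases "c a = Obstacle")
    case False
    then have "c a = Hole" using ca by (cases "c a") auto
    then show ?thesis using block_inside_obstacle[where c = c, OF B(1) q a(1) a(1)] by blast
  qed blast
  then obtain c1 where c1: "(go (E \<inter> B \<times> B) UNIV)\<^sup>*\<^sup>* c c1" "c1 a = Obstacle" by blast
  have m1: "moves_within D B B c c1" by (rule block_moves_within[OF B(1) c1(1)])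
  then have m1': "moves_within D (B \<union> ?N) B c c1"
    unfolding moves_within_go by (rule go_star_mono) auto
  have out: "c1 x = c x" if "x \<notin> B" for x by (rule go_star_outside[OF c1(1) Int_lower2 that])
  have "card {x \<in> B. c1 x = Hole} = card {x \<in> B. c x = Hole}"
    by (rule go_star_cells[OF c1(1) Int_lower2])
  then have hB: "card (holes_in c1 B) = card (holes_in c B)" unfolding holes_in_def .
  have NB: "?N \<inter> B = {}" "?N \<subseteq> V" using N by auto
  have noR: "c1 x \<noteq> Robot" if x: "x \<in> insert a ?N" for x
  proof (cases "x = a")
    case False
    then have "x \<in> ?N" using x by simp
    then have "x \<notin> B" "x \<in> V" using NB by auto
    then have "c1 x = c x" "x \<noteq> v" using out B(2) by auto
    then show ?thesis using robot_onlyD(3)[OF R \<open>x \<in> V\<close>] by simp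
  qed (use c1(2) in simp)
  have hN: "h \<in> ?N" using h' N by simp
  then have c1h: "c1 h = Hole" using out[of h] h' by simp
  let ?c = "c1(h := c1 a, a := Hole)"
  have "(go (A \<inter> insert a ?N \<times> insert a ?N) B)\<^sup>*\<^sup>* c1 ?c"
    by (rule transfer_walk[where c = c1, OF ah noR c1h])
  then have "moves_within D (B \<union> ?N) B c1 ?c"
    unfolding moves_within_go by (rule go_star_mono) (use a(1) in auto)
  with m1' have m: "moves_within D (B \<union> ?N) B c ?c"
    unfolding moves_within_def by (rule rtranclp_trans)
  have finB: "finite (holes_in c1 B)"
    unfolding holes_in_def using finite_subset[OF block_subset[OF B(1)] fin] by simp
  have finN: "finite (holes_in c ?N)" unfolding holes_in_def using finite_subset[OF NB(2) fin] by simp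
  have "holes_in ?c B = insert a (holes_in c1 B)"
    unfolding holes_in_def using a(1) h'(1) by auto
  moreover have "a \<notin> holes_in c1 B" using c1(2) unfolding holes_in_def by simp
  ultimately have 1: "card (holes_in ?c B) = card (holes_in c B) + 1" using hB finB by simp
  have "c1 x = c x" if "x \<in> ?N" for x using out that NB(1) by blast
  then have "holes_in ?c ?N = holes_in c ?N - {h}"
    unfolding holes_in_def using NB(1) a(1) c1(2) by auto
  moreover have "Suc (card (holes_in c ?N - {h})) = card (holes_in c ?N)"
    using finN h by (intro card.remove[symmetric]) auto
  ultimately have 2: "card (holes_in ?c ?N) + 1 = card (holes_in c ?N)" by simp
  show ?thesis using m 1 2 by blast
qed

lemma in_return_exists:
  assumes R: "robot_only V c p" and B: "block B" "v \<in> B" "p \<in> B" and h: "holes_in c B \<noteq> {}"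
  shows "\<exists>c'. moves_within D B B c c' \<and> c' v = Robot"
proof -
  obtain h where h: "h \<in> B" "c h = Hole" using h unfolding holes_in_def by blast
  have "robot_only B c p" using R B(3) block_subset[OF B(1)] unfolding robot_only_def by blast
  then obtain c' where "(go (E \<inter> B \<times> B) UNIV)\<^sup>*\<^sup>* c c'" "c' v = Robot"
    using block_inside_goal[where c = c, OF B(1) _ B(2) h] by blast
  then show ?thesis using block_moves_within[OF B(1)] by blast
qed

end

section \<open>Invariant, termination measure and result of a run\<close>

locale fscd = sc_digraph +
  fixes t :: 'a and f :: "'a config"
  assumes tV: "t \<in> V"
begin

definition good :: "'a config \<Rightarrow> 'a \<Rightarrow> bool" where
  "good c v \<longleftrightarrow> robot_only V c v \<and> v \<noteq> t \<and> reach f c"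

text \<open>Each clause holds what the following instructions need in order to be executable. In
  \<open>In_Return\<close> the robot may have been displaced inside the block, but a hole is there
  to bring it back.\<close>

primrec invariant :: "'a state \<Rightarrow> bool" where
  "invariant (Loop c) \<longleftrightarrow> (\<exists>v. good c v)"
| "invariant (Cut_Fetch c v B) \<longleftrightarrow> good c v \<and> v \<in> cut_vertices \<and> block (verts B) \<and> v \<in> verts B \<and>
     verts B \<inter> side D t v = {} \<and> (\<exists>w\<in>verts B. w \<noteq> v \<and> holes_in c (side D w v) \<noteq> {})"
| "invariant (Cut_Move c v B) \<longleftrightarrow> good c v \<and> v \<in> cut_vertices \<and> block (verts B) \<and> v \<in> verts B \<and>
     verts B \<inter> side D t v = {} \<and> holes_in c (verts B) \<noteq> {}"
| "invariant (In_Fetch c v B) \<longleftrightarrow> good c v \<and> v \<notin> cut_vertices \<and> block (verts B) \<and> v \<in> verts B \<and>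
     obstacles_in c (side D t v) \<noteq> {} \<and> holes_in c (non_side D t v) \<noteq> {}"
| "invariant (In_Swap c v B) \<longleftrightarrow> good c v \<and> v \<notin> cut_vertices \<and> block (verts B) \<and> v \<in> verts B \<and>
     obstacles_in c (verts B) \<noteq> {} \<and> holes_in c (non_side D t v) \<noteq> {}"
| "invariant (In_Return c v B) \<longleftrightarrow> (\<exists>p\<in>verts B. robot_only V c p) \<and> v \<noteq> t \<and> reach f c \<and> v \<notin> cut_vertices \<and>
     block (verts B) \<and> v \<in> verts B \<and> holes_in c (verts B) \<noteq> {}"
| "invariant (Decide c) \<longleftrightarrow> (\<exists>v. good c v) \<and> \<not> loop_cond D t c"
| "invariant (Return b) \<longleftrightarrow> (b \<longleftrightarrow> robot_can_reach D f t)"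

definition robot_pos :: "'a config \<Rightarrow> 'a" where
  "robot_pos c = (THE v. robot_only V c v)"

definition separated :: "'a \<Rightarrow> nat" where
  "separated v = card (V - region v t)"

definition outer_holes :: "'a config \<Rightarrow> 'a \<Rightarrow> nat" where
  "outer_holes c v = card (holes_in c (non_side D t v))"

text \<open>At a cut vertex the robot moves away from \<open>t\<close>; otherwise it keeps its position and the number
  of holes on its non-\<open>t\<close>-side drops.\<close>

primrec rank :: "'a state \<Rightarrow> nat \<times> nat \<times> nat" where
  "rank (Loop c) = (separated (robot_pos c), outer_holes c (robot_pos c), 5)"
| "rank (Cut_Fetch c v B) = (separated v, 0, 3)"
| "rank (Cut_Move c v B) = (separated v, 0, 2)"
| "rank (In_Fetch c v B) = (separated v, outer_holes c v, 4)"
| "rank (In_Swap c v B) = (separated v, outer_holes c v, 3)"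
\<comment> \<open>The value may rise from 3 to 6 because entering this location lowers the second
  component. It exceeds that of \<open>Loop\<close> because returning to \<open>v\<close> changes
  neither of the first two.\<close>
| "rank (In_Return c v B) = (separated v, outer_holes c v, 6)"
| "rank (Decide c) = (0, 0, 1)"
| "rank (Return b) = (0, 0, 0)"

abbreviation rank_order where
  "rank_order \<equiv> less_than <*lex*> less_than <*lex*> less_than"

lemma robot_pos_eq: "robot_only V c v \<Longrightarrow> robot_pos c = v"
  unfolding robot_pos_def by (rule the_equality) (auto simp: robot_only_def)

lemma robot_at_iff: "robot_only V c v \<Longrightarrow> robot_at D c u \<longleftrightarrow> u = v"
  unfolding robot_at_def robot_only_def by auto

lemma moves_within_robot:
  assumes "moves_within D X Y c c'" "robot_only V c v"
  shows "\<exists>v'. robot_only V c' v' \<and> (v' = v \<or> v' \<in> Y)"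
  using go_star_robot[of "A \<inter> X \<times> X" Y c c' V v] assms AV unfolding moves_within_go by auto

lemma good_still:
  assumes "good c v" "moves_within D X {} c c'"
  shows "good c' v"
proof -
  have "robot_only V c' v" using moves_within_robot[OF assms(2)] assms(1) unfolding good_def by blast
  then show ?thesis
    using assms(1) rtranclp_trans[OF _ moves_within_reach[OF assms(2)]] unfolding good_def by blast
qed

lemma invariant_step_cut_move:
  assumes i: "invariant (Cut_Move c v B)" and w: "w' \<in> verts B"
    and tr: "transfer_hole D h w' c c'" and mv: "move D v w' c' c''"
  shows "invariant (Loop c'') \<and> (rank (Loop c''), rank (Cut_Move c v B)) \<in> rank_order"
proof -
  have g: "good c v" and v: "v \<in> cut_vertices" and B: "block (verts B)" "v \<in> verts B" "verts B \<inter> side D t v = {}"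
    using i by auto
  have g': "good c' v" using good_still[OF g] tr unfolding transfer_hole_def by blast
  have cv: "c' v = Robot" using g' robot_onlyD(1)[of V c' v] unfolding good_def by blast
  have m: "(v, w') \<in> A" "c' w' = Hole" "c'' = c'(v := Hole, w' := Robot)"
    using mv cv unfolding move_def by auto
  have "w' \<noteq> v" using m(2) cv by auto
  moreover have "w' \<in> V" using m(1) AV by auto
  ultimately have R: "robot_only V c'' w'"
    unfolding m(3) using g' robot_only_slide unfolding good_def by blast
  have vV: "v \<in> V" "v \<noteq> t" using g robot_onlyD(2) unfolding good_def by auto
  have tr: "t \<in> region v t" unfolding region_def using vV tV by auto
  have w'r: "w' \<notin> region v t" using w B(3) side_cut[OF v, of t] by blast
  \<comment> \<open>\<open>t\<close> is on its own side of \<open>v\<close>, whereas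
    \<open>B\<close> avoids that side; so the loop never puts the robot on \<open>t\<close>.\<close>
  then have "w' \<noteq> t" using tr by blast
  have "go E UNIV c' c''" unfolding go_def using m cv by (intro exI[of _ v] exI[of _ w']) auto
  then have "good c'' w'"
    using R \<open>w' \<noteq> t\<close> g' rtranclp.rtrancl_into_rtrancl[of "go E UNIV" f c' c''] unfolding good_def by blast
  moreover have "separated w' < separated v"
    unfolding separated_def
  proof (rule psubset_card_mono)
    have "region v t \<subset> region w' t" using region_grows[OF vV(1) tV vV(2) w'r \<open>w' \<noteq> v\<close>] .
    then show "V - region w' t \<subset> V - region v t" using region_subset[of w' t] by blast
  qed (use fin in simp)
  ultimately show ?thesis using robot_pos_eq[OF R] by auto
qed

lemma side_disjoint: "u \<in> side D t v \<Longrightarrow> u \<notin> non_side D t v"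
  unfolding non_side_def by simp

lemma block_non_side:
  assumes "v \<notin> cut_vertices" "block B" "v \<in> B" "u \<in> B"
  shows "u \<notin> non_side D t v"
  using non_side_not_cut[OF assms(1-3)] assms(4) by auto

lemma outer_holes_cong:
  "(\<And>x. x \<in> non_side D t v \<Longrightarrow> c' x = c x) \<Longrightarrow> outer_holes c' v = outer_holes c v"
  unfolding outer_holes_def holes_in_def by (rule arg_cong[of _ _ card]) auto

lemma invariant_step_in_fetch:
  assumes i: "invariant (In_Fetch c v B)" and x: "x \<in> obstacles_in c (side D t v)" and w: "w \<in> verts B"
    and tr: "transfer_obstacle D x w c c'"
  shows "invariant (In_Swap c' v B) \<and> (rank (In_Swap c' v B), rank (In_Fetch c v B)) \<in> rank_order"
proof -
  have g: "good c v" and v: "v \<notin> cut_vertices" and B: "block (verts B)" "v \<in> verts B"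
    and h: "holes_in c (non_side D t v) \<noteq> {}"
    using i by auto
  have tr': "c' = c(x := Hole, w := Obstacle)" "moves_within D V {} c c'"
    using tr unfolding transfer_obstacle_def by auto
  have x: "x \<in> side D t v" using x unfolding obstacles_in_def by simp
  have "c' y = c y" if "y \<in> non_side D t v" for y
    using that tr'(1) side_disjoint[OF x] block_non_side[OF v B w] by auto
  moreover from this have "holes_in c' (non_side D t v) \<noteq> {}" using h unfolding holes_in_def by auto
  moreover have "obstacles_in c' (verts B) \<noteq> {}" using w tr'(1) unfolding obstacles_in_def by auto
  ultimately show ?thesis using good_still[OF g tr'(2)] v B outer_holes_cong[of v c' c] by auto
qed

lemma invariant_step_in_swap:
  assumes i: "invariant (In_Swap c v B)" and mv: "moves_within D (verts B \<union> non_side D t v) (verts B) c c'"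
    and 1: "card (holes_in c' (verts B)) = card (holes_in c (verts B)) + 1"
    and 2: "card (holes_in c' (non_side D t v)) + 1 = card (holes_in c (non_side D t v))"
  shows "invariant (In_Return c' v B) \<and> (rank (In_Return c' v B), rank (In_Swap c v B)) \<in> rank_order"
proof -
  have g: "good c v" and v: "v \<notin> cut_vertices" and B: "block (verts B)" "v \<in> verts B"
    using i by auto
  have "\<exists>p\<in>verts B. robot_only V c' p"
    using moves_within_robot[OF mv] g B(2) unfolding good_def by blast
  moreover have "reach f c'"
    using g rtranclp_trans[OF _ moves_within_reach[OF mv]] unfolding good_def by blast
  moreover have "holes_in c' (verts B) \<noteq> {}" using 1 by auto
  ultimately show ?thesis using g v B 2 by (auto simp: good_def outer_holes_def)
qed

lemma invariant_step_in_return: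
  assumes i: "invariant (In_Return c v B)" and mv: "moves_within D (verts B) (verts B) c c'" and c'v: "c' v = Robot"
  shows "invariant (Loop c') \<and> (rank (Loop c'), rank (In_Return c v B)) \<in> rank_order"
proof -
  obtain p where p: "robot_only V c p" using i by auto
  have B: "v \<notin> cut_vertices" "block (verts B)" "v \<in> verts B" and c: "v \<noteq> t" "reach f c" using i by auto
  obtain p' where "robot_only V c' p'" using moves_within_robot[OF mv p] by blast
  moreover have "v \<in> V" using B block_subset by blast
  ultimately have R: "robot_only V c' v" using c'v robot_onlyD(3) by metis
  have "reach f c'" by (rule rtranclp_trans[OF c(2) moves_within_reach[OF mv]])
  then have "good c' v" unfolding good_def using R c(1) by blast
  moreover have "outer_holes c' v = outer_holes c v"
  proof (rule outer_holes_cong)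
    fix x assume x: "x \<in> non_side D t v"
    have "(go (A \<inter> verts B \<times> verts B) (verts B))\<^sup>*\<^sup>* c c'" using mv by (simp add: moves_within_go)
    moreover have "x \<notin> verts B" using block_non_side[OF B] x by blast
    ultimately show "c' x = c x"
      using go_star_outside[of "A \<inter> verts B \<times> verts B" "verts B" c c' "verts B" x] by blast
  qed
  ultimately show ?thesis using robot_pos_eq[OF R] by auto
qed

text \<open>As \<open>reach\<close> is symmetric, a position that can be reached from
  \<open>f\<close> admits the same continuations as \<open>f\<close>.\<close>

lemma can_reach_iff: "reach f c \<Longrightarrow> robot_can_reach D f t \<longleftrightarrow> (\<exists>c'. reach c c' \<and> c' t = Robot)"
  unfolding robot_can_reach_def moves_reach using reach_sym by (meson rtranclp_trans)

lemma invariant_step: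
  assumes "fscd_step D t S S'" "invariant S"
  shows "invariant S' \<and> (rank S', rank S) \<in> rank_order"
  using assms
proof (induction rule: fscd_step.induct)
  case (cut_select c v B)
  then obtain v' where g: "good c v'" by auto
  then have R: "robot_only V c v'" unfolding good_def by blast
  have "v' = v" using robot_at_iff[OF R, of v] cut_select(2) by blast
  then show ?case using g cut_select sb_verts robot_pos_eq[OF R] W_sbc_eq by auto
next
  case (cut_no_fetch c B v)
  then show ?case by auto
next
  case (cut_fetch c B w h c' v)
  have g: "good c v" using cut_fetch by simp
  have m: "moves_within D V {} c c'" "c' w = Hole" using cut_fetch(4) unfolding transfer_hole_def by auto
  have "holes_in c' (verts B) \<noteq> {}" using m(2) cut_fetch(2) unfolding holes_in_def by blast
  then show ?case using good_still[OF g m(1)] cut_fetch by auto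
next
  case (cut_move h c B w' c' v c'')
  then show ?case using invariant_step_cut_move by blast
next
  case (in_select c v B)
  then obtain v' where g: "good c v'" by auto
  then have R: "robot_only V c v'" unfolding good_def by blast
  have v: "v' = v" using robot_at_iff[OF R, of v] in_select(2) by blast
  have "obstacles_in c (side D t v) \<noteq> {} \<and> holes_in c (non_side D t v) \<noteq> {}"
    using in_select(1) robot_at_iff[OF R] v unfolding loop_cond_def by auto
  then show ?case using g v in_select sb_verts robot_pos_eq[OF R] W_sbc_eq by auto
next
  case (in_no_fetch c B v)
  then show ?case by auto
next
  case (in_fetch c B x v w c')
  then show ?case using invariant_step_in_fetch by blast
next
  case (in_swap B v c c')
  then show ?case using invariant_step_in_swap by blast
next
  case (in_return B c c' v)
  then show ?case using invariant_step_in_return by blast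
next
  case (exit c)
  then show ?case by auto
next
  case (decide_common c s')
  then obtain v where g: "good c v" and ex: "\<not> loop_cond D t c" by auto
  then have R: "robot_only V c v" "t \<noteq> v" "reach f c" unfolding good_def by auto
  have v: "s' = v" using robot_at_iff[OF R(1)] decide_common(1) by blast
  obtain B where B: "B \<in> sb_components D" "v \<in> verts B" "t \<in> verts B"
    using decide_common(2) unfolding v by blast
  then show ?case
    using decide_common_correct[OF R(1) tV R(2) ex sb_verts[OF B(1)] B(2,3)] can_reach_iff[OF R(3)] v by auto
next
  case (decide_path c s' Bs vs)
  then obtain v where g: "good c v" and ex: "\<not> loop_cond D t c" by auto
  then have R: "robot_only V c v" "t \<noteq> v" "reach f c" unfolding good_def by auto
  have v: "s' = v" using robot_at_iff[OF R(1)] decide_path(1) by blast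
  show ?case
    using decide_path_correct[OF R(1) tV R(2) ex] decide_path(3) can_reach_iff[OF R(3)] v by auto
qed

lemma invariant_progress:
  assumes "invariant S" "\<nexists>S'. fscd_step D t S S'"
  shows "\<exists>b. S = Return b"
proof (rule ccontr)
  assume ret: "\<nexists>b. S = Return b"
  have "\<exists>S'. fscd_step D t S S'"
  proof (cases S)
    case (Loop c)
    then obtain v where g: "good c v" using assms(1) by auto
    then have R: "robot_only V c v" "v \<noteq> t" and vV: "v \<in> V" unfolding good_def using robot_onlyD(2) by auto
    have at: "robot_at D c v" using robot_at_iff[OF R(1)] by simp
    show ?thesis
    proof (cases "loop_cond D t c")
      case False
      then show ?thesis using fscd_step.exit[OF False] Loop by blast
    next
      case lc: True
      then obtain h where h: "h \<in> holes_in c (non_side D t v)"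
        using robot_at_iff[OF R(1)] unfolding loop_cond_def by auto
      show ?thesis
      proof (cases "v \<in> cut_vertices")
        case True
        then obtain B where "B \<in> sb_components D" "v \<in> verts B" "verts B \<inter> side D t v = {}"
          "\<exists>w\<in>verts B. w \<noteq> v \<and> holes_in c (side D w v) \<noteq> {}"
          using cut_select_exists[OF R(1) tV R(2) _ h] by blast
        then show ?thesis using fscd_step.cut_select[OF lc at] True W_sbc_eq Loop by blast
      next
        case False
        obtain S' where "block S'" "v \<in> S'" using block_at vV by blast
        then obtain B where "B \<in> sb_components D" "v \<in> verts B" using sb_of_block by blast
        then show ?thesis using fscd_step.in_select[OF lc at] False W_sbc_eq Loop by blast
      qed
    qed
  next
    case (Cut_Fetch c v B)
    then have i: "good c v" "v \<in> cut_vertices" "block (verts B)" "v \<in> verts B" "verts B \<inter> side D t v = {}"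
      "\<exists>w\<in>verts B. w \<noteq> v \<and> holes_in c (side D w v) \<noteq> {}" using assms(1) by auto
    show ?thesis
    proof (cases "holes_in c (verts B) = {}")
      case False
      then show ?thesis using fscd_step.cut_no_fetch[OF False] Cut_Fetch by blast
    next
      case True
      obtain w h where w: "w \<in> verts B" "w \<noteq> v" "h \<in> holes_in c (side D w v)" using i(6) by blast
      have R: "robot_only V c v" "v \<noteq> t" using i(1) unfolding good_def by auto
      show ?thesis
        using cut_fetch_exists[OF R(1) tV R(2) i(2-5) True w] fscd_step.cut_fetch[OF True] Cut_Fetch by blast
    qed
  next
    case (Cut_Move c v B)
    then have i: "good c v" "block (verts B)" "v \<in> verts B" "holes_in c (verts B) \<noteq> {}"
      using assms(1) by auto
    obtain h where h: "h \<in> holes_in c (verts B)" using i(4) by blast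
    have R: "robot_only V c v" using i(1) unfolding good_def by blast
    show ?thesis using cut_move_exists[OF R i(2,3) h] fscd_step.cut_move[OF h] Cut_Move by blast
  next
    case (In_Fetch c v B)
    then have i: "good c v" "v \<notin> cut_vertices" "block (verts B)" "v \<in> verts B" "obstacles_in c (side D t v) \<noteq> {}"
      using assms(1) by auto
    have R: "robot_only V c v" using i(1) unfolding good_def by blast
    show ?thesis
    proof (cases "obstacles_in c (verts B) = {}")
      case False
      then show ?thesis using fscd_step.in_no_fetch[OF False] In_Fetch by blast
    next
      case True
      obtain x where x: "x \<in> obstacles_in c (side D t v)" using i(5) by blast
      show ?thesis using in_fetch_exists[OF R i(2-4) True x] fscd_step.in_fetch[OF True x] In_Fetch by blast
    qed
  next
    case (In_Swap c v B)
    then have i: "good c v" "v \<notin> cut_vertices" "block (verts B)" "v \<in> verts B" "obstacles_in c (verts B) \<noteq> {}"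
      "holes_in c (non_side D t v) \<noteq> {}" using assms(1) by auto
    have R: "robot_only V c v" using i(1) unfolding good_def by blast
    obtain h where h: "h \<in> holes_in c (non_side D t v)" using i(6) by blast
    show ?thesis using in_swap_exists[OF R i(2-5) h] fscd_step.in_swap[where D = D and t = t] In_Swap by blast
  next
    case (In_Return c v B)
    then obtain p where i: "p \<in> verts B" "robot_only V c p" "block (verts B)" "v \<in> verts B"
      "holes_in c (verts B) \<noteq> {}" using assms(1) by auto
    show ?thesis using in_return_exists[OF i(2-4,1,5)] fscd_step.in_return[where D = D and t = t] In_Return by blast
  next
    case (Decide c)
    then obtain v where g: "good c v" using assms(1) by auto
    then have R: "robot_only V c v" "v \<noteq> t" and vV: "v \<in> V" unfolding good_def using robot_onlyD(2) by auto
    have at: "robot_at D c v" using robot_at_iff[OF R(1)] by simp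
    show ?thesis
    proof (cases "\<exists>B\<in>sb_components D. v \<in> verts B \<and> t \<in> verts B")
      case True
      then show ?thesis using fscd_step.decide_common[OF at] Decide by blast
    next
      case False
      have "\<not> (\<exists>S. block S \<and> v \<in> S \<and> t \<in> S)" using False sb_of_block by blast
      then obtain Bs vs where "sbc_path D v t Bs vs" using sbc_path_exists[OF vV tV] by blast
      then show ?thesis using fscd_step.decide_path[OF at False] Decide by blast
    qed
  next
    case (Return b)
    then show ?thesis using ret by blast
  qed
  then show False using assms(2) by blast
qed

lemma wf_rank_order: "wf rank_order"
  by (intro wf_lex_prod wf_less_than)

lemma returns:
  assumes "invariant (Loop f)"
  shows "fscd_returns D t f (robot_can_reach D f t)"
  unfolding fscd_returns_def
proof (intro conjI allI impI notI)
  assume "\<exists>\<sigma>. \<sigma> 0 = Loop f \<and> (\<forall>n. fscd_step D t (\<sigma> n) (\<sigma> (Suc n)))"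
  then obtain \<sigma> where \<sigma>: "\<sigma> 0 = Loop f" "\<And>n. fscd_step D t (\<sigma> n) (\<sigma> (Suc n))" by blast
  have invariant: "invariant (\<sigma> n)" for n
    by (induction n) (use \<sigma> assms invariant_step in \<open>auto simp del: invariant.simps\<close>)
  then have "\<forall>n. (rank (\<sigma> (Suc n)), rank (\<sigma> n)) \<in> rank_order" using invariant_step[OF \<sigma>(2)] by blast
  then have "\<exists>g. \<forall>n. (g (Suc n), g n) \<in> rank_order" by (rule exI[of _ "\<lambda>n. rank (\<sigma> n)"])
  then show False using wf_iff_no_infinite_down_chain[THEN iffD1, OF wf_rank_order] by blast
next
  fix S assume S: "(fscd_step D t)\<^sup>*\<^sup>* (Loop f) S \<and> (\<nexists>S'. fscd_step D t S S')"
  then have "(fscd_step D t)\<^sup>*\<^sup>* (Loop f) S" by blast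
  then have "invariant S"
    by (induction rule: rtranclp_induct) (use assms invariant_step in \<open>blast+\<close>)
  moreover from this obtain b where "S = Return b" using invariant_progress S by blast
  ultimately show "S = Return (robot_can_reach D f t)" by simp
qed

end

theorem theorem10:
  fixes D :: "'a pair_pre_digraph" and s t :: 'a and f :: "'a config"
  assumes "pair_digraph D"
    and "strongly_connected (with_proj D)"
    and "s \<in> pverts D" and "t \<in> pverts D" and "s \<noteq> t"
    and "\<forall>x\<in>pverts D. f x = Robot \<longleftrightarrow> x = s"
  shows "\<exists>b. fscd_returns (with_proj D) t f b \<and> (b \<longleftrightarrow> robot_can_reach (with_proj D) f t)"
proof -
  interpret fscd D t f
    by (intro fscd.intro sc_digraph.intro fscd_axioms.intro) (use assms in auto)
  have "robot_only (pverts D) f s" unfolding robot_only_def using assms(3,6) by auto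
  then have "invariant (Loop f)" unfolding invariant.simps good_def using assms(5) by blast
  then show ?thesis using returns by blast
qed

end
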